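(* Let $\alpha\ge 0$, $\beta>0$, $1\le p\le\infty$ and $m>\alpha-1$. For a double indexed sequence of complex numbers $c=\{c_k^j : k\ge 0,\ 1\le j\le d_k\}$ the following conditions are equivalent: 1. $c\in M_H(H^1_\alpha, H^p_\beta)$. 2. The function $g(x)=\sum_{k\ge 0} r^k\sum_{j=1}^{d_k} c_k^j Y_j^{(k)}(x')$, $x=rx'$, is harmonic in $\mathbb B$ and $$N_p(g)=\sup_{0\le\rho<1}\ \sup_{y'\in\mathbb S}\ (1-\rho)^{m+1-\alpha+\beta}\left(\int_{\mathbb S}|\Lambda_{m+1}(g\ast P_{x'})(\rho y')|^p\,dx'\right)^{1/p}<\infty ,$$ where for $p=\infty$ the $L^p(dx')$-norm is replaced by $\sup_{x'\in\mathbb S}|\Lambda_{m+1}(g\ast P_{x'})(\rho y')|$.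
   Context: Let $n\ge 2$, let $\mathbb B$ be the open unit ball of $\mathbb R^n$, $\mathbb S=\partial\mathbb B$, and write $x=rx'$ with $r=|x|$, $x'\in\mathbb S$. $dx'$ is the rotation-invariant surface measure on $\mathbb S$ (fixed normalization). $h(\mathbb B)$ is the space of (complex-valued) harmonic functions on $\mathbb B$. For each $k\ge0$ let $Y^{(k)}_j$, $1\le j\le d_k$, be real-valued spherical harmonics of order $k$ ($d_k$ is the dimension of the space of spherical harmonics of order $k$), chosen so that the whole family $\{Y_j^{(k)}\}_{k\ge 0,\,1\le j\le d_k}$ is an orthonormal basis of $L^2(\mathbb S,dx')$; this basis is fixed. Every $f\in h(\mathbb B)$ has an expansion $f(rx')=\sum_{k\ge0} r^k\sum_{j=1}^{d_k} b_k^j(f)Y_j^{(k)}(x')$. For $y'\in\mathbb S$ the Poisson kernel is $P_{y'}(rx')=\sum_{k\ge0} r^k\sum_{j=1}^{d_k}Y_j^{(k)}(y')Y_j^{(k)}(x')$. For $f,g\in h(\mathbb B)$ the convolution is $(f\ast g)(rx')=\sum_{k\ge 0}\sum_{j=1}^{d_k} r^k b_k^j(f)b_k^j(g)Y_j^{(k)}(x')$, which is harmonic in $\mathbb B$. For a double indexed sequence $c$ and $f\in h(\mathbb B)$, $(c\ast f)(rx')=\sum_{k\ge 0}\sum_{j=1}^{d_k} r^k c_k^j b_k^j(f)Y_j^{(k)}(x')$, if the series converges in $\mathbb B$. For $t>0$ the fractional derivative of $f\in h(\mathbb B)$ of order $t$ is $$(\Lambda_t f)(rx')=\sum_{k\ge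 0} r^k\frac{\Gamma(k+n/2+t)}{\Gamma(k+n/2)\Gamma(t)}\sum_{j=1}^{d_k}b_k^j(f)Y_j^{(k)}(x').$$ In $\Lambda_{m+1}(g\ast P_{x'})(\rho y')$ the operator acts on the harmonic function $g\ast P_{x'}$ ($x'$ fixed), and the result is evaluated at $\rho y'$. For subspaces $X,Y\subset h(\mathbb B)$, $M_H(X,Y)$ is the set of all double indexed sequences $c$ such that $c\ast f\in Y$ for every $f\in X$ (multipliers from $X$ to $Y$). $M_p(f,r)=\left(\int_{\mathbb S}|f(rx')|^p dx'\right)^{1/p}$ for $0<p<\infty$ and $M_\infty(f,r)=\sup_{x'\in\mathbb S}|f(rx')|$. For $0<p\le\infty$, $\alpha\ge0$, $H^p_\alpha$ is the space of $f\in h(\mathbb B)$ with $\sup_{0\le r<1}M_p(f,r)(1-r)^\alpha<\infty$. *)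

theory Defs
  imports "HOL-Analysis.Analysis" "HOL-Library.Function_Algebras"
begin

text \<open>
  Functions on the open unit ball are total functions of which only the values on \<open>ball 0 1\<close>
  matter.  Double indexed families \<open>c k j\<close> matter only for \<open>1 \<le> j \<le> d\<^sub>k\<close>.
\<close>

text \<open>Twice continuously differentiable (in the Frechet sense) with vanishing Laplacian, the trace
  of the second derivative; intended for open sets \<open>S\<close>, where the derivatives are unique.\<close>

definition harmonic_on ::
    "('a::euclidean_space \<Rightarrow> 'b::real_normed_vector) \<Rightarrow> 'a set \<Rightarrow> bool" where
  "harmonic_on f S \<longleftrightarrow>
     (\<exists>(f' :: 'a \<Rightarrow> 'a \<Rightarrow>\<^sub>L 'b) (f'' :: 'a \<Rightarrow> 'a \<Rightarrow>\<^sub>L ('a \<Rightarrow>\<^sub>L 'b)).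
        (\<forall>x\<in>S. (f has_derivative blinfun_apply (f' x)) (at x)) \<and>
        (\<forall>x\<in>S. (f' has_derivative blinfun_apply (f'' x)) (at x)) \<and>
        continuous_on S f'' \<and>
        (\<forall>x\<in>S. (\<Sum>b\<in>Basis. f'' x b b) = 0))"

text \<open>Surface area of a Borel subset \<open>A\<close> of the unit sphere is \<open>n\<close> times the volume of the cone
  \<open>{s *\<^sub>R x |s x. 0 < s \<and> s < 1 \<and> x \<in> A}\<close>.\<close>

definition surface_measure :: "'a::euclidean_space measure" where
  "surface_measure =
     scale_measure (of_nat DIM('a))
       (distr (restrict_space lborel (ball 0 1 - {0})) (restrict_space borel (sphere 0 1)) sgn)"

text \<open>Restrictions to the unit sphere of homogeneous harmonic polynomials of degree \<open>k\<close>.  A function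
  on the sphere is represented by its extension by zero, so that distinct elements are distinct
  functions on the sphere and the dimension below is the correct one.\<close>

definition spherical_harmonics :: "nat \<Rightarrow> ('a::euclidean_space \<Rightarrow> real) set" where
  "spherical_harmonics k =
     {\<lambda>x. if x \<in> sphere 0 1 then q x else 0 |q.
        real_polynomial_function q \<and> (\<forall>s x. q (s *\<^sub>R x) = s ^ k * q x) \<and> harmonic_on q UNIV}"

definition sph_dim :: "'a::euclidean_space itself \<Rightarrow> nat \<Rightarrow> nat" where
  "sph_dim _ k =
     vector_space.dim (\<lambda>(s::real) f x. s * f x) (spherical_harmonics k :: ('a \<Rightarrow> real) set)"

text \<open>Orthonormality together with density of the linear span in (complex) \<open>L\<^sup>2\<close>.\<close>

definition spherical_harmonic_basis ::
    "'a::euclidean_space measure \<Rightarrow> (nat \<Rightarrow> nat \<Rightarrow> 'a \<Rightarrow> real) \<Rightarrow> bool" where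
  "spherical_harmonic_basis \<sigma> Y \<longleftrightarrow>
     (\<forall>k. \<forall>j\<in>{1..sph_dim TYPE('a) k}. Y k j \<in> spherical_harmonics k) \<and>
     (\<forall>k l. \<forall>j\<in>{1..sph_dim TYPE('a) k}. \<forall>i\<in>{1..sph_dim TYPE('a) l}.
        (LINT x|\<sigma>. Y k j x * Y l i x) = (if k = l \<and> j = i then 1 else 0)) \<and>
     (\<forall>u :: 'a \<Rightarrow> complex. u \<in> borel_measurable \<sigma> \<and> integrable \<sigma> (\<lambda>x. (cmod (u x))\<^sup>2) \<longrightarrow>
        (\<forall>e>0. \<exists>K a.
           (LINT x|\<sigma>. (cmod (u x -
              (\<Sum>k\<le>K. \<Sum>j=1..sph_dim TYPE('a) k. a k j * complex_of_real (Y k j x))))\<^sup>2) < e))"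

text \<open>The \<open>x'\<close> of \<open>x = r x'\<close>.  At the origin any unit vector will do: only the constant term
  \<open>k = 0\<close> of an expansion survives there.\<close>

definition direction :: "'a::euclidean_space \<Rightarrow> 'a" where
  "direction x = (if x = 0 then (SOME u. u \<in> sphere 0 1) else sgn x)"

definition harmonic_term ::
    "(nat \<Rightarrow> nat \<Rightarrow> 'a::euclidean_space \<Rightarrow> real) \<Rightarrow> (nat \<Rightarrow> nat \<Rightarrow> complex) \<Rightarrow> 'a \<Rightarrow> nat \<Rightarrow> complex" where
  "harmonic_term Y c x k =
     of_real (norm x ^ k) * (\<Sum>j=1..sph_dim TYPE('a) k. c k j * of_real (Y k j (direction x)))"

definition harmonic_series ::
    "(nat \<Rightarrow> nat \<Rightarrow> 'a::euclidean_space \<Rightarrow> real) \<Rightarrow> (nat \<Rightarrow> nat \<Rightarrow> complex) \<Rightarrow> 'a \<Rightarrow> complex" where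
  "harmonic_series Y c x = (\<Sum>k. harmonic_term Y c x k)"

definition series_converges ::
    "(nat \<Rightarrow> nat \<Rightarrow> 'a::euclidean_space \<Rightarrow> real) \<Rightarrow> (nat \<Rightarrow> nat \<Rightarrow> complex) \<Rightarrow> bool" where
  "series_converges Y c \<longleftrightarrow> (\<forall>x\<in>ball 0 1. summable (harmonic_term Y c x))"

text \<open>The coefficients of the expansion of \<open>f\<close>; for \<open>f\<close> harmonic on the ball they exist and are
  unique for \<open>1 \<le> j \<le> d\<^sub>k\<close>.\<close>

definition coefficients ::
    "(nat \<Rightarrow> nat \<Rightarrow> 'a::euclidean_space \<Rightarrow> real) \<Rightarrow> ('a \<Rightarrow> complex) \<Rightarrow> nat \<Rightarrow> nat \<Rightarrow> complex" where
  "coefficients Y f = (SOME b. \<forall>x\<in>ball 0 1. harmonic_term Y b x sums f x)"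

definition poisson_kernel ::
    "(nat \<Rightarrow> nat \<Rightarrow> 'a::euclidean_space \<Rightarrow> real) \<Rightarrow> 'a \<Rightarrow> 'a \<Rightarrow> complex" where
  "poisson_kernel Y y = harmonic_series Y (\<lambda>k j. of_real (Y k j y))"

definition convolution ::
    "(nat \<Rightarrow> nat \<Rightarrow> 'a::euclidean_space \<Rightarrow> real) \<Rightarrow> ('a \<Rightarrow> complex) \<Rightarrow> ('a \<Rightarrow> complex) \<Rightarrow> 'a \<Rightarrow> complex" where
  "convolution Y f g = harmonic_series Y (\<lambda>k j. coefficients Y f k j * coefficients Y g k j)"

definition frac_deriv ::
    "(nat \<Rightarrow> nat \<Rightarrow> 'a::euclidean_space \<Rightarrow> real) \<Rightarrow> real \<Rightarrow> ('a \<Rightarrow> complex) \<Rightarrow> 'a \<Rightarrow> complex" where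
  "frac_deriv Y t f = harmonic_series Y (\<lambda>k j.
     of_real (Gamma (real k + real DIM('a) / 2 + t) / (Gamma (real k + real DIM('a) / 2) * Gamma t))
       * coefficients Y f k j)"

definition multipliers ::
    "(nat \<Rightarrow> nat \<Rightarrow> 'a::euclidean_space \<Rightarrow> real) \<Rightarrow> ('a \<Rightarrow> complex) set \<Rightarrow> ('a \<Rightarrow> complex) set
       \<Rightarrow> (nat \<Rightarrow> nat \<Rightarrow> complex) set" where
  "multipliers Y A B =
     {c. \<forall>f\<in>A. series_converges Y (\<lambda>k j. c k j * coefficients Y f k j) \<and>
               harmonic_series Y (\<lambda>k j. c k j * coefficients Y f k j) \<in> B}"

definition sphere_norm ::
    "'a::euclidean_space measure \<Rightarrow> ennreal \<Rightarrow> ('a \<Rightarrow> complex) \<Rightarrow> ennreal" where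
  "sphere_norm \<sigma> p u =
     (if p = \<infinity> then (SUP x\<in>sphere 0 1. ennreal (cmod (u x)))
      else let I = (\<integral>\<^sup>+x. ennreal (cmod (u x) powr enn2real p) \<partial>\<sigma>)
           in if I = \<infinity> then \<infinity> else ennreal (enn2real I powr (1 / enn2real p)))"

definition mean_p ::
    "'a::euclidean_space measure \<Rightarrow> ennreal \<Rightarrow> ('a \<Rightarrow> complex) \<Rightarrow> real \<Rightarrow> ennreal" where
  "mean_p \<sigma> p f r = sphere_norm \<sigma> p (\<lambda>x. f (r *\<^sub>R x))"

definition H_space ::
    "'a::euclidean_space measure \<Rightarrow> ennreal \<Rightarrow> real \<Rightarrow> ('a \<Rightarrow> complex) set" where
  "H_space \<sigma> p \<alpha> =
     {f. harmonic_on f (ball 0 1) \<and>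
         (SUP r\<in>{0..<1}. mean_p \<sigma> p f r * ennreal ((1 - r) powr \<alpha>)) < \<infinity>}"

definition N_p ::
    "'a::euclidean_space measure \<Rightarrow> (nat \<Rightarrow> nat \<Rightarrow> 'a \<Rightarrow> real) \<Rightarrow> real \<Rightarrow> real \<Rightarrow> real \<Rightarrow> ennreal
       \<Rightarrow> ('a \<Rightarrow> complex) \<Rightarrow> ennreal" where
  "N_p \<sigma> Y m \<alpha> \<beta> p g =
     (SUP \<rho>\<in>{0..<1}. SUP y\<in>sphere 0 1.
        ennreal ((1 - \<rho>) powr (m + 1 - \<alpha> + \<beta>)) *
        sphere_norm \<sigma> p
          (\<lambda>x. frac_deriv Y (m + 1) (convolution Y g (poisson_kernel Y x)) (\<rho> *\<^sub>R y)))"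

end

theory Submission
  imports Defs
begin

text \<open>
  Convergence on the ball makes the coefficients subexponential, so that all expansions may be
  handled termwise; the expansion of a harmonic function is read off its Poisson integral.

  The factors of the fractional derivative are reciprocal moments of a beta distribution \<open>\<mu>\<close>.  Hence
  \<open>(c * f)(r\<^sup>2 x)\<close> is the integral of \<open>\<Lambda>\<^sub>t (g * P\<^sub>x)(r \<surd>s \<xi>) f(r \<surd>s \<xi>)\<close> over the sphere and \<open>\<mu>\<close>, with
  \<open>t = m + 1\<close>, and the second condition gives the first by Minkowski's inequality.

  Conversely \<open>\<Lambda>\<^sub>t P\<^sub>y\<close> has \<open>L\<^sup>1\<close> norm at most \<open>C (1 - r)\<^bsup>-t\<^esup>\<close> on the sphere of radius \<open>r\<close>, so the
  functions \<open>(1 - \<rho>)\<^bsup>t - \<alpha>\<^esup> (\<Lambda>\<^sub>t P\<^sub>y)(\<rho> x)\<close> are bounded in \<open>H\<^sup>1\<^sub>\<alpha>\<close>.  A multiplier \<open>c\<close> maps them to bounded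
  functions of \<open>H\<^sup>p\<^sub>\<beta>\<close>, by a gliding hump argument in place of the closed graph theorem, and evaluating
  the bound at radius \<open>\<surd>\<rho>\<close> gives the second condition.
\<close>

section \<open>Harmonic functions\<close>

text \<open>Everything about harmonic functions has to come from the C^2 definition and from L^2
  density of the basis. The maximum principle gives the Poisson formula, expanding the Poisson
  kernel gives all other expansions, and Bessel's inequality for the same kernel controls both
  \<open>ymax k\<close> and the dimensions \<open>d k\<close>, whose values are never computed. A
  multiplier is tested by pairing a kernel with a function at the same radius, so each of them
  carries half of the powers of the radius. This is why square roots of radii occur; removing them
  costs only powers of 2. For real t the L^1 bound is reached through integer orders. Each linear
  factor k + n/2 + i acts as a first-order radial derivative and costs one power of 1/(1 - r);
  averaging over smaller radii then lowers an integer order N > t to t. One integral, that of (1 -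
  s)^(a-1) (1 - r s)^(-a-b), at most of order (1 - r)^(-b) for b > 0, closes this step with b = t
  and the sufficiency with b = \<beta>. The condition m > \<alpha> - 1 means t > \<alpha>, which
  keeps the normalising factors of the test functions bounded.\<close>

definition coord_blinfun :: "'a::euclidean_space \<Rightarrow> 'b::real_normed_vector \<Rightarrow> ('a \<Rightarrow>\<^sub>L 'b)" where
  "coord_blinfun b w = blinfun_scaleR_left w o\<^sub>L blinfun_inner_left b"

lemma coord_blinfun_apply [simp]: "blinfun_apply (coord_blinfun b w) v = (v \<bullet> b) *\<^sub>R w"
  by (simp add: coord_blinfun_def)

lemma bounded_linear_coord_blinfun: "bounded_linear (coord_blinfun b)"
  unfolding coord_blinfun_def
  by (rule bounded_linear_compose[OF bounded_bilinear.bounded_linear_left[OF bounded_bilinear_blinfun_compose]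
        bounded_linear_blinfun_scaleR_left])

text \<open>Operator-valued derivatives are awkward to exhibit for functions given by integrals. In
  coordinates finitely many first and second partials \<open>g b\<close> and \<open>h b c\<close>
  suffice: \<open>coord_blinfun\<close> reassembles them into linear maps, and the trace becomes the
  sum of the \<open>h b b\<close>.\<close>

lemma harmonic_on_iff_partials:
  fixes f :: "'a::euclidean_space \<Rightarrow> 'b::real_normed_vector"
  shows "harmonic_on f S \<longleftrightarrow>
    (\<exists>(g :: 'a \<Rightarrow> 'a \<Rightarrow> 'b) (h :: 'a \<Rightarrow> 'a \<Rightarrow> 'a \<Rightarrow> 'b).
      (\<forall>x\<in>S. (f has_derivative (\<lambda>v. \<Sum>b\<in>Basis. (v \<bullet> b) *\<^sub>R g b x)) (at x)) \<and>
      (\<forall>b\<in>Basis. \<forall>x\<in>S. (g b has_derivative (\<lambda>v. \<Sum>c\<in>Basis. (v \<bullet> c) *\<^sub>R h b c x)) (at x)) \<and>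
      (\<forall>b\<in>Basis. \<forall>c\<in>Basis. continuous_on S (h b c)) \<and>
      (\<forall>x\<in>S. (\<Sum>b\<in>Basis. h b b x) = 0))"
    (is "?L \<longleftrightarrow> ?R")
proof
  assume ?L
  then obtain f' :: "'a \<Rightarrow> 'a \<Rightarrow>\<^sub>L 'b" and f'' :: "'a \<Rightarrow> 'a \<Rightarrow>\<^sub>L ('a \<Rightarrow>\<^sub>L 'b)" where
    f: "\<And>x. x\<in>S \<Longrightarrow> (f has_derivative blinfun_apply (f' x)) (at x)"
    and f': "\<And>x. x\<in>S \<Longrightarrow> (f' has_derivative blinfun_apply (f'' x)) (at x)"
    and c: "continuous_on S f''" and t: "\<And>x. x\<in>S \<Longrightarrow> (\<Sum>b\<in>Basis. f'' x b b) = 0"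
    unfolding harmonic_on_def by blast
  have rep: "(\<Sum>b\<in>Basis. (v \<bullet> b) *\<^sub>R blinfun_apply A b) = blinfun_apply A v"
    for A :: "'a \<Rightarrow>\<^sub>L 'b" and v
    by (metis (mono_tags, lifting) blinfun.scaleR_right blinfun.sum_right euclidean_representation sum.cong)
  have rep2: "(\<Sum>c\<in>Basis. (v \<bullet> c) *\<^sub>R blinfun_apply (blinfun_apply A c) b) = blinfun_apply (blinfun_apply A v) b"
    for A :: "'a \<Rightarrow>\<^sub>L ('a \<Rightarrow>\<^sub>L 'b)" and v b
  proof -
    have "blinfun_apply A v = blinfun_apply A (\<Sum>c\<in>Basis. (v \<bullet> c) *\<^sub>R c)"
      by (simp add: euclidean_representation)
    then show ?thesis
      by (simp add: blinfun.sum_right blinfun.scaleR_right blinfun.sum_left blinfun.scaleR_left)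
  qed
  show ?R
  proof (intro exI[of _ "\<lambda>b x. f' x b"] exI[of _ "\<lambda>b c x. f'' x c b"] conjI ballI)
    fix x assume "x \<in> S"
    then show "(f has_derivative (\<lambda>v. \<Sum>b\<in>Basis. (v \<bullet> b) *\<^sub>R f' x b)) (at x)"
      using f by (simp add: rep)
    show "(\<Sum>b\<in>Basis. f'' x b b) = 0" using t \<open>x \<in> S\<close> by simp
    fix b :: 'a assume "b \<in> Basis"
    show "((\<lambda>x. f' x b) has_derivative (\<lambda>v. \<Sum>c\<in>Basis. (v \<bullet> c) *\<^sub>R f'' x c b)) (at x)"
      unfolding rep2
      using bounded_linear.has_derivative[OF blinfun.bounded_linear_left f'[OF \<open>x \<in> S\<close>]] .
  next
    fix b c :: 'a
    show "continuous_on S (\<lambda>x. f'' x c b)"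
      by (intro continuous_intros c)
  qed
next
  assume ?R
  then obtain g :: "'a \<Rightarrow> 'a \<Rightarrow> 'b" and h :: "'a \<Rightarrow> 'a \<Rightarrow> 'a \<Rightarrow> 'b" where
    *: "\<forall>x\<in>S. (f has_derivative (\<lambda>v. \<Sum>b\<in>Basis. (v \<bullet> b) *\<^sub>R g b x)) (at x)"
    "\<forall>b\<in>Basis. \<forall>x\<in>S. (g b has_derivative (\<lambda>v. \<Sum>c\<in>Basis. (v \<bullet> c) *\<^sub>R h b c x)) (at x)"
    "\<forall>b\<in>Basis. \<forall>c\<in>Basis. continuous_on S (h b c)"
    "\<forall>x\<in>S. (\<Sum>b\<in>Basis. h b b x) = 0"
    by (elim exE conjE)
  have f: "\<And>x. x\<in>S \<Longrightarrow> (f has_derivative (\<lambda>v. \<Sum>b\<in>Basis. (v \<bullet> b) *\<^sub>R g b x)) (at x)"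
    and g: "\<And>b x. b \<in> Basis \<Longrightarrow> x\<in>S \<Longrightarrow> (g b has_derivative (\<lambda>v. \<Sum>c\<in>Basis. (v \<bullet> c) *\<^sub>R h b c x)) (at x)"
    and c: "\<And>b c. b \<in> Basis \<Longrightarrow> c \<in> Basis \<Longrightarrow> continuous_on S (h b c)"
    and t: "\<And>x. x\<in>S \<Longrightarrow> (\<Sum>b\<in>Basis. h b b x) = 0"
    using * by blast+
  define f' :: "'a \<Rightarrow> 'a \<Rightarrow>\<^sub>L 'b" where "f' x = (\<Sum>b\<in>Basis. coord_blinfun b (g b x))" for x
  define f'' :: "'a \<Rightarrow> ('a \<Rightarrow>\<^sub>L ('a \<Rightarrow>\<^sub>L 'b))" where "f'' x = (\<Sum>b\<in>Basis. \<Sum>c\<in>Basis. coord_blinfun c (coord_blinfun b (h b c x)))" for x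
  have Elin: "bounded_linear (coord_blinfun b :: 'b \<Rightarrow> ('a \<Rightarrow>\<^sub>L 'b))" for b
    by (rule bounded_linear_coord_blinfun)
  have Elin2: "bounded_linear (coord_blinfun b :: ('a \<Rightarrow>\<^sub>L 'b) \<Rightarrow> ('a \<Rightarrow>\<^sub>L ('a \<Rightarrow>\<^sub>L 'b)))" for b
    by (rule bounded_linear_coord_blinfun)
  show ?L unfolding harmonic_on_def
  proof (intro exI[of _ f'] exI[of _ f''] conjI ballI)
    fix x assume x: "x \<in> S"
    have "blinfun_apply (f' x) = (\<lambda>v. \<Sum>b\<in>Basis. (v \<bullet> b) *\<^sub>R g b x)"
      by (auto simp: f'_def blinfun.sum_left fun_eq_iff)
    then show "(f has_derivative blinfun_apply (f' x)) (at x)" using f[OF x] by simp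
    have "blinfun_apply (f'' x) = (\<lambda>v. \<Sum>b\<in>Basis. coord_blinfun b (\<Sum>c\<in>Basis. (v \<bullet> c) *\<^sub>R h b c x))"
      by (auto simp: f''_def blinfun.sum_left fun_eq_iff bounded_linear.linear[OF Elin] linear_sum linear_scale
          intro!: sum.cong)
    moreover have "(f' has_derivative (\<lambda>v. \<Sum>b\<in>Basis. coord_blinfun b (\<Sum>c\<in>Basis. (v \<bullet> c) *\<^sub>R h b c x))) (at x)"
      unfolding f'_def
      by (intro has_derivative_sum bounded_linear.has_derivative[OF Elin] g x)
    ultimately show "(f' has_derivative blinfun_apply (f'' x)) (at x)" by simp
    have "(\<Sum>b\<in>Basis. f'' x b b) = (\<Sum>b\<in>Basis. \<Sum>b'\<in>Basis. \<Sum>c\<in>Basis. (b \<bullet> c) *\<^sub>R ((b \<bullet> b') *\<^sub>R h b' c x))"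
      by (simp add: f''_def blinfun.sum_left blinfun.scaleR_left)
    also have "\<dots> = (\<Sum>b\<in>Basis. \<Sum>b'\<in>Basis. \<Sum>c\<in>Basis. if c = b then (if b' = b then h b b x else 0) else 0)"
      by (intro sum.cong refl) (auto simp: inner_Basis)
    also have "\<dots> = (\<Sum>b\<in>Basis. h b b x)"
      by (simp add: sum.delta)
    finally show "(\<Sum>b\<in>Basis. f'' x b b) = 0" using t[OF x] by simp
  next
    show "continuous_on S f''" unfolding f''_def
      by (intro continuous_on_sum bounded_linear.continuous_on[OF Elin2] bounded_linear.continuous_on[OF Elin] c)
  qed
qed

lemma harmonic_onE:
  fixes f :: "'a::euclidean_space \<Rightarrow> 'b::real_normed_vector"
  assumes "harmonic_on f S"
  obtains g :: "'a \<Rightarrow> 'a \<Rightarrow> 'b" and h :: "'a \<Rightarrow> 'a \<Rightarrow> 'a \<Rightarrow> 'b" where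
    "\<And>x. x\<in>S \<Longrightarrow> (f has_derivative (\<lambda>v. \<Sum>b\<in>Basis. (v \<bullet> b) *\<^sub>R g b x)) (at x)"
    "\<And>b x. b \<in> Basis \<Longrightarrow> x\<in>S \<Longrightarrow> (g b has_derivative (\<lambda>v. \<Sum>c\<in>Basis. (v \<bullet> c) *\<^sub>R h b c x)) (at x)"
    "\<And>b c. b \<in> Basis \<Longrightarrow> c \<in> Basis \<Longrightarrow> continuous_on S (h b c)"
    "\<And>x. x\<in>S \<Longrightarrow> (\<Sum>b\<in>Basis. h b b x) = 0"
proof -
  from assms obtain g :: "'a \<Rightarrow> 'a \<Rightarrow> 'b" and h :: "'a \<Rightarrow> 'a \<Rightarrow> 'a \<Rightarrow> 'b" where
    *: "\<forall>x\<in>S. (f has_derivative (\<lambda>v. \<Sum>b\<in>Basis. (v \<bullet> b) *\<^sub>R g b x)) (at x)"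
    "\<forall>b\<in>Basis. \<forall>x\<in>S. (g b has_derivative (\<lambda>v. \<Sum>c\<in>Basis. (v \<bullet> c) *\<^sub>R h b c x)) (at x)"
    "\<forall>b\<in>Basis. \<forall>c\<in>Basis. continuous_on S (h b c)"
    "\<forall>x\<in>S. (\<Sum>b\<in>Basis. h b b x) = 0"
    unfolding harmonic_on_iff_partials by (elim exE conjE)
  show ?thesis
    by (rule that[of g h]) (use * in blast)+
qed

lemma harmonic_onI:
  fixes f :: "'a::euclidean_space \<Rightarrow> 'b::real_normed_vector"
  assumes "\<And>x. x\<in>S \<Longrightarrow> (f has_derivative (\<lambda>v. \<Sum>b\<in>Basis. (v \<bullet> b) *\<^sub>R g b x)) (at x)"
    "\<And>b x. b \<in> Basis \<Longrightarrow> x\<in>S \<Longrightarrow> (g b has_derivative (\<lambda>v. \<Sum>c\<in>Basis. (v \<bullet> c) *\<^sub>R h b c x)) (at x)"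
    "\<And>b c. b \<in> Basis \<Longrightarrow> c \<in> Basis \<Longrightarrow> continuous_on S (h b c)"
    "\<And>x. x\<in>S \<Longrightarrow> (\<Sum>b\<in>Basis. h b b x) = 0"
  shows "harmonic_on f S"
  using assms unfolding harmonic_on_iff_partials by blast

lemma harmonic_on_subset: 
  assumes "harmonic_on f S" "T \<subseteq> S" 
  shows "harmonic_on f T"
  using assms(1)
proof (rule harmonic_onE)
  fix g h
  assume *: "\<And>x. x\<in>S \<Longrightarrow> (f has_derivative (\<lambda>v. \<Sum>b\<in>Basis. (v \<bullet> b) *\<^sub>R g b x)) (at x)"
    "\<And>b x. b \<in> Basis \<Longrightarrow> x\<in>S \<Longrightarrow> (g b has_derivative (\<lambda>v. \<Sum>c\<in>Basis. (v \<bullet> c) *\<^sub>R h b c x)) (at x)"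
    "\<And>b c. b \<in> Basis \<Longrightarrow> c \<in> Basis \<Longrightarrow> continuous_on S (h b c)"
    "\<And>x. x\<in>S \<Longrightarrow> (\<Sum>b\<in>Basis. h b b x) = 0"
  show ?thesis
    by (rule harmonic_onI[of T f g h]) (use * assms(2) continuous_on_subset in blast)+
qed

lemma harmonic_on_continuous: 
  assumes "harmonic_on f S" 
  shows "continuous_on S f"
  using assms
proof (rule harmonic_onE)
  fix g h
  assume *: "\<And>x. x\<in>S \<Longrightarrow> (f has_derivative (\<lambda>v. \<Sum>b\<in>Basis. (v \<bullet> b) *\<^sub>R g b x)) (at x)"
  show ?thesis
    by (intro continuous_at_imp_continuous_on ballI has_derivative_continuous) (rule *)
qed

lemma harmonic_on_cong:
  assumes "harmonic_on f S" "open S" "\<And>x. x \<in> S \<Longrightarrow> f x = g x"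
  shows "harmonic_on g S"
  using assms(1)
proof (rule harmonic_onE)
  fix g' h
  assume *: "\<And>x. x\<in>S \<Longrightarrow> (f has_derivative (\<lambda>v. \<Sum>b\<in>Basis. (v \<bullet> b) *\<^sub>R g' b x)) (at x)"
    "\<And>b x. b \<in> Basis \<Longrightarrow> x\<in>S \<Longrightarrow> (g' b has_derivative (\<lambda>v. \<Sum>c\<in>Basis. (v \<bullet> c) *\<^sub>R h b c x)) (at x)"
    "\<And>b c. b \<in> Basis \<Longrightarrow> c \<in> Basis \<Longrightarrow> continuous_on S (h b c)"
    "\<And>x. x\<in>S \<Longrightarrow> (\<Sum>b\<in>Basis. h b b x) = 0"
  show ?thesis
  proof (rule harmonic_onI[of S g g' h])
    show "(g has_derivative (\<lambda>v. \<Sum>b\<in>Basis. (v \<bullet> b) *\<^sub>R g' b x)) (at x)" if "x \<in> S" for x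
      by (rule has_derivative_transform_within_open[OF *(1)[OF that] assms(2) that assms(3)])
  qed (use * in blast)+
qed

text \<open>The derivatives that witness harmonicity may be different functions on different
  neighbourhoods. Derivatives at a point are unique, so the pointwise choices \<open>D\<close> and
  \<open>D2\<close> agree with every local witness, and continuity of \<open>D2\<close> passes to
  the union of the open sets.\<close>

lemma harmonic_on_locally:
  fixes f :: "'a::euclidean_space \<Rightarrow> 'b::real_normed_vector"
  assumes "\<And>x. x \<in> S \<Longrightarrow> \<exists>T. open T \<and> x \<in> T \<and> harmonic_on f T"
  shows "harmonic_on f S"
proof -
  define P where "P T f' f'' \<longleftrightarrow>
        (\<forall>x\<in>T. (f has_derivative blinfun_apply (f' x)) (at x)) \<and>
        (\<forall>x\<in>T. (f' has_derivative blinfun_apply (f'' x)) (at x)) \<and>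
        continuous_on T f'' \<and>
        (\<forall>x\<in>T. (\<Sum>b\<in>Basis. blinfun_apply (blinfun_apply (f'' x) b) b) = 0)" 
      for T and f' :: "'a \<Rightarrow> 'a \<Rightarrow>\<^sub>L 'b" and f'' :: "'a \<Rightarrow> 'a \<Rightarrow>\<^sub>L ('a \<Rightarrow>\<^sub>L 'b)"
  define D where "D x = (SOME A :: 'a \<Rightarrow>\<^sub>L 'b. (f has_derivative blinfun_apply A) (at x))" for x
  define D2 where "D2 x = (SOME A :: 'a \<Rightarrow>\<^sub>L ('a \<Rightarrow>\<^sub>L 'b). (D has_derivative blinfun_apply A) (at x))" for x
  have loc: "P T D D2" if "open T" "harmonic_on f T" for T
  proof -
    from that obtain f' f'' where *: "P T f' f''" unfolding harmonic_on_def P_def by blast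
    have D: "D x = f' x" if "x \<in> T" for x
    proof -
      have "(f has_derivative blinfun_apply (f' x)) (at x)" using * that by (auto simp: P_def)
      moreover from this have "(f has_derivative blinfun_apply (D x)) (at x)"
        unfolding D_def by (rule someI)
      ultimately show ?thesis
        by (metis blinfun_apply_inject has_derivative_unique)
    qed
    have D': "(D has_derivative blinfun_apply (f'' x)) (at x)" if "x \<in> T" for x
      using * that D \<open>open T\<close> has_derivative_transform_within_open[of f' _ x UNIV T D]
      by (auto simp: P_def)
    have D2: "D2 x = f'' x" if "x \<in> T" for x
    proof -
      have "(D has_derivative blinfun_apply (D2 x)) (at x)"
        unfolding D2_def by (rule someI) (rule D'[OF that])
      then show ?thesis using D'[OF that] by (metis blinfun_apply_inject has_derivative_unique)
    qed
    have "continuous_on T D2" using * D2 continuous_on_cong[of T T D2 f''] by (auto simp: P_def)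
    then show ?thesis using * D D' D2 by (auto simp: P_def)
  qed
  let ?U = "\<Union>{T. open T \<and> harmonic_on f T}"
  have "continuous_on ?U D2"
    by (intro continuous_on_open_Union) (use loc in \<open>auto simp: P_def\<close>)
  moreover have "S \<subseteq> ?U" using assms by auto
  ultimately have c: "continuous_on S D2" using continuous_on_subset by blast
  show ?thesis unfolding harmonic_on_def
    using assms loc c by (intro exI[of _ D] exI[of _ D2]) (auto simp: P_def; metis)
qed

lemma harmonic_on_linear:
  assumes "harmonic_on f S" "bounded_linear L"
  shows "harmonic_on (\<lambda>x. L (f x)) S"
  using assms(1)
proof (rule harmonic_onE)
  fix g h
  assume f: "\<And>x. x\<in>S \<Longrightarrow> (f has_derivative (\<lambda>v. \<Sum>b\<in>Basis. (v \<bullet> b) *\<^sub>R g b x)) (at x)"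
    and g: "\<And>b x. b \<in> Basis \<Longrightarrow> x\<in>S \<Longrightarrow> (g b has_derivative (\<lambda>v. \<Sum>c\<in>Basis. (v \<bullet> c) *\<^sub>R h b c x)) (at x)"
    and c: "\<And>b c. b \<in> Basis \<Longrightarrow> c \<in> Basis \<Longrightarrow> continuous_on S (h b c)"
    and t: "\<And>x. x\<in>S \<Longrightarrow> (\<Sum>b\<in>Basis. h b b x) = 0"
  interpret L: bounded_linear L by fact
  have L: "L (\<Sum>b\<in>B. (v \<bullet> b) *\<^sub>R G b) = (\<Sum>b\<in>B. (v \<bullet> b) *\<^sub>R L (G b))" for v B and G :: "'a \<Rightarrow> 'b"
    by (simp add: L.sum L.scaleR)
  show ?thesis
  proof (rule harmonic_onI[where g="\<lambda>b x. L (g b x)" and h="\<lambda>b c x. L (h b c x)"])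
    show "((\<lambda>x. L (f x)) has_derivative (\<lambda>v. \<Sum>b\<in>Basis. (v \<bullet> b) *\<^sub>R L (g b x))) (at x)" if "x \<in> S" for x
      using L.has_derivative[OF f[OF that]] by (simp add: L)
    show "((\<lambda>x. L (g b x)) has_derivative (\<lambda>v. \<Sum>c\<in>Basis. (v \<bullet> c) *\<^sub>R L (h b c x))) (at x)"
      if "b \<in> Basis" "x \<in> S" for x b
      using L.has_derivative[OF g[OF that]] by (simp add: L)
    show "continuous_on S (\<lambda>x. L (h b c x))" if "b \<in> Basis" "c \<in> Basis" for b c
      using that c L.continuous_on by blast
    show "(\<Sum>b\<in>Basis. L (h b b x)) = 0" if "x \<in> S" for x
      using t[OF that] by (simp flip: L.sum)
  qed
qed

lemma harmonic_on_add:
  assumes "harmonic_on f1 S" "harmonic_on f2 S"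
  shows "harmonic_on (\<lambda>x. f1 x + f2 x) S"
  using assms(1)
proof (rule harmonic_onE)
  fix g1 h1
  assume 1: "\<And>x. x\<in>S \<Longrightarrow> (f1 has_derivative (\<lambda>v. \<Sum>b\<in>Basis. (v \<bullet> b) *\<^sub>R g1 b x)) (at x)"
    "\<And>b x. b \<in> Basis \<Longrightarrow> x\<in>S \<Longrightarrow> (g1 b has_derivative (\<lambda>v. \<Sum>c\<in>Basis. (v \<bullet> c) *\<^sub>R h1 b c x)) (at x)"
    "\<And>b c. b \<in> Basis \<Longrightarrow> c \<in> Basis \<Longrightarrow> continuous_on S (h1 b c)"
    "\<And>x. x\<in>S \<Longrightarrow> (\<Sum>b\<in>Basis. h1 b b x) = 0"
  show ?thesis using assms(2)
  proof (rule harmonic_onE)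
    fix g2 h2
    assume 2: "\<And>x. x\<in>S \<Longrightarrow> (f2 has_derivative (\<lambda>v. \<Sum>b\<in>Basis. (v \<bullet> b) *\<^sub>R g2 b x)) (at x)"
      "\<And>b x. b \<in> Basis \<Longrightarrow> x\<in>S \<Longrightarrow> (g2 b has_derivative (\<lambda>v. \<Sum>c\<in>Basis. (v \<bullet> c) *\<^sub>R h2 b c x)) (at x)"
      "\<And>b c. b \<in> Basis \<Longrightarrow> c \<in> Basis \<Longrightarrow> continuous_on S (h2 b c)"
      "\<And>x. x\<in>S \<Longrightarrow> (\<Sum>b\<in>Basis. h2 b b x) = 0"
    show ?thesis
    proof (rule harmonic_onI[where g="\<lambda>b x. g1 b x + g2 b x" and h="\<lambda>b c x. h1 b c x + h2 b c x"])
      show "((\<lambda>x. f1 x + f2 x) has_derivative (\<lambda>v. \<Sum>b\<in>Basis. (v \<bullet> b) *\<^sub>R (g1 b x + g2 b x))) (at x)"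
        if "x \<in> S" for x
        using has_derivative_add[OF 1(1)[OF that] 2(1)[OF that]]
        by (simp add: scaleR_add_right sum.distrib)
      show "((\<lambda>x. g1 b x + g2 b x) has_derivative (\<lambda>v. \<Sum>c\<in>Basis. (v \<bullet> c) *\<^sub>R (h1 b c x + h2 b c x))) (at x)"
        if "b \<in> Basis" "x \<in> S" for x b
        using has_derivative_add[OF 1(2)[OF that] 2(2)[OF that]]
        by (simp add: scaleR_add_right sum.distrib)
      show "continuous_on S (\<lambda>x. h1 b c x + h2 b c x)" if "b \<in> Basis" "c \<in> Basis" for b c
        using that 1(3) 2(3) by (intro continuous_on_add) auto
      show "(\<Sum>b\<in>Basis. h1 b b x + h2 b b x) = 0" if "x \<in> S" for x
        using 1(4)[OF that] 2(4)[OF that] by (simp add: sum.distrib)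
    qed
  qed
qed

lemma harmonic_on_diff:
  assumes "harmonic_on f S" "harmonic_on g S"
  shows "harmonic_on (\<lambda>x. f x - g x) S"
  using harmonic_on_add[OF assms(1) harmonic_on_linear[OF assms(2) bounded_linear_minus[OF bounded_linear_ident]]]
  by simp

lemma harmonic_on_dilation:
  fixes f :: "'a::euclidean_space \<Rightarrow> 'b::real_normed_vector"
  assumes "harmonic_on f S" 
  shows "harmonic_on (\<lambda>x. f (R *\<^sub>R x)) {x. R *\<^sub>R x \<in> S}"
  using assms(1)
proof (rule harmonic_onE)
  fix g h
  assume f: "\<And>x. x\<in>S \<Longrightarrow> (f has_derivative (\<lambda>v. \<Sum>b\<in>Basis. (v \<bullet> b) *\<^sub>R g b x)) (at x)"
    and g: "\<And>b x. b \<in> Basis \<Longrightarrow> x\<in>S \<Longrightarrow> (g b has_derivative (\<lambda>v. \<Sum>c\<in>Basis. (v \<bullet> c) *\<^sub>R h b c x)) (at x)"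
    and c: "\<And>b c. b \<in> Basis \<Longrightarrow> c \<in> Basis \<Longrightarrow> continuous_on S (h b c)"
    and t: "\<And>x. x\<in>S \<Longrightarrow> (\<Sum>b\<in>Basis. h b b x) = 0"
  have R: "((*\<^sub>R) R has_derivative (*\<^sub>R) R) (at x)" for x :: 'a
    by (rule bounded_linear_imp_has_derivative) (rule bounded_linear_scaleR_right)
  show ?thesis
  proof (rule harmonic_onI[where g="\<lambda>b x. R *\<^sub>R g b (R *\<^sub>R x)" and h="\<lambda>b c x. R *\<^sub>R R *\<^sub>R h b c (R *\<^sub>R x)"]; clarsimp?)
    show "((\<lambda>x. f (R *\<^sub>R x)) has_derivative (\<lambda>v. \<Sum>b\<in>Basis. ((v \<bullet> b) * R) *\<^sub>R g b (R *\<^sub>R x))) (at x)" if "R *\<^sub>R x \<in> S" for x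
      using has_derivative_compose[OF R f[OF that]] by (simp add: mult.commute)
    show "((\<lambda>x. R *\<^sub>R g b (R *\<^sub>R x)) has_derivative (\<lambda>v. \<Sum>c\<in>Basis. ((v \<bullet> c) * (R * R)) *\<^sub>R h b c (R *\<^sub>R x))) (at x)"
      if "b \<in> Basis" "R *\<^sub>R x \<in> S" for x b
      using has_derivative_scaleR_right[OF has_derivative_compose[OF R g[OF that]], of R] 
      by (simp add: scaleR_sum_right mult_ac)
    show "continuous_on {x. R *\<^sub>R x \<in> S} (\<lambda>x. (R * R) *\<^sub>R h b c (R *\<^sub>R x))" if "b \<in> Basis" "c \<in> Basis" for b c
      by (intro continuous_intros continuous_on_compose2[OF c[OF that]]) auto
    show "(\<Sum>b\<in>Basis. (R * R) *\<^sub>R h b b (R *\<^sub>R x)) = 0" if "R *\<^sub>R x \<in> S" for x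
      using t[OF that] by (simp flip: scaleR_sum_right)
  qed
qed

section \<open>The maximum principle\<close>

lemma local_max_second_derivative:
  fixes \<phi> \<phi>' :: "real \<Rightarrow> real"
  assumes "e > 0" "\<And>t. \<bar>t\<bar> < e \<Longrightarrow> (\<phi> has_real_derivative \<phi>' t) (at t)"
    and "(\<phi>' has_real_derivative d) (at 0)" and "\<And>t. \<bar>t\<bar> < e \<Longrightarrow> \<phi> t \<le> \<phi> 0"
  shows "d \<le> 0"
proof (rule ccontr)
  assume "\<not> d \<le> 0"
  then have "d > 0" by simp
  have "\<phi>' 0 = 0"
    using DERIV_local_max[OF assms(2)[of 0] \<open>e > 0\<close>] assms(1,4) by auto
  \<comment> \<open>As \<open>\<phi>'\<close> vanishes at 0 with positive slope there, it is
    positive just to the right, so \<open>\<phi>\<close> would rise above its maximum.\<close>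
  with DERIV_pos_inc_right[OF assms(3) \<open>d > 0\<close>] obtain \<delta> where \<delta>: "\<delta> > 0" "\<And>h. 0 < h \<Longrightarrow> h < \<delta> \<Longrightarrow> 0 < \<phi>' h"
    by auto
  define T where "T = min \<delta> e / 2"
  have T: "0 < T" "T < \<delta>" "T < e" using \<delta> assms(1) by (auto simp: T_def)
  have "\<exists>z>0. z < T \<and> \<phi> T - \<phi> 0 = (T - 0) * \<phi>' z"
    using T by (intro MVT2) (auto intro!: assms(2))
  then obtain z where z: "0 < z" "z < T" "\<phi> T - \<phi> 0 = T * \<phi>' z" by auto
  then have "\<phi> T > \<phi> 0" using \<delta>(2)[of z] T by (smt (verit) mult_pos_pos)
  with assms(4)[of T] T show False by auto
qed

text \<open>A harmonic function may have vanishing second derivatives at a maximum, so \<epsilon>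
  |x|^2 is added: its Laplacian is positive, while at an interior maximum every pure second
  derivative is at most 0. The maximum of the perturbed function thus lies on the sphere of radius
  r, and \<epsilon> is arbitrary.\<close>

lemma harmonic_max_principle:
  fixes u :: "'a::euclidean_space \<Rightarrow> real"
  assumes "harmonic_on u (ball 0 1)" "r < 1" "\<And>x. norm x = r \<Longrightarrow> u x \<le> M" "norm x0 \<le> r"
  shows "u x0 \<le> M"
  using assms(1)
proof (rule harmonic_onE)
  fix g h
  let ?S = "ball 0 1 :: 'a set"
  assume f: "\<And>x. x\<in>?S \<Longrightarrow> (u has_derivative (\<lambda>v. \<Sum>b\<in>Basis. (v \<bullet> b) *\<^sub>R g b x)) (at x)"
    and g: "\<And>b x. b \<in> Basis \<Longrightarrow> x\<in>?S \<Longrightarrow> (g b has_derivative (\<lambda>v. \<Sum>c\<in>Basis. (v \<bullet> c) *\<^sub>R h b c x)) (at x)"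
    and c: "\<And>b c. b \<in> Basis \<Longrightarrow> c \<in> Basis \<Longrightarrow> continuous_on ?S (h b c)"
    and t: "\<And>x. x\<in>?S \<Longrightarrow> (\<Sum>b\<in>Basis. h b b x) = 0"
  show ?thesis
  proof (rule field_le_epsilon)
    fix \<epsilon> :: real assume "\<epsilon> > 0"
    have r0: "r \<ge> 0" using assms(4) norm_ge_zero[of x0] by linarith
    define w where "w x = u x + \<epsilon> * (x \<bullet> x)" for x
    have "continuous_on (cball 0 r) w" unfolding w_def
      by (intro continuous_intros continuous_on_subset[OF harmonic_on_continuous[OF assms(1)]]) (use assms(2) in auto)
    then obtain y where y: "norm y \<le> r" "\<And>x. norm x \<le> r \<Longrightarrow> w x \<le> w y"
      using continuous_attains_sup[of "cball 0 r" w] r0 by auto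
    have "norm y = r"
    proof (rule ccontr)
      assume "norm y \<noteq> r"
      then have yr: "norm y < r" using y by auto
      have *: "h b b y + 2 * \<epsilon> \<le> 0" if b: "b \<in> Basis" for b
      proof (rule local_max_second_derivative)
        show "r - norm y > 0" using yr by simp
        have n: "norm (y + t *\<^sub>R b) < r" if "\<bar>t\<bar> < r - norm y" for t
          using norm_triangle_ineq[of y "t *\<^sub>R b"] that b by simp
        have l: "((\<lambda>t. y + t *\<^sub>R b) has_derivative (\<lambda>t. t *\<^sub>R b)) (at t)" for t
          by (auto intro!: derivative_eq_intros)
        have s: "(\<Sum>c\<in>Basis. (t *\<^sub>R b \<bullet> c) *\<^sub>R (G c :: real)) = G b * t" for t G
          using b by (simp add: inner_Basis if_distrib if_distribR sum.delta mult.commute cong: if_cong)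
        show "((\<lambda>t. w (y + t *\<^sub>R b)) has_real_derivative (g b (y + t *\<^sub>R b) + \<epsilon> * (2 * (y \<bullet> b) + 2 * t))) (at t)" 
          if "\<bar>t\<bar> < r - norm y" for t
        proof -
          have "((\<lambda>t. u (y + t *\<^sub>R b)) has_real_derivative g b (y + t *\<^sub>R b)) (at t)"
            using has_derivative_compose[OF l[of t] f] n[OF that] assms(2)
            unfolding has_field_derivative_def s by simp
          moreover have "((\<lambda>t. (y + t *\<^sub>R b) \<bullet> (y + t *\<^sub>R b)) has_real_derivative (2 * (y \<bullet> b) + 2 * t)) (at t)"
            using b by (auto simp: inner_add inner_commute intro!: derivative_eq_intros)
          ultimately show ?thesis unfolding w_def
            by (auto intro!: derivative_eq_intros)
        qed
        have "((\<lambda>t. g b (y + t *\<^sub>R b)) has_real_derivative h b b y) (at 0)"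
          using has_derivative_compose[OF l[of 0] g[OF b]] yr assms(2)
          unfolding has_field_derivative_def s by simp
        then show "((\<lambda>t. g b (y + t *\<^sub>R b) + \<epsilon> * (2 * (y \<bullet> b) + 2 * t)) has_real_derivative h b b y + 2 * \<epsilon>) (at 0)"
          by (auto intro!: derivative_eq_intros)
        show "w (y + t *\<^sub>R b) \<le> w (y + 0 *\<^sub>R b)" if "\<bar>t\<bar> < r - norm y" for t
          using y(2)[of "y + t *\<^sub>R b"] n[OF that] by simp
      qed
      have "(\<Sum>b\<in>Basis. h b b y + 2 * \<epsilon>) \<le> 0" by (intro sum_nonpos *)
      then have "real DIM('a) * (2 * \<epsilon>) \<le> 0" using t[of y] yr assms(2) by (simp add: sum.distrib)
      then show False using \<open>\<epsilon> > 0\<close> by (simp add: mult_le_0_iff)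
    qed
    then have "w y \<le> M + \<epsilon> * r\<^sup>2" using assms(3)[of y] by (simp add: w_def dot_square_norm)
    moreover have "u x0 \<le> w x0" using \<open>\<epsilon> > 0\<close> by (simp add: w_def)
    moreover have "w x0 \<le> w y" using y(2) assms(4) by auto
    moreover have "\<epsilon> * r\<^sup>2 \<le> \<epsilon> * 1" 
      by (rule mult_left_mono) (use r0 assms(2) \<open>\<epsilon> > 0\<close> in \<open>auto simp: power_le_one\<close>)
    ultimately show "u x0 \<le> M + \<epsilon>" by linarith
  qed
qed

section \<open>Surface measure\<close>

lemma nn_integral_lborel_shift:
  fixes h :: "'a::euclidean_space \<Rightarrow> ennreal"
  assumes "h \<in> borel_measurable borel"
  shows "(\<integral>\<^sup>+y. h (c + y) \<partial>lborel) = (\<integral>\<^sup>+y. h y \<partial>lborel)"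
  using assms by (subst (2) lborel_distr_plus[symmetric, of c]) (simp add: nn_integral_distr)

text \<open>Uniqueness of Haar measure, specialised: integrate \<open>f x * g (T y + x)\<close> over both variables,
  with \<open>f\<close> the indicator of a ball, and use translation invariance in either order.\<close>

lemma nn_integral_lborel_orthogonal:
  fixes T :: "'a::euclidean_space \<Rightarrow> 'a" and g :: "'a \<Rightarrow> ennreal"
  assumes T: "orthogonal_transformation T" and g[measurable]: "g \<in> borel_measurable borel"
  shows "(\<integral>\<^sup>+x. g (T x) \<partial>lborel) = (\<integral>\<^sup>+x. g x \<partial>lborel)"
proof -
  define f :: "'a \<Rightarrow> ennreal" where "f = indicator (ball 0 1)"
  have [measurable]: "f \<in> borel_measurable borel" unfolding f_def by (intro borel_measurable_indicator) simp
  have lin: "linear T" and "surj T" 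
    using T orthogonal_transformation_linear orthogonal_transformation_surj by auto
  have [measurable]: "T \<in> borel_measurable borel"
    by (intro borel_measurable_continuous_onI linear_continuous_on) 
       (simp add: lin linear_conv_bounded_linear[symmetric])
  let ?b = "emeasure lborel (ball 0 1 :: 'a set)"
  have fb: "(\<integral>\<^sup>+x. f x \<partial>lborel) = ?b" unfolding f_def by simp
  have "?b * (\<integral>\<^sup>+y. g (T y) \<partial>lborel) = (\<integral>\<^sup>+x. \<integral>\<^sup>+y. f x * g (T y) \<partial>lborel \<partial>lborel)"
    by (simp add: nn_integral_cmult nn_integral_multc fb)
  also have "\<dots> = (\<integral>\<^sup>+x. \<integral>\<^sup>+y. f x * g (x + T y) \<partial>lborel \<partial>lborel)"
  proof (rule nn_integral_cong)
    fix x :: 'a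
    obtain z where z: "T z = x" using \<open>surj T\<close> by (metis surjD)
    have "(\<integral>\<^sup>+y. f x * g (T (z + y)) \<partial>lborel) = (\<integral>\<^sup>+y. f x * g (T y) \<partial>lborel)"
      by (rule nn_integral_lborel_shift[of "\<lambda>y. f x * g (T y)"]) simp
    then show "(\<integral>\<^sup>+y. f x * g (T y) \<partial>lborel) = (\<integral>\<^sup>+y. f x * g (x + T y) \<partial>lborel)"
      using lin z by (simp add: linear_add)
  qed
  also have "\<dots> = (\<integral>\<^sup>+y. \<integral>\<^sup>+x. f x * g (x + T y) \<partial>lborel \<partial>lborel)"
    by (intro lborel_pair.Fubini') simp
  also have "\<dots> = (\<integral>\<^sup>+y. \<integral>\<^sup>+x. f (x - T y) * g x \<partial>lborel \<partial>lborel)"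
  proof (rule nn_integral_cong)
    fix y :: 'a
    show "(\<integral>\<^sup>+x. f x * g (x + T y) \<partial>lborel) = (\<integral>\<^sup>+x. f (x - T y) * g x \<partial>lborel)"
      using nn_integral_lborel_shift[of "\<lambda>x. f (x - T y) * g x" "T y"] by (simp add: add.commute)
  qed
  also have "\<dots> = (\<integral>\<^sup>+x. \<integral>\<^sup>+y. f (x - T y) * g x \<partial>lborel \<partial>lborel)"
    by (intro lborel_pair.Fubini') simp
  also have "\<dots> = (\<integral>\<^sup>+x. ?b * g x \<partial>lborel)"
  proof (rule nn_integral_cong)
    fix x :: 'a
    obtain z where z: "T z = x" using \<open>surj T\<close> by (metis surjD)
    \<comment> \<open>\<open>f\<close> is the indicator of a centred ball, so only the norm of its
      argument counts, and \<open>T\<close> preserves it.\<close>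
    have "f (x - T y) = f (- z + y)" for y
    proof -
      have "x - T y = T (z - y)" using z lin by (simp add: linear_diff)
      then have "norm (x - T y) = norm (z - y)" using T by (simp add: orthogonal_transformation_norm)
      then show ?thesis by (simp add: f_def indicator_def norm_minus_commute)
    qed
    then have "(\<integral>\<^sup>+y. f (x - T y) * g x \<partial>lborel) = (\<integral>\<^sup>+y. f (- z + y) * g x \<partial>lborel)" by simp
    also have "\<dots> = (\<integral>\<^sup>+y. f y * g x \<partial>lborel)"
      by (rule nn_integral_lborel_shift[of "\<lambda>y. f y * g x"]) simp
    also have "\<dots> = ?b * g x" by (simp add: nn_integral_multc fb)
    finally show "(\<integral>\<^sup>+y. f (x - T y) * g x \<partial>lborel) = ?b * g x" .
  qed
  also have "\<dots> = ?b * (\<integral>\<^sup>+x. g x \<partial>lborel)" by (simp add: nn_integral_cmult)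
  finally have "?b * (\<integral>\<^sup>+x. g (T x) \<partial>lborel) = ?b * (\<integral>\<^sup>+x. g x \<partial>lborel)" .
  moreover have "?b \<noteq> 0" "?b \<noteq> \<infinity>"
    using emeasure_lborel_ball_finite[of "0::'a" 1] content_ball_pos[of 1 "0::'a"] 
    by (auto simp: emeasure_eq_ennreal_measure)
  ultimately show ?thesis by (simp add: ennreal_mult_cancel_left)
qed

locale sphere_measure =
  fixes \<sigma> :: "'a::euclidean_space measure" and \<kappa> :: real
  assumes kappa_pos: "0 < \<kappa>" and sigma_eq: "\<sigma> = scale_measure (ennreal \<kappa>) surface_measure"
begin

lemma space_sigma [simp]: "space \<sigma> = sphere 0 1"
  by (simp add: sigma_eq surface_measure_def space_scale_measure space_restrict_space)

lemma sets_sigma [measurable_cong]: "sets \<sigma> = sets (restrict_space borel (sphere 0 1))"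
  by (simp add: sigma_eq surface_measure_def)

lemma sgn_measurable [measurable]:
  "sgn \<in> restrict_space lborel (ball 0 1 - {0}) \<rightarrow>\<^sub>M restrict_space borel (sphere 0 1 :: 'a set)"
proof (rule measurable_restrict_space2)
  show "sgn \<in> space (restrict_space lborel (ball 0 1 - {0 :: 'a})) \<rightarrow> sphere 0 1"
    by (auto simp: space_restrict_space norm_sgn)
  show "sgn \<in> restrict_space lborel (ball 0 1 - {0}) \<rightarrow>\<^sub>M (borel :: 'a measure)"
    by (rule measurable_restrict_space1) (simp add: sgn_div_norm[abs_def])
qed

text \<open>The measure of a set of directions is the volume of a cone, so spherical integrals are
  Lebesgue integrals of functions of \<open>sgn x\<close>. Rotation invariance and the treatment of
  null sets are inherited from Lebesgue measure in this way.\<close>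

lemma nn_integral_sigma:
  assumes "f \<in> borel_measurable \<sigma>"
  shows "(\<integral>\<^sup>+x. f x \<partial>\<sigma>) = ennreal (\<kappa> * DIM('a)) * 
    (\<integral>\<^sup>+x. f (sgn x) * indicator (ball 0 1 - {0}) x \<partial>lborel)"
proof -
  have f: "f \<in> borel_measurable (restrict_space borel (sphere 0 1))"
    using assms measurable_cong_sets[OF sets_sigma refl] by blast
  have "(\<integral>\<^sup>+x. f x \<partial>\<sigma>) = ennreal \<kappa> * (of_nat DIM('a) * 
    (\<integral>\<^sup>+x. f (sgn x) \<partial>restrict_space lborel (ball 0 1 - {0})))"
    unfolding sigma_eq surface_measure_def using f
    by (subst nn_integral_scale_measure, simp)+ (simp add: nn_integral_distr)
  also have "\<dots> = ennreal (\<kappa> * DIM('a)) * 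
    (\<integral>\<^sup>+x. f (sgn x) * indicator (ball 0 1 - {0}) x \<partial>lborel)"
    using kappa_pos
    by (subst nn_integral_restrict_space) (auto simp: ennreal_mult mult.assoc ennreal_of_nat_eq_real_of_nat)
  finally show ?thesis .
qed

lemma measurable_sigma_continuous:
  assumes "continuous_on (sphere 0 1) f"
  shows "f \<in> borel_measurable \<sigma>"
  using borel_measurable_continuous_on_restrict[OF assms] measurable_cong_sets[OF sets_sigma refl] by blast

sublocale finite_measure \<sigma>
proof
  have "emeasure \<sigma> (space \<sigma>) = (\<integral>\<^sup>+x. 1 \<partial>\<sigma>)" by simp
  also have "\<dots> = ennreal (\<kappa> * DIM('a)) * emeasure lborel (ball 0 1 - {0::'a})"
    by (subst nn_integral_sigma) auto
  also have "\<dots> < \<infinity>"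
  proof -
    have "emeasure lborel (ball 0 1 - {0::'a}) \<le> emeasure lborel (ball (0::'a) 1)"
      by (rule emeasure_mono) auto
    also have "\<dots> < \<infinity>" by (rule emeasure_lborel_ball_finite)
    finally show ?thesis by (simp add: ennreal_mult_less_top)
  qed
  finally show "emeasure \<sigma> (space \<sigma>) \<noteq> \<infinity>" by simp
qed

definition \<omega> :: real where "\<omega> = measure \<sigma> (sphere 0 1)"

text \<open>A nonzero value persists on a neighbourhood in the sphere, and the cone \<open>W\<close>
  over the nonzero set is open, hence contains a ball of positive volume.\<close>

lemma sigma_null_continuous:
  fixes u :: "'a \<Rightarrow> 'b::real_normed_vector"
  assumes "continuous_on (sphere 0 1) u" "AE x in \<sigma>. u x = 0" "norm x = 1"
  shows "u x = 0"
proof (rule ccontr)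
  assume "u x \<noteq> 0"
  define f where "f x = ennreal (norm (u x))" for x
  have f: "f \<in> borel_measurable \<sigma>" unfolding f_def
    by (intro measurable_compose[OF _ measurable_ennreal] measurable_sigma_continuous continuous_intros assms)
  have "(\<integral>\<^sup>+x. f x \<partial>\<sigma>) = 0" 
    using assms(2) f by (subst nn_integral_0_iff_AE) (auto simp: f_def)
  moreover have "f (sgn x) * indicator (ball 0 1 - {0}) x = f (sgn x) * indicator (ball 0 1 - {0::'a}) x" for x by simp
  have m: "(\<lambda>x. f (sgn x) * indicator (ball 0 1 - {0}) x) \<in> borel_measurable lborel"
  proof -
    have "f \<in> borel_measurable (restrict_space borel (sphere 0 1))"
      using f measurable_cong_sets[OF sets_sigma refl] by blast
    then have "(\<lambda>x. f (sgn x)) \<in> borel_measurable (restrict_space lborel (ball 0 1 - {0}))" by simp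
    then show ?thesis by (subst borel_measurable_restrict_space_iff_ennreal[symmetric]) auto
  qed
  ultimately have "(\<integral>\<^sup>+x. f (sgn x) * indicator (ball 0 1 - {0}) x \<partial>lborel) = 0"
    using kappa_pos nn_integral_sigma[OF f] by auto
  then have ae: "AE x in lborel. f (sgn x) * indicator (ball 0 1 - {0}) x = 0"
    using m by (subst (asm) nn_integral_0_iff_AE) auto
  define W where "W = {z \<in> ball 0 1 - {0}. u (sgn z) \<in> - {0}}"
  have "continuous_on (ball 0 1 - {0}) (\<lambda>z. u (sgn z))"
    by (rule continuous_on_compose2[OF assms(1)]) (auto intro!: continuous_intros simp: norm_sgn split: if_splits)
  then have "open W" unfolding W_def
    using continuous_open_preimage[of "ball 0 1 - {0}" "\<lambda>z. u (sgn z)" "- {0}"]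
    by (auto simp: vimage_def Int_def open_delete)
  moreover have "(1/2) *\<^sub>R x \<in> W" using assms(3) \<open>u x \<noteq> 0\<close> by (auto simp: W_def sgn_div_norm)
  ultimately obtain e where e: "e > 0" "ball ((1/2) *\<^sub>R x) e \<subseteq> W" by (meson openE)
  have "AE x in lborel. x \<notin> W" using ae by eventually_elim (auto simp: W_def f_def indicator_def split: if_splits)
  then have "AE y in lborel. y \<notin> ball ((1/2) *\<^sub>R x) e" by eventually_elim (use e in auto)
  then have "ball ((1/2) *\<^sub>R x) e \<in> null_sets lborel" by (subst AE_iff_null_sets) auto
  then show False using content_ball_pos[OF e(1), of "(1/2) *\<^sub>R x"] by (auto simp: null_sets_def measure_def)
qed

end

section \<open>The Poisson integral\<close>

lemma sqdist_powr_has_derivative: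
  fixes x z :: "'a::euclidean_space"
  assumes "x \<noteq> z"
  shows "((\<lambda>x. ((x - z) \<bullet> (x - z)) powr a) has_derivative
    (\<lambda>v. 2 * a * ((x - z) \<bullet> (x - z)) powr (a - 1) * ((x - z) \<bullet> v))) (at x)"
proof -
  have "(x - z) \<bullet> (x - z) > 0" using assms by simp
  then have "((\<lambda>t. t powr a) has_real_derivative a * ((x - z) \<bullet> (x - z)) powr (a - 1)) (at ((x - z) \<bullet> (x - z)))"
    by (rule has_real_derivative_powr)
  moreover have "((\<lambda>x. (x - z) \<bullet> (x - z)) has_derivative (\<lambda>v. 2 * ((x - z) \<bullet> v))) (at x)"
    by (auto intro!: derivative_eq_intros simp: inner_commute)
  ultimately have "((\<lambda>x. ((x - z) \<bullet> (x - z)) powr a) has_derivative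
     (\<lambda>v. (2 * ((x - z) \<bullet> v)) * (a * ((x - z) \<bullet> (x - z)) powr (a - 1)))) (at x)"
    by (rule DERIV_compose_FDERIV)
  then show ?thesis by (simp add: mult_ac)
qed

text \<open>Gradient in \<open>x\<close> of (1 - |x|^2) |x - z|^(2a), which for a = -n/2 is the
  Poisson kernel up to a constant. The exponent stays general because its value matters only for the
  trace of the Hessian.\<close>

definition poisson_grad :: "real \<Rightarrow> 'a::euclidean_space \<Rightarrow> 'a \<Rightarrow> 'a" where
  "poisson_grad a x z = (-2 * ((x - z) \<bullet> (x - z)) powr a) *\<^sub>R x
     + (2 * a * (1 - x \<bullet> x) * ((x - z) \<bullet> (x - z)) powr (a - 1)) *\<^sub>R (x - z)"

text \<open>The row in direction \<open>b\<close> of the Hessian of the same function.\<close>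

definition poisson_hess :: "real \<Rightarrow> 'a::euclidean_space \<Rightarrow> 'a \<Rightarrow> 'a \<Rightarrow> 'a" where
  "poisson_hess a b x z =
     (-2 * ((x - z) \<bullet> (x - z)) powr a + 2 * a * (1 - x \<bullet> x) * ((x - z) \<bullet> (x - z)) powr (a - 1)) *\<^sub>R b
     - (4 * a * (x \<bullet> b) * ((x - z) \<bullet> (x - z)) powr (a - 1)) *\<^sub>R (x - z)
     - (4 * a * ((x - z) \<bullet> b) * ((x - z) \<bullet> (x - z)) powr (a - 1)) *\<^sub>R x
     + (4 * a * (a - 1) * (1 - x \<bullet> x) * ((x - z) \<bullet> (x - z)) powr (a - 2) * ((x - z) \<bullet> b)) *\<^sub>R (x - z)"

lemma poisson_grad_has_derivative:
  fixes x z :: "'a::euclidean_space"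
  assumes "x \<noteq> z"
  shows "((\<lambda>x. (1 - x \<bullet> x) * ((x - z) \<bullet> (x - z)) powr a) has_derivative (\<lambda>v. poisson_grad a x z \<bullet> v)) (at x)"
  unfolding poisson_grad_def
  by (rule derivative_eq_intros sqdist_powr_has_derivative[OF assms] refl)+
    (auto simp: fun_eq_iff algebra_simps inner_commute)

lemma poisson_hess_has_derivative:
  fixes x z :: "'a::euclidean_space"
  assumes "x \<noteq> z"
  shows "((\<lambda>x. poisson_grad a x z \<bullet> b) has_derivative (\<lambda>v. poisson_hess a b x z \<bullet> v)) (at x)"
proof -
  have *: "a - 1 - 1 = a - 2" by simp
  show ?thesis
    unfolding poisson_grad_def poisson_hess_def inner_add_left inner_scaleR_left
    by (rule derivative_eq_intros sqdist_powr_has_derivative[OF assms] refl)+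
      (auto simp: fun_eq_iff algebra_simps inner_commute *)
qed

text \<open>With D = |x - z|^2, the common factor D^(a-1) leaves an expression in |x|^2, D and the
  inner product of \<open>x\<close> and \<open>z\<close>. It vanishes for a = -n/2, because |z| = 1
  expresses D through the other two quantities.\<close>

lemma poisson_hess_trace:
  fixes x z :: "'a::euclidean_space"
  assumes "norm z = 1" "x \<noteq> z"
  shows "(\<Sum>b\<in>Basis. poisson_hess (- real DIM('a) / 2) b x z \<bullet> b) = 0"
proof -
  define n where "n = real DIM('a)"
  define a where "a = - n / 2"
  define D where "D = (x - z) \<bullet> (x - z)"
  have D: "D > 0" using assms by (simp add: D_def)
  have p1: "D powr a = D powr (a - 1) * D" and p2: "D powr (a - 1) = D powr (a - 2) * D"
    using powr_add[of D "a - 1" 1] powr_add[of D "a - 2" 1] D by auto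
  have s: "(\<Sum>b\<in>Basis. (u \<bullet> b) * (w \<bullet> b)) = u \<bullet> w" for u w :: 'a
    by (simp add: euclidean_inner[of u w])
  have "(\<Sum>b\<in>Basis. poisson_hess a b x z \<bullet> b) =
    (\<Sum>b\<in>Basis. (-2 * D powr a + 2 * a * (1 - x \<bullet> x) * D powr (a - 1))
     - 8 * a * D powr (a - 1) * ((x \<bullet> b) * ((x - z) \<bullet> b))
     + 4 * a * (a - 1) * (1 - x \<bullet> x) * D powr (a - 2) * (((x - z) \<bullet> b) * ((x - z) \<bullet> b)))"
    by (intro sum.cong refl) (simp add: poisson_hess_def D_def inner_add_left inner_diff_left algebra_simps)
  also have "\<dots> = n * (-2 * D powr a + 2 * a * (1 - x \<bullet> x) * D powr (a - 1))
     - 8 * a * D powr (a - 1) * (x \<bullet> (x - z)) + 4 * a * (a - 1) * (1 - x \<bullet> x) * D powr (a - 2) * D"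
    unfolding sum.distrib sum_subtractf sum_distrib_left[symmetric] s D_def n_def by (simp add: algebra_simps)
  also have "\<dots> = D powr (a - 1) * (n * (-2 * D + 2 * a * (1 - x \<bullet> x)) - 8 * a * (x \<bullet> (x - z)) + 4 * a * (a - 1) * (1 - x \<bullet> x))"
    by (simp add: p1 p2 algebra_simps)
  also have "\<dots> = 0"
  proof -
    have "z \<bullet> z = 1" using assms by (simp add: dot_square_norm)
    then have D_eq: "D = x \<bullet> x - 2 * (x \<bullet> z) + 1" by (simp add: D_def inner_diff inner_commute)
    have "n * (-2 * D + 2 * a * (1 - x \<bullet> x)) - 8 * a * (x \<bullet> (x - z)) + 4 * a * (a - 1) * (1 - x \<bullet> x) = 0"
      unfolding a_def D_eq by (simp add: inner_diff_right field_simps)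
    then show ?thesis by simp
  qed
  finally show ?thesis unfolding a_def n_def .
qed

section \<open>Differentiation under the integral over the sphere\<close>

lemma uniform_on_compact_fibre:
  fixes H :: "'a::euclidean_space \<times> 'z::metric_space \<Rightarrow> 'b::metric_space"
  assumes "continuous_on (U \<times> Z) H" "open U" "compact Z" "x \<in> U" "\<epsilon> > 0"
  obtains \<delta> where "\<delta> > 0" "ball x \<delta> \<subseteq> U" "\<And>y z. y \<in> ball x \<delta> \<Longrightarrow> z \<in> Z \<Longrightarrow> dist (H (y, z)) (H (x, z)) < \<epsilon>"
proof -
  obtain r where r: "r > 0" "cball x r \<subseteq> U" using assms open_contains_cball by blast
  have "uniformly_continuous_on (cball x r \<times> Z) H"
    by (intro compact_uniformly_continuous continuous_on_subset[OF assms(1)] compact_Times) (use r assms in auto)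
  then obtain \<delta> where \<delta>: "\<delta> > 0" "\<And>p q. p \<in> cball x r \<times> Z \<Longrightarrow> q \<in> cball x r \<times> Z \<Longrightarrow> dist q p < \<delta> \<Longrightarrow> dist (H q) (H p) < \<epsilon>"
    using \<open>\<epsilon> > 0\<close> unfolding uniformly_continuous_on_def by metis
  show ?thesis
  proof (rule that[of "min \<delta> r"])
    show "dist (H (y, z)) (H (x, z)) < \<epsilon>" if "y \<in> ball x (min \<delta> r)" "z \<in> Z" for y z
      using that r by (intro \<delta>(2)) (auto simp: dist_Pair_Pair dist_commute)
  qed (use r \<delta> in auto)
qed

lemma continuous_on_fibre:
  "continuous_on (U \<times> Z) f \<Longrightarrow> x \<in> U \<Longrightarrow> continuous_on Z (\<lambda>z. f (x, z))"
  by (rule continuous_on_compose2[of "U \<times> Z" f Z "\<lambda>z. (x, z)"])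
     (auto intro!: continuous_on_Pair continuous_on_const continuous_on_id)

context sphere_measure
begin

lemma sphere_in_sets [simp]: "sphere 0 1 \<in> sets \<sigma>"
  using sets.top[of \<sigma>] by simp

lemma omega_pos: "0 < \<omega>"
proof (rule ccontr)
  assume "\<not> 0 < \<omega>"
  then have "measure \<sigma> (space \<sigma>) = 0" unfolding \<omega>_def using measure_nonneg[of \<sigma> "sphere 0 1"] by simp
  then have "emeasure \<sigma> (space \<sigma>) = 0" by (simp add: emeasure_eq_measure)
  then have "AE x in \<sigma>. (1::real) = 0"
    by (intro AE_I'[of "space \<sigma>"]) (auto simp: null_sets_def)
  moreover obtain x :: 'a where "norm x = 1" using vector_choose_size[of 1] by auto
  ultimately show False using sigma_null_continuous[of "\<lambda>_. 1::real" x] by simp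
qed

text \<open>\<open>T\<close> commutes with \<open>sgn\<close> and preserves the ball, so invariance
  follows from that of Lebesgue measure.\<close>

lemma distr_sigma_orthogonal:
  assumes T: "orthogonal_transformation T"
  shows "distr \<sigma> \<sigma> T = \<sigma>"
proof (rule measure_eqI)
  have lin: "linear T" using T orthogonal_transformation_linear by auto
  have cT: "continuous_on UNIV T"
    using lin by (intro linear_continuous_on) (simp add: linear_conv_bounded_linear[symmetric])
  have "T \<in> restrict_space borel (sphere 0 1) \<rightarrow>\<^sub>M restrict_space borel (sphere 0 1)"
    using borel_measurable_continuous_onI[OF cT] T
    by (intro measurable_restrict_space3) (auto simp: orthogonal_transformation_norm)
  then have mT: "T \<in> \<sigma> \<rightarrow>\<^sub>M \<sigma>"
    using measurable_cong_sets[OF sets_sigma sets_sigma] by blast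
  fix A assume "A \<in> sets (distr \<sigma> \<sigma> T)"
  then have A: "A \<in> sets \<sigma>" by simp
  define f :: "'a \<Rightarrow> ennreal" where "f x = indicator A (sgn x) * indicator (ball 0 1 - {0}) x" for x
  have "f \<in> borel_measurable lborel" unfolding f_def
  proof (subst borel_measurable_restrict_space_iff_ennreal[symmetric])
    have "indicator A \<in> borel_measurable (restrict_space borel (sphere 0 1))"
      using A sets_sigma by (intro borel_measurable_indicator) auto
    then show "(\<lambda>x. indicator A (sgn x)) \<in> borel_measurable (restrict_space lborel (ball 0 1 - {0}))"
      by (rule measurable_compose[OF sgn_measurable])
  qed auto
  then have f: "f \<in> borel_measurable borel" by simp
  have "emeasure (distr \<sigma> \<sigma> T) A = (\<integral>\<^sup>+x. indicator A x \<partial>distr \<sigma> \<sigma> T)" using A by simp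
  also have "\<dots> = (\<integral>\<^sup>+x. indicator A (T x) \<partial>\<sigma>)"
    using A by (intro nn_integral_distr mT) auto
  also have "\<dots> = ennreal (\<kappa> * DIM('a)) * (\<integral>\<^sup>+x. f (T x) \<partial>lborel)"
  proof (subst nn_integral_sigma)
    show "(\<lambda>x. indicator A (T x)) \<in> borel_measurable \<sigma>"
      using A by (intro measurable_compose[OF mT]) auto
    have "f (T x) = indicator A (T (sgn x)) * indicator (ball 0 1 - {0}) x" for x
    proof -
      have "T x = 0 \<longleftrightarrow> x = 0" using T lin by (metis linear_0 norm_eq_zero orthogonal_transformation_norm)
      moreover have "sgn (T x) = T (sgn x)"
        using T lin by (simp add: sgn_div_norm orthogonal_transformation_norm linear_scale)
      ultimately show ?thesis using T by (simp add: f_def indicator_def orthogonal_transformation_norm)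
    qed
    then show "ennreal (\<kappa> * DIM('a)) * (\<integral>\<^sup>+x. indicator A (T (sgn x)) * indicator (ball 0 1 - {0}) x \<partial>lborel)
      = ennreal (\<kappa> * DIM('a)) * (\<integral>\<^sup>+x. f (T x) \<partial>lborel)" by simp
  qed
  also have "\<dots> = ennreal (\<kappa> * DIM('a)) * (\<integral>\<^sup>+x. f x \<partial>lborel)"
    by (simp add: nn_integral_lborel_orthogonal[OF T f])
  also have "\<dots> = emeasure \<sigma> A"
    using nn_integral_sigma[of "indicator A"] A by (simp add: f_def)
  finally show "emeasure (distr \<sigma> \<sigma> T) A = emeasure \<sigma> A" .
qed simp

lemma integral_sigma_orthogonal:
  fixes f :: "'a \<Rightarrow> 'b::{banach,second_countable_topology}"
  assumes T: "orthogonal_transformation T" and f: "f \<in> borel_measurable \<sigma>"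
  shows "(LINT x|\<sigma>. f (T x)) = (LINT x|\<sigma>. f x)"
proof -
  have "T \<in> \<sigma> \<rightarrow>\<^sub>M \<sigma>"
  proof -
    have "continuous_on UNIV T"
      using T by (intro linear_continuous_on) (simp add: linear_conv_bounded_linear[symmetric] orthogonal_transformation_linear)
    then have "T \<in> restrict_space borel (sphere 0 1) \<rightarrow>\<^sub>M restrict_space borel (sphere 0 1)"
      using borel_measurable_continuous_onI T
      by (intro measurable_restrict_space3) (auto simp: orthogonal_transformation_norm)
    then show ?thesis using measurable_cong_sets[OF sets_sigma sets_sigma] by blast
  qed
  then show ?thesis
    using integral_distr[of T \<sigma> \<sigma> f] f distr_sigma_orthogonal[OF T] by simp
qed

lemma integrable_sigma_bounded:
  fixes f :: "'a \<Rightarrow> 'b::{banach,second_countable_topology}"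
  assumes "f \<in> borel_measurable \<sigma>" "\<And>x. norm x = 1 \<Longrightarrow> norm (f x) \<le> B"
  shows "integrable \<sigma> f"
  using assms by (intro integrable_const_bound[where B=B]) auto

lemma norm_sigma_integral_le:
  fixes f :: "'a \<Rightarrow> 'b::{banach,second_countable_topology}"
  assumes "f \<in> borel_measurable \<sigma>" "\<And>x. norm x = 1 \<Longrightarrow> norm (f x) \<le> B"
  shows "norm (LINT x|\<sigma>. f x) \<le> \<omega> * B"
proof -
  have "norm (LINT x|\<sigma>. f x) \<le> (LINT x|\<sigma>. norm (f x))" by simp
  also have "\<dots> \<le> (LINT x|\<sigma>. B)"
    by (intro integral_mono integrable_norm integrable_sigma_bounded[OF assms]) (use assms in auto)
  finally show ?thesis by (simp add: \<omega>_def)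
qed

lemma integrable_sigma_continuous_scaleR:
  fixes \<phi> :: "'a \<Rightarrow> 'b::{banach,second_countable_topology}" and h :: "'a \<Rightarrow> real"
  assumes "continuous_on (sphere 0 1) h" "\<phi> \<in> borel_measurable \<sigma>" "\<And>z. norm z = 1 \<Longrightarrow> norm (\<phi> z) \<le> B"
  shows "integrable \<sigma> (\<lambda>z. h z *\<^sub>R \<phi> z)"
proof -
  obtain M where M: "\<forall>z\<in>sphere 0 1. \<bar>h z\<bar> \<le> M"
    using compact_imp_bounded[OF compact_continuous_image[OF assms(1) compact_sphere]]
    unfolding bounded_iff by auto
  show ?thesis
  proof (rule integrable_sigma_bounded[where B="M * B"])
    show "(\<lambda>z. h z *\<^sub>R \<phi> z) \<in> borel_measurable \<sigma>"
      by (intro borel_measurable_scaleR measurable_sigma_continuous assms)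
    show "norm (h z *\<^sub>R \<phi> z) \<le> M * B" if "norm z = 1" for z
      using M assms(3)[OF that] that by (auto intro!: mult_mono intro: order_trans[OF abs_ge_zero])
  qed
qed

text \<open>\<open>\<phi>\<close> is only bounded and measurable, but the gradient of the kernel is
  jointly continuous and the sphere is compact. So the linearisation error is small uniformly in
  \<open>z\<close> and can simply be integrated.\<close>

lemma sigma_integral_has_derivative:
  fixes \<phi> :: "'a \<Rightarrow> 'b::{banach,second_countable_topology}" and k :: "'a \<Rightarrow> 'a \<Rightarrow> real" and G :: "'a \<Rightarrow> 'a \<Rightarrow> 'a"
  assumes U: "open U" "x \<in> U" and G: "continuous_on (U \<times> sphere 0 1) (\<lambda>(x, z). G x z)"
    and k: "\<And>x z. x \<in> U \<Longrightarrow> norm z = 1 \<Longrightarrow> ((\<lambda>x. k x z) has_derivative (\<lambda>v. G x z \<bullet> v)) (at x)"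
    and kc: "\<And>x. x \<in> U \<Longrightarrow> continuous_on (sphere 0 1) (k x)"
    and phi: "\<phi> \<in> borel_measurable \<sigma>" "\<And>z. norm z = 1 \<Longrightarrow> norm (\<phi> z) \<le> B"
  shows "((\<lambda>x. LINT z|\<sigma>. k x z *\<^sub>R \<phi> z) has_derivative (\<lambda>v. LINT z|\<sigma>. (G x z \<bullet> v) *\<^sub>R \<phi> z)) (at x)"
proof -
  have B: "B \<ge> 0" using phi(2) vector_choose_size[of 1] by (metis norm_ge_zero order_trans zero_le_one)
  have Gc: "continuous_on (sphere 0 1) (G y)" if "y \<in> U" for y
    using continuous_on_fibre[OF G that] by simp
  have intk: "integrable \<sigma> (\<lambda>z. k y z *\<^sub>R \<phi> z)" if "y \<in> U" for y
    by (rule integrable_sigma_continuous_scaleR[OF kc[OF that] phi])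
  have intG: "integrable \<sigma> (\<lambda>z. (G x z \<bullet> v) *\<^sub>R \<phi> z)" for v
    by (intro integrable_sigma_continuous_scaleR[OF _ phi] continuous_intros Gc U)
  show ?thesis unfolding has_derivative_at_alt
  proof (intro conjI allI impI)
    have "linear (\<lambda>v. LINT z|\<sigma>. (G x z \<bullet> v) *\<^sub>R \<phi> z)"
      by (rule linearI) (simp_all add: inner_add_right scaleR_add_left intG flip: scaleR_scaleR)
    then show "bounded_linear (\<lambda>v. LINT z|\<sigma>. (G x z \<bullet> v) *\<^sub>R \<phi> z)" by (simp add: linear_conv_bounded_linear)
    fix e :: real assume e: "e > 0"
    \<comment> \<open>The integrated error is at most \<open>\<omega> * \<epsilon> * B\<close> times
      the distance; \<open>B + 1\<close> avoids a division by 0.\<close>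
    define \<epsilon> where "\<epsilon> = e / (\<omega> * (B + 1))"
    have "\<epsilon> > 0" using e B omega_pos by (simp add: \<epsilon>_def)
    from uniform_on_compact_fibre[OF G U(1) compact_sphere U(2) this] obtain \<delta> where
      \<delta>: "\<delta> > 0" "ball x \<delta> \<subseteq> U" "\<And>y z. y \<in> ball x \<delta> \<Longrightarrow> z \<in> sphere 0 1 \<Longrightarrow> dist (G y z) (G x z) < \<epsilon>"
      by (auto simp: split_beta)
    show "\<exists>d>0. \<forall>y. norm (y - x) < d \<longrightarrow>
      norm ((LINT z|\<sigma>. k y z *\<^sub>R \<phi> z) - (LINT z|\<sigma>. k x z *\<^sub>R \<phi> z) - (LINT z|\<sigma>. (G x z \<bullet> (y - x)) *\<^sub>R \<phi> z)) \<le> e * norm (y - x)"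
    proof (intro exI[of _ \<delta>] conjI allI impI)
      fix y assume y: "norm (y - x) < \<delta>"
      then have yU: "y \<in> U" using \<delta>(2) by (metis dist_norm mem_ball norm_minus_commute subsetD)
      have lin: "\<bar>k y z - k x z - G x z \<bullet> (y - x)\<bar> \<le> \<epsilon> * norm (y - x)" if "norm z = 1" for z
      proof -
        \<comment> \<open>Subtracting the linear part leaves a function whose derivative at
          \<open>w\<close> is the small difference \<open>G w z - G x z\<close>, so the mean value
          inequality applies on the ball.\<close>
        have "norm ((k y z - G x z \<bullet> y) - (k x z - G x z \<bullet> x)) \<le> \<epsilon> * norm (y - x)"
        proof (rule differentiable_bound[OF convex_ball[of x \<delta>], where f="\<lambda>y. k y z - G x z \<bullet> y" and f'="\<lambda>w v. (G w z - G x z) \<bullet> v"])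
          fix w assume w: "w \<in> ball x \<delta>"
          show "((\<lambda>y. k y z - G x z \<bullet> y) has_derivative (\<lambda>v. (G w z - G x z) \<bullet> v)) (at w within ball x \<delta>)"
            unfolding inner_diff_left using w \<delta>(2) that
            by (intro has_derivative_at_withinI[OF has_derivative_diff] k has_derivative_inner_right has_derivative_ident) auto
          show "onorm (\<lambda>v. (G w z - G x z) \<bullet> v) \<le> \<epsilon>"
            using \<delta>(3)[OF w, of z] that 
            using \<open>\<epsilon> > 0\<close> by (intro onorm_bound) (auto simp: dist_norm intro!: order_trans[OF Cauchy_Schwarz_ineq2] mult_right_mono)
        qed (use y \<delta>(1) in \<open>auto simp: dist_norm norm_minus_commute\<close>)
        then show ?thesis by (simp add: inner_diff_right algebra_simps)
      qed
      have "norm (LINT z|\<sigma>. (k y z - k x z - G x z \<bullet> (y - x)) *\<^sub>R \<phi> z) \<le> \<omega> * ((\<epsilon> * norm (y - x)) * B)"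
      proof (rule norm_sigma_integral_le)
        show "(\<lambda>z. (k y z - k x z - G x z \<bullet> (y - x)) *\<^sub>R \<phi> z) \<in> borel_measurable \<sigma>"
          by (intro borel_measurable_scaleR measurable_sigma_continuous phi continuous_intros kc Gc U yU)
        show "norm ((k y z - k x z - G x z \<bullet> (y - x)) *\<^sub>R \<phi> z) \<le> (\<epsilon> * norm (y - x)) * B" if "norm z = 1" for z
          using lin[OF that] phi(2)[OF that] \<open>\<epsilon> > 0\<close> by (auto intro!: mult_mono)
      qed
      also have "(LINT z|\<sigma>. (k y z - k x z - G x z \<bullet> (y - x)) *\<^sub>R \<phi> z) =
        (LINT z|\<sigma>. k y z *\<^sub>R \<phi> z) - (LINT z|\<sigma>. k x z *\<^sub>R \<phi> z) - (LINT z|\<sigma>. (G x z \<bullet> (y - x)) *\<^sub>R \<phi> z)"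
        by (simp add: scaleR_diff_left intk intG U yU)
      also have "\<omega> * ((\<epsilon> * norm (y - x)) * B) = (\<omega> * \<epsilon> * B) * norm (y - x)" by simp
      also have "\<dots> \<le> e * norm (y - x)"
      proof (rule mult_right_mono)
        have "\<omega> * \<epsilon> * B = e * (B / (B + 1))" using omega_pos by (simp add: \<epsilon>_def)
        also have "\<dots> \<le> e * 1" by (rule mult_left_mono) (use B e in auto)
        finally show "\<omega> * \<epsilon> * B \<le> e" by simp
      qed simp
      finally show "norm ((LINT z|\<sigma>. k y z *\<^sub>R \<phi> z) - (LINT z|\<sigma>. k x z *\<^sub>R \<phi> z) - (LINT z|\<sigma>. (G x z \<bullet> (y - x)) *\<^sub>R \<phi> z)) \<le> e * norm (y - x)" .
    qed (rule \<delta>(1))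
  qed
qed

lemma sigma_integral_continuous:
  fixes \<phi> :: "'a \<Rightarrow> 'b::{banach,second_countable_topology}" and k :: "'a \<Rightarrow> 'a \<Rightarrow> real"
  assumes U: "open U" and k: "continuous_on (U \<times> sphere 0 1) (\<lambda>(x, z). k x z)"
    and phi: "\<phi> \<in> borel_measurable \<sigma>" "\<And>z. norm z = 1 \<Longrightarrow> norm (\<phi> z) \<le> B"
  shows "continuous_on U (\<lambda>x. LINT z|\<sigma>. k x z *\<^sub>R \<phi> z)"
proof -
  have B: "B \<ge> 0" using phi(2) vector_choose_size[of 1] by (metis norm_ge_zero order_trans zero_le_one)
  have kc: "continuous_on (sphere 0 1) (k y)" if "y \<in> U" for y
    using continuous_on_fibre[OF k that] by simp
  have intk: "integrable \<sigma> (\<lambda>z. k y z *\<^sub>R \<phi> z)" if "y \<in> U" for y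
    by (rule integrable_sigma_continuous_scaleR[OF kc[OF that] phi])
  show ?thesis unfolding continuous_on_iff
  proof (intro ballI allI impI)
    fix x and e :: real assume x: "x \<in> U" and e: "e > 0"
    define \<epsilon> where "\<epsilon> = e / (\<omega> * (B + 1)) / 2"
    have "\<epsilon> > 0" using e B omega_pos by (simp add: \<epsilon>_def)
    from uniform_on_compact_fibre[OF k U(1) compact_sphere x this] obtain \<delta> where
      \<delta>: "\<delta> > 0" "ball x \<delta> \<subseteq> U" "\<And>y z. y \<in> ball x \<delta> \<Longrightarrow> z \<in> sphere 0 1 \<Longrightarrow> dist (k y z) (k x z) < \<epsilon>"
      by (auto simp: split_beta)
    show "\<exists>d>0. \<forall>y\<in>U. dist y x < d \<longrightarrow> dist (LINT z|\<sigma>. k y z *\<^sub>R \<phi> z) (LINT z|\<sigma>. k x z *\<^sub>R \<phi> z) < e"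
    proof (intro exI[of _ \<delta>] conjI ballI impI)
      fix y assume y: "y \<in> U" "dist y x < \<delta>"
      have "norm (LINT z|\<sigma>. (k y z - k x z) *\<^sub>R \<phi> z) \<le> \<omega> * (\<epsilon> * B)"
      proof (rule norm_sigma_integral_le)
        show "(\<lambda>z. (k y z - k x z) *\<^sub>R \<phi> z) \<in> borel_measurable \<sigma>"
          by (intro borel_measurable_scaleR measurable_sigma_continuous phi continuous_intros kc x y)
        show "norm ((k y z - k x z) *\<^sub>R \<phi> z) \<le> \<epsilon> * B" if "norm z = 1" for z
          using \<delta>(3)[of y z] phi(2)[OF that] \<open>\<epsilon> > 0\<close> that y by (auto intro!: mult_mono simp: dist_real_def dist_commute)
      qed
      also have "(LINT z|\<sigma>. (k y z - k x z) *\<^sub>R \<phi> z) = (LINT z|\<sigma>. k y z *\<^sub>R \<phi> z) - (LINT z|\<sigma>. k x z *\<^sub>R \<phi> z)"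
        by (simp add: scaleR_diff_left intk x y)
      also have "\<omega> * (\<epsilon> * B) = e * (B / (2 * (B + 1)))" using omega_pos by (simp add: \<epsilon>_def)
      also have "\<dots> < e * 1" by (rule mult_strict_left_mono) (use B e in auto)
      finally show "dist (LINT z|\<sigma>. k y z *\<^sub>R \<phi> z) (LINT z|\<sigma>. k x z *\<^sub>R \<phi> z) < e" by (simp add: dist_norm)
    qed (rule \<delta>(1))
  qed
qed

text \<open>The classical kernel (1 - |x|^2) / |x - z|^n, divided by the total mass
  \<open>\<omega>\<close> because the normalisation \<open>\<kappa>\<close> of the measure is
  free.\<close>

definition poisson :: "'a \<Rightarrow> 'a \<Rightarrow> real" where
  "poisson x z = (1 - x \<bullet> x) * ((x - z) \<bullet> (x - z)) powr (- real DIM('a) / 2) / \<omega>"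

definition poisson_integral :: "('a \<Rightarrow> 'b) \<Rightarrow> 'a \<Rightarrow> 'b::{banach,second_countable_topology}" where
  "poisson_integral \<phi> x = (LINT z|\<sigma>. poisson x z *\<^sub>R \<phi> z)"

lemma ball_sphere_neq: "x \<in> ball 0 1 \<Longrightarrow> norm z = 1 \<Longrightarrow> x \<noteq> z" by auto

lemma sqdist_powr_continuous:
  "continuous_on (ball 0 1 \<times> sphere (0::'a) 1) (\<lambda>p. ((fst p - snd p) \<bullet> (fst p - snd p)) powr a)"
  by (intro continuous_intros) auto

text \<open>Differentiating twice under the integral leaves the trace of the Hessian of the kernel,
  which vanishes for every \<open>z\<close>.\<close>

lemma harmonic_poisson_integral:
  fixes \<phi> :: "'a \<Rightarrow> 'b::{banach,second_countable_topology}"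
  assumes phi: "\<phi> \<in> borel_measurable \<sigma>" "\<And>z. norm z = 1 \<Longrightarrow> norm (\<phi> z) \<le> B"
  shows "harmonic_on (poisson_integral \<phi>) (ball 0 1)"
proof -
  define a where "a = - real DIM('a) / 2"
  let ?B = "ball 0 1 :: 'a set" and ?S = "sphere 0 1 :: 'a set"
  define G where "G x z = (1 / \<omega>) *\<^sub>R poisson_grad a x z" for x z :: 'a
  define H where "H b x z = (1 / \<omega>) *\<^sub>R poisson_hess a b x z" for b x z :: 'a
  note ci = sqdist_powr_continuous continuous_on_add continuous_on_diff continuous_on_scaleR continuous_on_mult
    continuous_on_inner continuous_on_fst continuous_on_snd continuous_on_const continuous_on_id
  have G: "continuous_on (?B \<times> ?S) (\<lambda>(x, z). G x z)"
    unfolding G_def poisson_grad_def split_beta by (intro ci)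
  have H: "continuous_on (?B \<times> ?S) (\<lambda>(x, z). H b x z)" for b
    unfolding H_def poisson_hess_def split_beta by (intro ci)
  have Gc: "continuous_on ?S (G x)" if "x \<in> ?B" for x using continuous_on_fibre[OF G that] by simp
  have Hc: "continuous_on ?S (H b x)" if "x \<in> ?B" for x b using continuous_on_fibre[OF H that] by simp
  have pc: "continuous_on ?S (poisson x)" if "x \<in> ?B" for x
    unfolding poisson_def using that by (intro continuous_intros) (auto simp: omega_pos[THEN less_imp_neq, symmetric])
  have int: "integrable \<sigma> (\<lambda>z. (F z \<bullet> v) *\<^sub>R \<phi> z)" if "continuous_on ?S F" for F and v :: 'a
    by (intro integrable_sigma_continuous_scaleR[OF _ phi] continuous_intros that)
  have expand: "(\<lambda>v. LINT z|\<sigma>. (F z \<bullet> v) *\<^sub>R \<phi> z) = (\<lambda>v. \<Sum>b\<in>Basis. (v \<bullet> b) *\<^sub>R (LINT z|\<sigma>. (F z \<bullet> b) *\<^sub>R \<phi> z))"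
    if "continuous_on ?S F" for F :: "'a \<Rightarrow> 'a"
  proof
    fix v :: 'a
    have "(LINT z|\<sigma>. (F z \<bullet> v) *\<^sub>R \<phi> z) = (LINT z|\<sigma>. (\<Sum>b\<in>Basis. (v \<bullet> b) *\<^sub>R ((F z \<bullet> b) *\<^sub>R \<phi> z)))"
      by (intro Bochner_Integration.integral_cong refl) 
         (subst euclidean_inner, simp add: scaleR_sum_left mult.commute)
    also have "\<dots> = (\<Sum>b\<in>Basis. (v \<bullet> b) *\<^sub>R (LINT z|\<sigma>. (F z \<bullet> b) *\<^sub>R \<phi> z))"
      by (subst Bochner_Integration.integral_sum) (auto intro!: integrable_scaleR_right int that simp del: scaleR_scaleR)
    finally show "(LINT z|\<sigma>. (F z \<bullet> v) *\<^sub>R \<phi> z) = (\<Sum>b\<in>Basis. (v \<bullet> b) *\<^sub>R (LINT z|\<sigma>. (F z \<bullet> b) *\<^sub>R \<phi> z))" .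
  qed
  show ?thesis
  proof (rule harmonic_onI[where g="\<lambda>b x. LINT z|\<sigma>. (G x z \<bullet> b) *\<^sub>R \<phi> z" and h="\<lambda>b c x. LINT z|\<sigma>. (H b x z \<bullet> c) *\<^sub>R \<phi> z"])
    fix x :: 'a assume x: "x \<in> ?B"
    have "((\<lambda>x. poisson x z) has_derivative (\<lambda>v. G x z \<bullet> v)) (at x)" if "x \<in> ?B" "norm z = 1" for x z
      using has_derivative_mult_left[OF poisson_grad_has_derivative[OF ball_sphere_neq[OF that], of a], of "1/\<omega>"]
      by (simp add: poisson_def[abs_def] a_def G_def)
    from sigma_integral_has_derivative[OF open_ball x G this pc phi]
    show "(poisson_integral \<phi> has_derivative (\<lambda>v. \<Sum>b\<in>Basis. (v \<bullet> b) *\<^sub>R (LINT z|\<sigma>. (G x z \<bullet> b) *\<^sub>R \<phi> z))) (at x)"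
      unfolding poisson_integral_def[abs_def] expand[OF Gc[OF x]] by blast
    have "((\<lambda>x. G x z \<bullet> b) has_derivative (\<lambda>v. H b x z \<bullet> v)) (at x)" if "x \<in> ?B" "norm z = 1" for x z b
      using has_derivative_mult_left[OF poisson_hess_has_derivative[OF ball_sphere_neq[OF that], of a b], of "1/\<omega>"]
      by (simp add: G_def H_def)
    note Gd = this
    show "((\<lambda>x. LINT z|\<sigma>. (G x z \<bullet> b) *\<^sub>R \<phi> z) has_derivative (\<lambda>v. \<Sum>c\<in>Basis. (v \<bullet> c) *\<^sub>R (LINT z|\<sigma>. (H b x z \<bullet> c) *\<^sub>R \<phi> z))) (at x)"
      for b
      unfolding expand[OF Hc[OF x], symmetric]
    proof (rule sigma_integral_has_derivative[OF open_ball x H _ _ phi])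
      show "((\<lambda>x. G x z \<bullet> b) has_derivative (\<lambda>v. H b x z \<bullet> v)) (at x)" if "x \<in> ?B" "norm z = 1" for x z
        by (rule Gd[OF that])
      show "continuous_on ?S (\<lambda>z. G x z \<bullet> b)" if "x \<in> ?B" for x
        by (intro continuous_on_inner continuous_on_const Gc that)
    qed
    have "(\<Sum>b\<in>Basis. (LINT z|\<sigma>. (H b x z \<bullet> b) *\<^sub>R \<phi> z)) = (LINT z|\<sigma>. (\<Sum>b\<in>Basis. (H b x z \<bullet> b) *\<^sub>R \<phi> z))"
      by (subst Bochner_Integration.integral_sum) (auto intro!: int Hc x)
    also have "\<dots> = (LINT z|\<sigma>. 0)"
    proof (intro Bochner_Integration.integral_cong refl)
      fix z :: 'a assume "z \<in> space \<sigma>"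
      then have "(\<Sum>b\<in>Basis. poisson_hess a b x z \<bullet> b) = 0"
        unfolding a_def using ball_sphere_neq[OF x] by (intro poisson_hess_trace) auto
      then have "(\<Sum>b\<in>Basis. H b x z \<bullet> b) = 0" by (simp add: H_def sum_divide_distrib[symmetric])
      then show "(\<Sum>b\<in>Basis. (H b x z \<bullet> b) *\<^sub>R \<phi> z) = 0" by (simp flip: scaleR_sum_left)
    qed
    finally show "(\<Sum>b\<in>Basis. (LINT z|\<sigma>. (H b x z \<bullet> b) *\<^sub>R \<phi> z)) = 0" by simp
  next
    fix b c :: 'a
    show "continuous_on ?B (\<lambda>x. LINT z|\<sigma>. (H b x z \<bullet> c) *\<^sub>R \<phi> z)"
    proof (rule sigma_integral_continuous[OF open_ball _ phi])
      show "continuous_on (?B \<times> ?S) (\<lambda>(x, z). H b x z \<bullet> c)"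
        using continuous_on_inner[OF H[of b] continuous_on_const] by (simp add: split_beta)
    qed
  qed
qed

end

section \<open>The Poisson formula\<close>

lemma orthogonal_transformation_same_norm:
  fixes x y :: "'a::real_inner"
  assumes "norm x = norm y"
  obtains T where "orthogonal_transformation T" "T x = y"
proof (cases "x = y")
  case True
  then show ?thesis using that[of "\<lambda>x. x"] by (auto simp: orthogonal_transformation_def linear_iff)
next
  case False
  \<comment> \<open>\<open>T\<close> is the reflection in the hyperplane orthogonal to
    \<open>x - y\<close>, which exchanges \<open>x\<close> and \<open>y\<close>.\<close>
  define w where "w = x - y"
  define T where "T v = v - (2 * (v \<bullet> w) / (w \<bullet> w)) *\<^sub>R w" for v
  have w: "w \<bullet> w \<noteq> 0" using False by (simp add: w_def)
  have "orthogonal_transformation T"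
    unfolding orthogonal_transformation_def
  proof (intro conjI allI)
    show "linear T" unfolding T_def
      by (rule linearI) (auto simp: inner_add_left algebra_simps add_divide_distrib)
    show "T u \<bullet> T v = u \<bullet> v" for u v
      using w by (simp add: T_def inner_diff inner_commute field_simps)
  qed
  moreover have "T x = y"
  proof -
    have "x \<bullet> x = y \<bullet> y" using assms by (simp add: dot_square_norm)
    then have "2 * (x \<bullet> w) = w \<bullet> w" by (simp add: w_def inner_diff inner_commute)
    then show ?thesis using w by (simp add: T_def) (simp add: w_def)
  qed
  ultimately show ?thesis by (rule that)
qed

context sphere_measure
begin

lemma poisson_pos:
  assumes "x \<in> ball 0 1" "norm z = 1"
  shows "0 < poisson x z"
proof -
  have "x \<bullet> x < 1" using assms by (simp add: dot_square_norm power_less_one_iff)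
  then show ?thesis unfolding poisson_def using omega_pos ball_sphere_neq[OF assms] by simp
qed

lemma poisson_continuous:
  assumes "x \<in> ball 0 1"
  shows "continuous_on (sphere 0 1) (poisson x)"
  unfolding poisson_def using assms
  by (intro continuous_intros) (auto simp: omega_pos[THEN less_imp_neq, symmetric])

lemma poisson_orthogonal:
  assumes "orthogonal_transformation T"
  shows "poisson (T x) (T z) = poisson x z"
proof -
  have "T x - T z = T (x - z)"
    using assms by (simp add: orthogonal_transformation_linear linear_diff)
  then show ?thesis using assms by (simp add: poisson_def orthogonal_transformation_def)
qed

text \<open>Rotation invariance makes the integral a radial harmonic function of \<open>x\<close>.
  As it is constant on the sphere through \<open>x\<close>, the maximum principle for it and for its
  negative equates it with its value at the centre, where the kernel is the constant
  \<open>1 / \<omega>\<close>.\<close>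

lemma integral_poisson:
  assumes x: "x \<in> ball 0 1"
  shows "(LINT z|\<sigma>. poisson x z) = 1"
proof -
  define F where "F x = (LINT z|\<sigma>. poisson x z)" for x
  have F: "harmonic_on F (ball 0 1)"
    using harmonic_poisson_integral[of "\<lambda>_. 1::real" 1] by (simp add: poisson_integral_def[abs_def] F_def[abs_def])
  have radial: "F y = F x" if yx: "norm y = norm x" for y
  proof -
    obtain T where T: "orthogonal_transformation T" "T x = y"
      using orthogonal_transformation_same_norm[OF yx[symmetric]] by blast
    have y: "y \<in> ball 0 1" using x yx by simp
    have "F y = (LINT z|\<sigma>. poisson y (T z))"
      unfolding F_def by (rule integral_sigma_orthogonal[symmetric]) 
        (auto intro!: T measurable_sigma_continuous poisson_continuous y)
    also have "\<dots> = F x" using poisson_orthogonal[OF T(1)] T(2) by (auto simp: F_def)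
    finally show ?thesis .
  qed
  have "F 0 \<le> F x"
    using x by (intro harmonic_max_principle[OF F _ eq_refl[OF radial]]) auto
  moreover have "- F 0 \<le> - F x"
    using x by (intro harmonic_max_principle[OF harmonic_on_linear[OF F bounded_linear_minus[OF bounded_linear_ident]] _ 
          eq_refl[OF arg_cong[OF radial]]]) auto
  moreover have "F 0 = 1"
  proof -
    have "F 0 = (LINT z|\<sigma>. 1 / \<omega>)" unfolding F_def
      by (intro Bochner_Integration.integral_cong refl) (auto simp: poisson_def dot_square_norm)
    then show ?thesis using omega_pos by (simp add: \<omega>_def)
  qed
  ultimately show ?thesis by (simp add: F_def)
qed

lemma integrable_poisson_scaleR:
  fixes \<phi> :: "'a \<Rightarrow> 'b::{banach,second_countable_topology}"
  assumes "x \<in> ball 0 1" "continuous_on (sphere 0 1) \<phi>"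
  shows "integrable \<sigma> (\<lambda>z. poisson x z *\<^sub>R \<phi> z)"
proof -
  obtain M where "\<forall>z\<in>sphere 0 1. norm (\<phi> z) \<le> M"
    using compact_imp_bounded[OF compact_continuous_image[OF assms(2) compact_sphere]]
    unfolding bounded_iff by auto
  then show ?thesis
    by (intro integrable_sigma_continuous_scaleR[where B=M] poisson_continuous assms measurable_sigma_continuous) auto
qed

text \<open>The boundary behaviour of the Poisson integral is replaced by an estimate slightly
  inside: on a sphere of radius \<open>r\<close> close to 1 it differs from \<open>f\<close> by at
  most 2 \<epsilon>, and the maximum principle carries this to the interior. Near \<open>x\<close>
  the estimate rests on uniform continuity of \<open>f\<close>, away from \<open>x\<close> on the
  smallness of 1 - r^2.\<close>

lemma poisson_formula_real:
  fixes f :: "'a \<Rightarrow> real"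
  assumes c: "continuous_on (cball 0 1) f" and h: "harmonic_on f (ball 0 1)" and x0: "x0 \<in> ball 0 1"
  shows "poisson_integral f x0 = f x0"
proof -
  define n where "n = real DIM('a)"
  have cs: "continuous_on (sphere 0 1) f" using c by (rule continuous_on_subset) auto
  obtain M where M: "\<forall>z\<in>cball 0 1. norm (f z) \<le> M"
    using compact_imp_bounded[OF compact_continuous_image[OF c compact_cball]]
    unfolding bounded_iff by auto
  have M0: "M \<ge> 0" using M by (metis centre_in_cball norm_ge_zero order_trans zero_le_one)
  have hp: "harmonic_on (poisson_integral f) (ball 0 1)"
    by (rule harmonic_poisson_integral[of _ M]) (use M in \<open>auto intro!: measurable_sigma_continuous cs\<close>)
  have est: "\<bar>poisson_integral f x0 - f x0\<bar> \<le> 2 * \<epsilon>" if "\<epsilon> > 0" for \<epsilon>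
  proof -
    have "uniformly_continuous_on (cball 0 1) f" using c by (intro compact_uniformly_continuous) auto
    then obtain \<delta> where \<delta>: "\<delta> > 0" "\<And>x z. x \<in> cball 0 1 \<Longrightarrow> z \<in> cball 0 1 \<Longrightarrow> dist z x < \<delta> \<Longrightarrow> dist (f z) (f x) < \<epsilon>"
      unfolding uniformly_continuous_on_def using \<open>\<epsilon> > 0\<close> by metis
    \<comment> \<open>At distance at least \<open>\<delta>\<close> the kernel is at most \<open>(1 -
      r\<^sup>2) * (\<delta>\<^sup>2) powr (- n / 2) / \<omega>\<close>, and \<open>f\<close> varies
      by at most \<open>2 * M\<close>.\<close>
    define C where "C = 2 * M * (\<delta>\<^sup>2) powr (- n / 2)"
    have C: "C \<ge> 0" using M0 by (simp add: C_def)
    \<comment> \<open>Since 1 - r^2 \<le> 2 (1 - r), this makes (1 - r^2) C at most \<epsilon>; the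
      denominator keeps the fraction strictly between 0 and 1.\<close>
    define r where "r = max (norm x0) (1 - \<epsilon> / (2 * C + 2 * \<epsilon> + 1))"
    have e1: "\<epsilon> / (2 * C + 2 * \<epsilon> + 1) > 0" "\<epsilon> / (2 * C + 2 * \<epsilon> + 1) < 1" using C \<open>\<epsilon> > 0\<close> by (auto simp: field_simps)
    have r: "norm x0 \<le> r" "r < 1" "0 \<le> r" using x0 e1 by (auto simp: r_def)
    have rC: "(1 - r\<^sup>2) * C \<le> \<epsilon>"
    proof -
      have "1 - r\<^sup>2 = (1 - r) * (1 + r)" by (simp add: power2_eq_square algebra_simps)
      also have "\<dots> \<le> (\<epsilon> / (2 * C + 2 * \<epsilon> + 1)) * 2" using r e1 by (intro mult_mono) (auto simp: r_def)
      finally have "(1 - r\<^sup>2) * C \<le> (\<epsilon> / (2 * C + 2 * \<epsilon> + 1)) * 2 * C" using C by (rule mult_right_mono)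
      also have "\<dots> \<le> \<epsilon>" using C \<open>\<epsilon> > 0\<close> by (simp add: field_simps)
      finally show ?thesis .
    qed
    have bd: "\<bar>poisson_integral f x - f x\<bar> \<le> 2 * \<epsilon>" if x: "norm x = r" for x
    proof -
      have xb: "x \<in> ball 0 1" using x r by simp
      have ip: "integrable \<sigma> (poisson x)" 
        using integrable_poisson_scaleR[OF xb, of "\<lambda>_. 1::real"] by (simp add: continuous_intros)
      have ipf: "integrable \<sigma> (\<lambda>z. poisson x z *\<^sub>R f z)" by (rule integrable_poisson_scaleR[OF xb cs])
      have "poisson_integral f x - f x = (LINT z|\<sigma>. poisson x z *\<^sub>R f z) - (LINT z|\<sigma>. poisson x z * f x)"
        using integral_poisson[OF xb] by (simp add: poisson_integral_def)
      also have "\<dots> = (LINT z|\<sigma>. poisson x z * (f z - f x))"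
        using ipf ip by (simp add: right_diff_distrib)
      finally have eq: "poisson_integral f x - f x = (LINT z|\<sigma>. poisson x z * (f z - f x))" .
      have "\<bar>poisson_integral f x - f x\<bar> \<le> (LINT z|\<sigma>. \<epsilon> * poisson x z + (1 - r\<^sup>2) * C / \<omega>)"
        unfolding eq real_norm_def[symmetric]
      proof (rule order_trans[OF integral_norm_bound integral_mono])
        show "integrable \<sigma> (\<lambda>z. norm (poisson x z * (f z - f x)))"
          using ipf ip by (intro integrable_norm) (simp add: right_diff_distrib)
        show "integrable \<sigma> (\<lambda>z. \<epsilon> * poisson x z + (1 - r\<^sup>2) * C / \<omega>)" using ip by simp
        fix z assume "z \<in> space \<sigma>"
        then have z: "norm z = 1" by simp
        have p: "poisson x z > 0" by (rule poisson_pos[OF xb z])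
        have r2: "1 - r\<^sup>2 \<ge> 0" using r by (simp add: power_le_one)
        show "norm (poisson x z * (f z - f x)) \<le> \<epsilon> * poisson x z + (1 - r\<^sup>2) * C / \<omega>"
        proof (cases "dist z x < \<delta>")
          case True
          then have "\<bar>f z - f x\<bar> \<le> \<epsilon>" using \<delta>(2)[of x z] z xb by (auto simp: dist_real_def)
          then have "poisson x z * \<bar>f z - f x\<bar> \<le> poisson x z * \<epsilon>" using p by (intro mult_left_mono) auto
          moreover have "0 \<le> (1 - r\<^sup>2) * C / \<omega>" using r2 C omega_pos by simp
          moreover have "poisson x z * \<epsilon> = \<epsilon> * poisson x z" by simp
          ultimately show ?thesis unfolding real_norm_def abs_mult abs_of_pos[OF p] by linarith
        next
          case False
          then have "\<delta> \<le> norm (x - z)" by (simp add: dist_norm norm_minus_commute)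
          then have "\<delta>\<^sup>2 \<le> (x - z) \<bullet> (x - z)" using \<delta>(1) by (simp add: dot_square_norm power_mono)
          then have "((x - z) \<bullet> (x - z)) powr (- n / 2) \<le> (\<delta>\<^sup>2) powr (- n / 2)"
            using \<delta>(1) by (intro powr_mono2') (auto simp: n_def)
          then have "poisson x z \<le> (1 - r\<^sup>2) * (\<delta>\<^sup>2) powr (- n / 2) / \<omega>"
            unfolding poisson_def n_def using x r2 omega_pos
            by (intro divide_right_mono mult_mono) (auto simp: dot_square_norm)
          moreover have "\<bar>f z - f x\<bar> \<le> 2 * M"
          proof -
            have "\<bar>f z\<bar> \<le> M" "\<bar>f x\<bar> \<le> M" using M z xb by auto
            then show ?thesis by linarith
          qed
          ultimately have "poisson x z * \<bar>f z - f x\<bar> \<le> ((1 - r\<^sup>2) * (\<delta>\<^sup>2) powr (- n / 2) / \<omega>) * (2 * M)"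
            using p by (intro mult_mono) (auto intro: order_trans[OF less_imp_le])
          also have "\<dots> = (1 - r\<^sup>2) * C / \<omega>" by (simp add: C_def)
          finally show ?thesis using mult_pos_pos[OF \<open>\<epsilon> > 0\<close> p] unfolding real_norm_def abs_mult abs_of_pos[OF p] by linarith
        qed
      qed
      also have "\<dots> = \<epsilon> + (1 - r\<^sup>2) * C"
        using ip integral_poisson[OF xb] omega_pos by (simp add: \<omega>_def)
      finally show ?thesis using rC by simp
    qed
    have "poisson_integral f x0 - f x0 \<le> 2 * \<epsilon>"
      using harmonic_max_principle[OF harmonic_on_diff[OF hp h] r(2) _ r(1), of "2 * \<epsilon>"] bd by fastforce
    moreover have "f x0 - poisson_integral f x0 \<le> 2 * \<epsilon>"
      using harmonic_max_principle[OF harmonic_on_diff[OF h hp] r(2) _ r(1), of "2 * \<epsilon>"] bd by fastforce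
    ultimately show ?thesis by simp
  qed
  have "\<bar>poisson_integral f x0 - f x0\<bar> \<le> 0"
  proof (rule field_le_epsilon)
    show "\<bar>poisson_integral f x0 - f x0\<bar> \<le> 0 + e" if "0 < e" for e
      using est[of "e/2"] that by simp
  qed
  then show ?thesis by simp
qed

text \<open>The maximum principle concerns real functions, so real and imaginary parts are treated
  separately.\<close>

lemma poisson_formula:
  fixes f :: "'a \<Rightarrow> complex"
  assumes c: "continuous_on (cball 0 1) f" and h: "harmonic_on f (ball 0 1)" and x: "x \<in> ball 0 1"
  shows "poisson_integral f x = f x"
proof -
  have int: "integrable \<sigma> (\<lambda>z. poisson x z *\<^sub>R f z)"
    by (rule integrable_poisson_scaleR[OF x]) (rule continuous_on_subset[OF c], auto)
  have "Re (poisson_integral f x) = poisson_integral (\<lambda>z. Re (f z)) x"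
    using integral_Re[OF int] by (simp add: poisson_integral_def)
  also have "\<dots> = Re (f x)"
    by (intro poisson_formula_real harmonic_on_linear[OF h] bounded_linear_Re continuous_intros c x)
  finally have 1: "Re (poisson_integral f x) = Re (f x)" .
  have "Im (poisson_integral f x) = poisson_integral (\<lambda>z. Im (f z)) x"
    using integral_Im[OF int] by (simp add: poisson_integral_def)
  also have "\<dots> = Im (f x)"
    by (intro poisson_formula_real harmonic_on_linear[OF h] bounded_linear_Im continuous_intros c x)
  finally show ?thesis using 1 by (intro complex_eqI)
qed

end

section \<open>Expansions in spherical harmonics\<close>

text \<open>Growth slower than every geometric rate above 1; equivalently, the power series with
  these coefficients converges on the open unit disc. The class is closed under products, so the
  various factors attached to the degree \<open>k\<close> can be bounded separately.\<close>

definition subexponential :: "(nat \<Rightarrow> real) \<Rightarrow> bool" where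
  "subexponential a \<longleftrightarrow> (\<forall>r. 0 < r \<and> r < 1 \<longrightarrow> (\<exists>C. \<forall>k. \<bar>a k\<bar> * r ^ k \<le> C))"

lemma subexponentialE:
  assumes "subexponential a" "0 < r" "r < 1"
  obtains C where "C > 0" "\<And>k. \<bar>a k\<bar> * r ^ k \<le> C"
proof -
  from assms obtain C where C: "\<And>k. \<bar>a k\<bar> * r ^ k \<le> C" unfolding subexponential_def by blast
  show ?thesis by (rule that[of "max C 1"]) (auto intro: order_trans[OF C])
qed

lemma subexponential_mono:
  assumes "subexponential b" "\<And>k. \<bar>a k\<bar> \<le> \<bar>b k\<bar>"
  shows "subexponential a"
  unfolding subexponential_def
proof (intro allI impI)
  fix r :: real assume r: "0 < r \<and> r < 1"
  then obtain C where "C > 0" "\<And>k. \<bar>b k\<bar> * r ^ k \<le> C" using subexponentialE[OF assms(1)] by blast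
  then show "\<exists>C. \<forall>k. \<bar>a k\<bar> * r ^ k \<le> C"
    using assms(2) r by (intro exI[of _ C]) (meson mult_right_mono order_trans zero_le_power less_imp_le)
qed

lemma subexponential_mult:
  assumes "subexponential a" "subexponential b"
  shows "subexponential (\<lambda>k. a k * b k)"
  unfolding subexponential_def
proof (intro allI impI)
  fix r :: real assume r: "0 < r \<and> r < 1"
  \<comment> \<open>Each of the two sequences uses half of the decay.\<close>
  define s where "s = sqrt r"
  have s: "0 < s" "s < 1" "r = s * s" using r by (auto simp: s_def)
  obtain A where A: "A > 0" "\<And>k. \<bar>a k\<bar> * s ^ k \<le> A" using subexponentialE[OF assms(1) s(1,2)] by blast
  obtain B where B: "B > 0" "\<And>k. \<bar>b k\<bar> * s ^ k \<le> B" using subexponentialE[OF assms(2) s(1,2)] by blast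
  have "\<bar>a k * b k\<bar> * r ^ k \<le> A * B" for k
  proof -
    have "\<bar>a k * b k\<bar> * r ^ k = (\<bar>a k\<bar> * s ^ k) * (\<bar>b k\<bar> * s ^ k)"
      by (simp add: s(3) power_mult_distrib abs_mult)
    also have "\<dots> \<le> A * B" using A B s by (intro mult_mono) auto
    finally show ?thesis .
  qed
  then show "\<exists>C. \<forall>k. \<bar>a k * b k\<bar> * r ^ k \<le> C" by blast
qed

lemma subexponential_const: "subexponential (\<lambda>_. c)"
  unfolding subexponential_def
  by (auto intro!: exI[of _ "\<bar>c\<bar>"] mult_left_le power_le_one)

lemma subexponential_summable:
  assumes "subexponential a" "0 \<le> r" "r < 1"
  shows "summable (\<lambda>k. \<bar>a k\<bar> * r ^ k)"
proof (cases "r = 0")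
  case True
  have "summable (\<lambda>k. \<bar>a k\<bar> * 0 ^ k)" by (rule summable_zero_power'[of "\<lambda>k. \<bar>a k\<bar>"])
  then show ?thesis using True by simp
next
  case False
  \<comment> \<open>Half of the decay bounds the terms, the other half makes the series
    geometric.\<close>
  define s where "s = sqrt r"
  have s: "0 < s" "s < 1" "r = s * s" using assms False by (auto simp: s_def)
  obtain A where A: "A > 0" "\<And>k. \<bar>a k\<bar> * s ^ k \<le> A" using subexponentialE[OF assms(1) s(1,2)] by blast
  show ?thesis
  proof (rule summable_comparison_test')
    show "summable (\<lambda>k. A * s ^ k)" using s by (intro summable_mult summable_geometric) auto
    show "norm (\<bar>a k\<bar> * r ^ k) \<le> A * s ^ k" for k
      using mult_right_mono[OF A(2)[of k], of "s ^ k"] s by (simp add: power_mult_distrib abs_mult mult_ac)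
  qed
qed

text \<open>The general term is evaluated along \<open>r \<rightarrow> 0\<close>, and the coefficients are peeled off one by one.\<close>

lemma powser_zero_coeff:
  fixes a :: "nat \<Rightarrow> complex"
  assumes "\<delta> > 0" "\<And>r. 0 < r \<Longrightarrow> r < \<delta> \<Longrightarrow> (\<lambda>k. a k * of_real (r ^ k)) sums 0"
  shows "a k = 0"
proof -
  have zero: "a 0 = 0" if *: "\<And>r. 0 < r \<Longrightarrow> r < \<delta> \<Longrightarrow> (\<lambda>k. a k * of_real (r ^ k)) sums 0" for a :: "nat \<Rightarrow> complex"
  proof -
    define F where "F x = (\<Sum>k. a k * x ^ k)" for x
    have "(F \<longlongrightarrow> a 0) (at 0)"
    proof (rule powser_limit_0[of "\<delta> / 2"])
      show "(\<lambda>n. a n * x ^ n) sums F x" if "norm x < \<delta> / 2" for x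
        unfolding F_def
      proof (rule summable_sums, rule powser_inside)
        show "summable (\<lambda>n. a n * complex_of_real (\<delta>/2) ^ n)"
          using *[of "\<delta>/2"] assms(1) by (simp add: sums_iff)
        show "norm x < norm (complex_of_real (\<delta>/2))" using that assms(1) by simp
      qed
    qed (use assms in simp)
    moreover have "filterlim complex_of_real (at 0) (at_right 0)"
      unfolding filterlim_at by (auto simp: eventually_at_filter intro!: tendsto_eq_intros)
    ultimately have "((\<lambda>r. F (complex_of_real r)) \<longlongrightarrow> a 0) (at_right 0)" by (rule filterlim_compose)
    moreover have "\<forall>\<^sub>F r in at_right 0. F (complex_of_real r) = 0"
      using eventually_at_right_less[of 0] eventually_at_right_real[OF assms(1)]
    proof eventually_elim
      case (elim r)
      then show ?case using *[of r] by (simp add: F_def sums_iff)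
    qed
    ultimately have "((\<lambda>r. 0) \<longlongrightarrow> a 0) (at_right (0::real))"
      by (rule Lim_transform_eventually)
    then show ?thesis by (simp add: tendsto_const_iff)
  qed
  show ?thesis using assms(2)
  proof (induction k arbitrary: a)
    case 0
    then show ?case by (rule zero)
  next
    case (Suc k)
    have "(\<lambda>k. a (Suc k) * of_real (r ^ k)) sums 0" if r: "0 < r" "r < \<delta>" for r
    proof -
      have "(\<lambda>k. a (Suc k) * of_real (r ^ Suc k)) sums (0 - a 0 * of_real (r ^ 0))"
        using Suc.prems[OF r] by (subst sums_Suc_iff) simp
      then have "(\<lambda>k. of_real (1/r) * (a (Suc k) * of_real (r ^ Suc k))) sums (of_real (1/r) * 0)"
        using zero[OF Suc.prems] by (intro sums_mult) simp
      then show ?thesis using r by (simp add: field_simps)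
    qed
    then show ?case by (rule Suc.IH)
  qed
qed

section \<open>Growth of the basis and series on the sphere\<close>

locale sphere_basis = sphere_measure \<sigma> \<kappa> for \<sigma> :: "'a::euclidean_space measure" and \<kappa> +
  fixes Y :: "nat \<Rightarrow> nat \<Rightarrow> 'a \<Rightarrow> real" and d :: "nat \<Rightarrow> nat"
  assumes basis: "spherical_harmonic_basis \<sigma> Y" and d_eq: "sph_dim TYPE('a) = d"
begin

lemma Y_polynomial:
  assumes "j \<in> {1..d k}"
  obtains q where "continuous_on UNIV q" "harmonic_on q UNIV" "\<And>s x. q (s *\<^sub>R x) = s ^ k * q x"
    "\<And>x. norm x = 1 \<Longrightarrow> Y k j x = q x"
proof -
  have "Y k j \<in> spherical_harmonics k" using basis assms unfolding spherical_harmonic_basis_def d_eq by blast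
  then obtain q where q: "Y k j = (\<lambda>x. if x \<in> sphere 0 1 then q x else 0)" "real_polynomial_function q"
    "\<forall>s x. q (s *\<^sub>R x) = s ^ k * q x" "harmonic_on q UNIV"
    unfolding spherical_harmonics_def by blast
  show ?thesis
    by (rule that[of q]) (use q in \<open>auto intro: harmonic_on_continuous\<close>)
qed

lemma Y_continuous: "j \<in> {1..d k} \<Longrightarrow> continuous_on (sphere 0 1) (Y k j)"
proof -
  assume "j \<in> {1..d k}"
  then obtain q where q: "continuous_on UNIV q" "\<And>x. norm x = 1 \<Longrightarrow> Y k j x = q x"
    by (rule Y_polynomial) blast
  have "continuous_on (sphere 0 1) q" using q(1) continuous_on_subset by blast
  then show "continuous_on (sphere 0 1) (Y k j)" by (rule continuous_on_eq) (simp add: q)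
qed

lemma Y_measurable [measurable (raw)]: "j \<in> {1..d k} \<Longrightarrow> Y k j \<in> borel_measurable \<sigma>"
  by (intro measurable_sigma_continuous Y_continuous)

lemma Y_orthonormal:
  "j \<in> {1..d k} \<Longrightarrow> i \<in> {1..d l} \<Longrightarrow> (LINT x|\<sigma>. Y k j x * Y l i x) = (if k = l \<and> j = i then 1 else 0)"
  using basis unfolding spherical_harmonic_basis_def d_eq by blast

lemma integrable_sigma_continuous:
  fixes f :: "'a \<Rightarrow> 'b::{banach,second_countable_topology}"
  assumes "continuous_on (sphere 0 1) f"
  shows "integrable \<sigma> f"
proof -
  obtain M where "\<forall>z\<in>sphere 0 1. norm (f z) \<le> M"
    using compact_imp_bounded[OF compact_continuous_image[OF assms compact_sphere]]
    unfolding bounded_iff by auto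
  then show ?thesis
    by (intro integrable_sigma_bounded[where B=M] measurable_sigma_continuous assms) auto
qed

text \<open>The Poisson formula reproduces the homogeneous harmonic polynomial that extends
  \<open>Y k j\<close>.\<close>

lemma poisson_Y:
  assumes j: "j \<in> {1..d k}" and r: "0 \<le> r" "r < 1" and x: "norm x = 1"
  shows "(LINT z|\<sigma>. poisson (r *\<^sub>R x) z * Y k j z) = r ^ k * Y k j x"
proof -
  obtain q where q: "continuous_on UNIV q" "harmonic_on q UNIV" "\<And>s x. q (s *\<^sub>R x) = s ^ k * q x"
    "\<And>x. norm x = 1 \<Longrightarrow> Y k j x = q x" using Y_polynomial[OF j] by blast
  have "(LINT z|\<sigma>. poisson (r *\<^sub>R x) z * Y k j z) = poisson_integral q (r *\<^sub>R x)"
    unfolding poisson_integral_def by (intro Bochner_Integration.integral_cong refl) (simp add: q)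
  also have "\<dots> = q (r *\<^sub>R x)"
    using r x
    by (intro poisson_formula_real continuous_on_subset[OF q(1)] harmonic_on_subset[OF q(2)]) auto
  finally show ?thesis by (simp add: q x)
qed

text \<open>Equals (1 - r)^(-n) / \<omega>; it comes from |r x - z| \<ge> 1 - r and 1 - |r x|^2
  \<le> 1.\<close>

definition poisson_bound :: "real \<Rightarrow> real" where
  "poisson_bound r = ((1 - r)\<^sup>2) powr (- real DIM('a) / 2) / \<omega>"

lemma poisson_le_bound:
  assumes "0 \<le> r" "r < 1" "norm x = 1" "norm z = 1"
  shows "poisson (r *\<^sub>R x) z \<le> poisson_bound r"
proof -
  have "norm z - norm (r *\<^sub>R x) \<le> norm (r *\<^sub>R x - z)" by (metis norm_minus_commute norm_triangle_ineq2)
  then have "1 - r \<le> norm (r *\<^sub>R x - z)" using assms by simp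
  then have "(1 - r)\<^sup>2 \<le> (r *\<^sub>R x - z) \<bullet> (r *\<^sub>R x - z)" unfolding dot_square_norm using assms by (intro power_mono) auto
  then have "((r *\<^sub>R x - z) \<bullet> (r *\<^sub>R x - z)) powr (- real DIM('a) / 2) \<le> ((1 - r)\<^sup>2) powr (- real DIM('a) / 2)"
    using assms by (intro powr_mono2') auto
  moreover have "1 - (r *\<^sub>R x) \<bullet> (r *\<^sub>R x) \<le> 1" using inner_ge_zero[of "r *\<^sub>R x"] by linarith
  ultimately have "(1 - (r *\<^sub>R x) \<bullet> (r *\<^sub>R x)) * ((r *\<^sub>R x - z) \<bullet> (r *\<^sub>R x - z)) powr (- real DIM('a) / 2)
     \<le> 1 * ((1 - r)\<^sup>2) powr (- real DIM('a) / 2)"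
    by (intro mult_mono) auto
  then show ?thesis unfolding poisson_def poisson_bound_def using omega_pos by (intro divide_right_mono) auto
qed

text \<open>Bessel's inequality for the Poisson kernel, whose coefficients are \<open>r ^ k * Y k j x\<close>.\<close>

lemma sum_Y_squared_le:
  assumes r: "0 \<le> r" "r < 1" and x: "norm x = 1"
  shows "(\<Sum>j=1..d k. (Y k j x)\<^sup>2) * r ^ (2 * k) \<le> poisson_bound r"
proof -
  let ?p = "poisson (r *\<^sub>R x)"
  define c where "c j = r ^ k * Y k j x" for j
  define s where "s z = (\<Sum>j=1..d k. c j * Y k j z)" for z
  have xb: "r *\<^sub>R x \<in> ball 0 1" using r x by simp
  have pc: "continuous_on (sphere 0 1) ?p" by (rule poisson_continuous[OF xb])
  have sc: "continuous_on (sphere 0 1) s" unfolding s_def by (intro continuous_intros Y_continuous) auto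
  have i: "integrable \<sigma> (\<lambda>z. f z * g z)" if "continuous_on (sphere 0 1) f" "continuous_on (sphere 0 1) g" for f g :: "'a \<Rightarrow> real"
    by (intro integrable_sigma_continuous continuous_intros that)
  have ps: "(LINT z|\<sigma>. ?p z * s z) = (\<Sum>j=1..d k. (c j)\<^sup>2)"
  proof -
    have "(LINT z|\<sigma>. ?p z * s z) = (LINT z|\<sigma>. (\<Sum>j=1..d k. c j * (?p z * Y k j z)))"
      by (simp add: s_def sum_distrib_left mult_ac)
    also have "\<dots> = (\<Sum>j=1..d k. c j * (LINT z|\<sigma>. ?p z * Y k j z))"
      by (subst Bochner_Integration.integral_sum) (auto intro!: i pc Y_continuous)
    also have "\<dots> = (\<Sum>j=1..d k. (c j)\<^sup>2)"
      by (intro sum.cong refl) (simp add: poisson_Y r x c_def power2_eq_square)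
    finally show ?thesis .
  qed
  have ss: "(LINT z|\<sigma>. s z * s z) = (\<Sum>j=1..d k. (c j)\<^sup>2)"
  proof -
    have "(LINT z|\<sigma>. s z * s z) = (LINT z|\<sigma>. (\<Sum>j=1..d k. \<Sum>i=1..d k. c j * c i * (Y k j z * Y k i z)))"
      by (simp add: s_def sum_product mult_ac)
    also have "\<dots> = (\<Sum>j=1..d k. \<Sum>i=1..d k. c j * c i * (LINT z|\<sigma>. Y k j z * Y k i z))"
    proof -
      have iY: "integrable \<sigma> (\<lambda>z. c j * c i * (Y k j z * Y k i z))" if "j \<in> {1..d k}" "i \<in> {1..d k}" for i j
        using that by (intro integrable_mult_right i Y_continuous)
      have "(LINT z|\<sigma>. (\<Sum>j=1..d k. \<Sum>i=1..d k. c j * c i * (Y k j z * Y k i z))) =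
        (\<Sum>j=1..d k. LINT z|\<sigma>. (\<Sum>i=1..d k. c j * c i * (Y k j z * Y k i z)))"
        by (intro Bochner_Integration.integral_sum Bochner_Integration.integrable_sum iY)
      also have "\<dots> = (\<Sum>j=1..d k. \<Sum>i=1..d k. c j * c i * (LINT z|\<sigma>. Y k j z * Y k i z))"
      proof (intro sum.cong refl)
        fix j assume j: "j \<in> {1..d k}"
        have "(LINT z|\<sigma>. (\<Sum>i=1..d k. c j * c i * (Y k j z * Y k i z))) = 
          (\<Sum>i=1..d k. LINT z|\<sigma>. c j * c i * (Y k j z * Y k i z))"
          by (intro Bochner_Integration.integral_sum iY j)
        then show "(LINT z|\<sigma>. (\<Sum>i=1..d k. c j * c i * (Y k j z * Y k i z))) = 
          (\<Sum>i=1..d k. c j * c i * (LINT z|\<sigma>. Y k j z * Y k i z))" by simp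
      qed
      finally show ?thesis .
    qed
    also have "\<dots> = (\<Sum>j=1..d k. \<Sum>i=1..d k. if j = i then c j * c i else 0)"
      by (intro sum.cong refl) (simp add: Y_orthonormal)
    also have "\<dots> = (\<Sum>j=1..d k. (c j)\<^sup>2)" by (simp add: power2_eq_square)
    finally show ?thesis .
  qed
  have "0 \<le> (LINT z|\<sigma>. (?p z - s z) * (?p z - s z))" by simp
  also have "\<dots> = (LINT z|\<sigma>. ?p z * ?p z - 2 * (?p z * s z) + s z * s z)"
    by (intro Bochner_Integration.integral_cong refl) (simp add: algebra_simps)
  also have "\<dots> = (LINT z|\<sigma>. ?p z * ?p z) - (\<Sum>j=1..d k. (c j)\<^sup>2)"
    using i[OF pc pc] i[OF pc sc] i[OF sc sc] ps ss by simp
  finally have "(\<Sum>j=1..d k. (c j)\<^sup>2) \<le> (LINT z|\<sigma>. ?p z * ?p z)" by simp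
  \<comment> \<open>The kernel is positive with integral 1, so its squared L^2 norm is at most its
    supremum.\<close>
  also have "\<dots> \<le> (LINT z|\<sigma>. poisson_bound r * ?p z)"
  proof (rule integral_mono)
    show "integrable \<sigma> (\<lambda>z. ?p z * ?p z)" by (rule i[OF pc pc])
    show "integrable \<sigma> (\<lambda>z. poisson_bound r * ?p z)" by (intro i pc continuous_intros)
    show "?p z * ?p z \<le> poisson_bound r * ?p z" if "z \<in> space \<sigma>" for z
      using poisson_le_bound[OF r x] poisson_pos[OF xb] that by (intro mult_right_mono) (auto intro: less_imp_le)
  qed
  also have "\<dots> = poisson_bound r" using integral_poisson[OF xb] by simp
  finally have "(\<Sum>j=1..d k. (c j)\<^sup>2) \<le> poisson_bound r" .
  moreover have "(c j)\<^sup>2 = (Y k j x)\<^sup>2 * r ^ (2 * k)" for j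
  proof -
    have "r ^ (2 * k) = (r ^ k)\<^sup>2" by (metis mult.commute power_mult)
    then show ?thesis by (simp add: c_def power_mult_distrib)
  qed
  ultimately show ?thesis by (simp flip: sum_distrib_right)
qed

lemma Y_squared_le:
  assumes "0 \<le> r" "r < 1" "norm x = 1" "j \<in> {1..d k}"
  shows "(Y k j x)\<^sup>2 * r ^ (2 * k) \<le> poisson_bound r"
proof -
  have "(Y k j x)\<^sup>2 \<le> (\<Sum>j=1..d k. (Y k j x)\<^sup>2)" by (rule member_le_sum) (use assms in auto)
  then have "(Y k j x)\<^sup>2 * r ^ (2 * k) \<le> (\<Sum>j=1..d k. (Y k j x)\<^sup>2) * r ^ (2 * k)"
    by (rule mult_right_mono) simp
  also have "\<dots> \<le> poisson_bound r" by (rule sum_Y_squared_le) fact+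
  finally show ?thesis .
qed

text \<open>Integrating the pointwise Bessel bound over the sphere counts the basis functions of
  degree \<open>k\<close>, since each has norm 1.\<close>

lemma subexponential_d: "subexponential (\<lambda>k. real (d k))"
proof -
  have *: "real (d k) * r ^ (2 * k) \<le> \<omega> * poisson_bound r" if "0 < r" "r < 1" for r k
  proof -
    have "real (d k) * r ^ (2 * k) = (\<Sum>j=1..d k. (LINT x|\<sigma>. Y k j x * Y k j x)) * r ^ (2 * k)"
      by (simp add: Y_orthonormal)
    also have "\<dots> = (LINT x|\<sigma>. (\<Sum>j=1..d k. (Y k j x)\<^sup>2) * r ^ (2 * k))"
      by (subst Bochner_Integration.integral_sum[symmetric]) 
        (auto intro!: integrable_sigma_continuous continuous_intros Y_continuous simp: power2_eq_square)
    also have "\<dots> \<le> (LINT x|\<sigma>. poisson_bound r)"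
      by (intro integral_mono integrable_sigma_continuous continuous_intros Y_continuous sum_Y_squared_le) (use that in auto)
    also have "\<dots> = \<omega> * poisson_bound r" by (simp add: \<omega>_def)
    finally show ?thesis .
  qed
  show ?thesis unfolding subexponential_def
  proof (intro allI impI)
    fix r :: real assume r: "0 < r \<and> r < 1"
    show "\<exists>C. \<forall>k. \<bar>real (d k)\<bar> * r ^ k \<le> C"
    proof (intro exI allI)
      fix k
      have "(sqrt r) ^ (2 * k) = r ^ k" using r by (simp add: power_mult)
      then show "\<bar>real (d k)\<bar> * r ^ k \<le> \<omega> * poisson_bound (sqrt r)" using *[of "sqrt r" k] r by simp
    qed
  qed
qed

text \<open>The inserted 0 keeps the set nonempty when there is no index \<open>j\<close>, and makes
  \<open>ymax k\<close> nonnegative.\<close>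

definition ymax :: "nat \<Rightarrow> real" where
  "ymax k = Sup (insert 0 ((\<lambda>(j, x). \<bar>Y k j x\<bar>) ` ({1..d k} \<times> sphere 0 1)))"

lemma ymax_bdd: "bdd_above (insert 0 ((\<lambda>(j, x). \<bar>Y k j x\<bar>) ` ({1..d k} \<times> sphere 0 1)))"
proof -
  have "\<bar>Y k j x\<bar> \<le> sqrt (poisson_bound (1/2) * 2 ^ (2 * k))" if "j \<in> {1..d k}" "norm x = 1" for j x
    using Y_squared_le[of "1/2" x j k] that by (intro real_le_rsqrt) (simp add: field_simps power_divide)
  then show ?thesis by (intro bdd_above_insert[THEN iffD2] bdd_aboveI2[where M="sqrt (poisson_bound (1/2) * 2 ^ (2 * k))"]) auto
qed

lemma ymax_nonneg: "0 \<le> ymax k"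
  unfolding ymax_def by (rule cSup_upper[OF _ ymax_bdd]) simp

lemma abs_Y_le_ymax: "j \<in> {1..d k} \<Longrightarrow> norm x = 1 \<Longrightarrow> \<bar>Y k j x\<bar> \<le> ymax k"
  unfolding ymax_def by (rule cSup_upper[OF _ ymax_bdd]) auto

lemma subexponential_ymax: "subexponential ymax"
  unfolding subexponential_def
proof (intro allI impI exI)
  fix r :: real and k assume r: "0 < r \<and> r < 1"
  have "ymax k \<le> sqrt (poisson_bound r) / r ^ k"
    unfolding ymax_def
  proof (rule cSup_least)
    fix t assume t: "t \<in> insert 0 ((\<lambda>(j, x). \<bar>Y k j x\<bar>) ` ({1..d k} \<times> sphere 0 1))"
    have "0 \<le> poisson_bound r" unfolding poisson_bound_def using omega_pos by simp
    moreover have "\<bar>Y k j x\<bar> \<le> sqrt (poisson_bound r) / r ^ k" if "j \<in> {1..d k}" "norm x = 1" for j x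
    proof -
      have "\<bar>Y k j x\<bar> * r ^ k \<le> sqrt (poisson_bound r)"
        using Y_squared_le[of r x j k] that r
        by (intro real_le_rsqrt) (simp add: power_mult_distrib power_mult[symmetric] mult.commute[of k])
      then show ?thesis using r by (simp add: field_simps)
    qed
    ultimately show "t \<le> sqrt (poisson_bound r) / r ^ k" using t r by auto
  qed simp
  then show "\<bar>ymax k\<bar> * r ^ k \<le> sqrt (poisson_bound r)" using r ymax_nonneg[of k] by (simp add: field_simps)
qed

text \<open>Bounds the \<open>k\<close>-th layer of a series whose coefficients have modulus at most \<open>1\<close>.\<close>

definition layer :: "nat \<Rightarrow> real" where "layer k = real (d k) * ymax k"

lemma layer_nonneg: "0 \<le> layer k" by (simp add: layer_def ymax_nonneg)

lemma subexponential_layer: "subexponential layer"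
  unfolding layer_def by (intro subexponential_mult subexponential_d subexponential_ymax)

text \<open>Carries no radius: the powers of the radius are absorbed into the coefficients, so the
  same facts serve every radius and every family of coefficients that depends on a
  parameter.\<close>

definition sphere_series :: "(nat \<Rightarrow> nat \<Rightarrow> complex) \<Rightarrow> 'a \<Rightarrow> complex" where
  "sphere_series c x = (\<Sum>k. \<Sum>j=1..d k. c k j * of_real (Y k j x))"

lemma layer_bound:
  assumes "\<And>j. j \<in> {1..d k} \<Longrightarrow> norm (c j) \<le> M" "norm x = 1"
  shows "norm (\<Sum>j=1..d k. c j * complex_of_real (Y k j x)) \<le> M * layer k"
proof -
  have "norm (\<Sum>j=1..d k. c j * complex_of_real (Y k j x)) \<le> (\<Sum>j=1..d k. M * ymax k)"
    using assms abs_Y_le_ymax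
    by (intro sum_norm_le) (auto simp: norm_mult intro!: mult_mono intro: order_trans[OF norm_ge_zero])
  then show ?thesis by (simp add: layer_def mult_ac)
qed

lemma sphere_series_sums:
  assumes "\<And>k j. j \<in> {1..d k} \<Longrightarrow> norm (c k j) \<le> M k" "summable (\<lambda>k. M k * layer k)" "norm x = 1"
  shows "(\<lambda>k. \<Sum>j=1..d k. c k j * complex_of_real (Y k j x)) sums sphere_series c x"
    and "norm (sphere_series c x) \<le> (\<Sum>k. M k * layer k)"
proof -
  have s: "summable (\<lambda>k. norm (\<Sum>j=1..d k. c k j * complex_of_real (Y k j x)))"
    using layer_bound[OF assms(1,3)]
    by (intro summable_comparison_test'[OF assms(2)]) auto
  then show "(\<lambda>k. \<Sum>j=1..d k. c k j * complex_of_real (Y k j x)) sums sphere_series c x"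
    unfolding sphere_series_def by (rule summable_sums[OF summable_norm_cancel])
  have "norm (sphere_series c x) \<le> (\<Sum>k. norm (\<Sum>j=1..d k. c k j * complex_of_real (Y k j x)))"
    unfolding sphere_series_def by (rule summable_norm[OF s])
  also have "\<dots> \<le> (\<Sum>k. M k * layer k)"
    by (intro suminf_le s assms(2) layer_bound assms(1,3))
  finally show "norm (sphere_series c x) \<le> (\<Sum>k. M k * layer k)" .
qed

lemma sphere_series_cong:
  "(\<And>k j. j \<in> {1..d k} \<Longrightarrow> c k j = c' k j) \<Longrightarrow> sphere_series c x = sphere_series c' x"
  unfolding sphere_series_def by (intro suminf_cong sum.cong refl) auto

lemma sphere_series_continuous:
  assumes "\<And>k j. j \<in> {1..d k} \<Longrightarrow> norm (c k j) \<le> M k" "summable (\<lambda>k. M k * layer k)"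
  shows "continuous_on (sphere 0 1) (sphere_series c)"
proof (rule uniform_limit_theorem)
  show "uniform_limit (sphere 0 1) (\<lambda>n x. \<Sum>k<n. \<Sum>j=1..d k. c k j * complex_of_real (Y k j x)) (sphere_series c) sequentially"
    unfolding sphere_series_def[abs_def]
    using layer_bound[OF assms(1)] by (intro Weierstrass_m_test[OF _ assms(2)]) auto
  show "\<forall>\<^sub>F n in sequentially. continuous_on (sphere 0 1) (\<lambda>x. \<Sum>k<n. \<Sum>j=1..d k. c k j * complex_of_real (Y k j x))"
    by (intro always_eventually allI continuous_intros Y_continuous) auto
qed simp

text \<open>The exchange of sum and integral is needed over the sphere, the beta measure, their
  product and the counting measure, hence the general \<open>\<nu>\<close>. A majorant split into a
  factor of \<open>k\<close> and a factor of \<open>w\<close> makes the sum of the integrals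
  converge.\<close>

lemma sphere_series_integral:
  assumes a: "\<And>k j. j \<in> {1..d k} \<Longrightarrow> (\<lambda>w. a w k j) \<in> borel_measurable \<nu>"
    and M: "\<And>k j w. j \<in> {1..d k} \<Longrightarrow> w \<in> space \<nu> \<Longrightarrow> norm (a w k j) \<le> M k * W w"
    and W: "integrable \<nu> W" and sM: "summable (\<lambda>k. M k * layer k)" and M0: "\<And>k. 0 \<le> M k" and x: "norm x = 1"
  shows "integrable \<nu> (\<lambda>w. sphere_series (a w) x)"
    and "sphere_series (\<lambda>k j. LINT w|\<nu>. a w k j) x = (LINT w|\<nu>. sphere_series (a w) x)"
proof -
  let ?f = "\<lambda>k w. \<Sum>j=1..d k. a w k j * complex_of_real (Y k j x)"
  have ia: "integrable \<nu> (\<lambda>w. a w k j)" if "j \<in> {1..d k}" for k j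
    by (rule Bochner_Integration.integrable_bound[OF integrable_mult_right[OF W, of "M k"] a[OF that]])
       (use M[OF that] in \<open>auto intro!: AE_I2 order_trans[OF M[OF that] abs_ge_self]\<close>)
  have i: "integrable \<nu> (?f k)" for k by (intro Bochner_Integration.integrable_sum integrable_mult_left ia)
  have b: "norm (?f k w) \<le> (M k * layer k) * W w" if "w \<in> space \<nu>" for k w
    using layer_bound[of k "a w k" "M k * W w" x] M that x by (simp add: mult_ac)
  have sw: "summable (\<lambda>k. norm (?f k w))" if "w \<in> space \<nu>" for w
    by (rule summable_comparison_test'[OF summable_mult2[OF sM, of "W w"]]) (use b[OF that] in auto)
  have "summable (\<lambda>k. LINT w|\<nu>. norm (?f k w))"
  proof (rule summable_comparison_test'[OF summable_mult2[OF sM, of "LINT w|\<nu>. W w"]])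
    fix k
    have "norm (LINT w|\<nu>. norm (?f k w)) = (LINT w|\<nu>. norm (?f k w))" by simp
    also have "\<dots> \<le> (LINT w|\<nu>. (M k * layer k) * W w)"
      by (intro integral_mono integrable_norm i integrable_mult_right W b)
    also have "\<dots> = M k * layer k * (LINT w|\<nu>. W w)" by simp
    finally show "norm (LINT w|\<nu>. norm (?f k w)) \<le> M k * layer k * (LINT w|\<nu>. W w)" .
  qed
  note s = this
  show "integrable \<nu> (\<lambda>w. sphere_series (a w) x)"
    unfolding sphere_series_def by (intro integrable_suminf i s AE_I2 sw)
  have "(LINT w|\<nu>. sphere_series (a w) x) = (\<Sum>k. LINT w|\<nu>. ?f k w)"
    unfolding sphere_series_def by (intro integral_suminf i s AE_I2 sw)
  also have "\<dots> = sphere_series (\<lambda>k j. LINT w|\<nu>. a w k j) x"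
    unfolding sphere_series_def
    by (intro suminf_cong) (subst Bochner_Integration.integral_sum; auto intro!: integrable_mult_left ia)
  finally show "sphere_series (\<lambda>k j. LINT w|\<nu>. a w k j) x = (LINT w|\<nu>. sphere_series (a w) x)" by simp
qed

lemma norm_direction: "norm (direction x :: 'a) = 1"
proof (cases "x = 0")
  case True
  have "\<exists>u :: 'a. u \<in> sphere 0 1" using vector_choose_size[of 1] by auto
  then have "(SOME u :: 'a. u \<in> sphere 0 1) \<in> sphere 0 1" by (rule someI_ex)
  then show ?thesis using True by (simp add: direction_def)
qed (simp add: direction_def norm_sgn)

lemma scaleR_norm_direction: "norm x *\<^sub>R direction x = (x :: 'a)"
  by (simp add: direction_def sgn_div_norm)

lemma harmonic_term_polar:
  assumes "0 \<le> r" "norm x = 1"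
  shows "harmonic_term Y c (r *\<^sub>R x) k = (\<Sum>j=1..d k. of_real (r ^ k) * c k j * of_real (Y k j x))"
proof (cases "r = 0")
  case False
  moreover have "x \<noteq> 0" using assms by auto
  ultimately have "direction (r *\<^sub>R x) = x" using assms by (simp add: direction_def sgn_div_norm)
  then show ?thesis using assms by (simp add: harmonic_term_def sum_distrib_left d_eq mult.assoc)
next
  case True
  show ?thesis
  proof (cases "k = 0")
    case k: True
    have "Y 0 j (direction 0) = Y 0 j x" if j: "j \<in> {1..d 0}" for j
    proof -
      obtain q where "continuous_on UNIV q" "harmonic_on q UNIV" and q: "\<And>s x. q (s *\<^sub>R x) = s ^ 0 * q x" 
        "\<And>x. norm x = 1 \<Longrightarrow> Y 0 j x = q x"
        by (rule Y_polynomial[OF j], rule that)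
      \<comment> \<open>Homogeneity of degree 0 at s = 0, where 0^0 = 1. The harmonics of degree 0
        are constant, so the arbitrary direction at the origin is harmless.\<close>
      have "q v = q 0" for v using q(1)[of 0 v] by simp
      from this[of x] this[of "direction 0"] show ?thesis using q(2)[OF norm_direction] q(2)[OF assms(2)] by simp
    qed
    then show ?thesis using True k by (auto simp: harmonic_term_def d_eq intro!: sum.cong)
  next
    case False
    then show ?thesis using True by (simp add: harmonic_term_def zero_power)
  qed
qed

lemma harmonic_term_polar_fun:
  assumes "0 \<le> r" "norm x = 1"
  shows "harmonic_term Y c (r *\<^sub>R x) = (\<lambda>k. \<Sum>j=1..d k. of_real (r ^ k) * c k j * of_real (Y k j x))"
  by (rule ext) (rule harmonic_term_polar[OF assms])

lemma harmonic_series_polar: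
  assumes "0 \<le> r" "norm x = 1"
  shows "harmonic_series Y c (r *\<^sub>R x) = sphere_series (\<lambda>k j. of_real (r ^ k) * c k j) x"
  unfolding harmonic_series_def sphere_series_def harmonic_term_polar_fun[OF assms] by (rule refl)

lemma harmonic_series_direction:
  "harmonic_series Y c x = sphere_series (\<lambda>k j. of_real (norm x ^ k) * c k j) (direction x)"
  using harmonic_series_polar[of "norm x" "direction x" c] by (simp add: scaleR_norm_direction norm_direction)

lemma harmonic_series_cong:
  "(\<And>k j. j \<in> {1..d k} \<Longrightarrow> c k j = c' k j) \<Longrightarrow> harmonic_series Y c = harmonic_series Y c'"
  unfolding harmonic_series_def harmonic_term_def d_eq
  by (intro ext suminf_cong arg_cong2[where f="(*)"] sum.cong refl) auto

lemma sphere_series_mult: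
  assumes "\<And>k j. j \<in> {1..d k} \<Longrightarrow> norm (c k j) \<le> M k" "summable (\<lambda>k. M k * layer k)" "norm x = 1"
  shows "sphere_series (\<lambda>k j. s * c k j) x = s * sphere_series c x"
proof -
  have "(\<lambda>k. s * (\<Sum>j=1..d k. c k j * complex_of_real (Y k j x))) sums (s * sphere_series c x)"
    by (intro sums_mult sphere_series_sums(1)[OF assms])
  then show ?thesis by (simp add: sphere_series_def[of "\<lambda>k j. s * c k j"] sum_distrib_left mult.assoc sums_iff)
qed

lemma sphere_series_coeff:
  assumes c: "\<And>k j. j \<in> {1..d k} \<Longrightarrow> norm (c k j) \<le> M k" and M: "summable (\<lambda>k. M k * layer k)"
    and i: "i \<in> {1..d l}"
  shows "(LINT x|\<sigma>. sphere_series c x * of_real (Y l i x)) = c l i"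
proof -
  let ?f = "\<lambda>k x. (\<Sum>j=1..d k. c k j * complex_of_real (Y k j x)) * complex_of_real (Y l i x)"
  have fc: "continuous_on (sphere 0 1) (?f k)" for k
    by (intro continuous_intros Y_continuous i) auto
  have b: "norm (?f k x) \<le> M k * layer k * ymax l" if "norm x = 1" for k x
    unfolding norm_mult norm_of_real
    by (rule mult_mono[OF layer_bound[OF c that] abs_Y_le_ymax[OF i that] order_trans[OF norm_ge_zero layer_bound[OF c that]] abs_ge_zero])
  have "(\<lambda>k. LINT x|\<sigma>. ?f k x) sums (LINT x|\<sigma>. (\<Sum>k. ?f k x))"
  proof (rule sums_integral)
    show "integrable \<sigma> (?f k)" for k by (rule integrable_sigma_continuous[OF fc])
    show "AE x in \<sigma>. summable (\<lambda>k. norm (?f k x))"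
      by (intro AE_I2 summable_comparison_test'[OF summable_mult2[OF M, of "ymax l"]]) (use b in auto)
    show "summable (\<lambda>k. LINT x|\<sigma>. norm (?f k x))"
    proof (rule summable_comparison_test'[OF summable_mult[OF summable_mult2[OF M, of "ymax l"], of \<omega>]])
      show "norm (LINT x|\<sigma>. norm (?f k x)) \<le> \<omega> * (M k * layer k * ymax l)" for k
      proof (rule norm_sigma_integral_le)
        show "(\<lambda>x. norm (?f k x)) \<in> borel_measurable \<sigma>"
          by (intro measurable_sigma_continuous continuous_on_norm fc)
      qed (use b in auto)
    qed
  qed
  moreover have "(LINT x|\<sigma>. ?f k x) = (if k = l then c l i else 0)" for k
  proof -
    have "(LINT x|\<sigma>. ?f k x) = (LINT x|\<sigma>. (\<Sum>j=1..d k. c k j * complex_of_real (Y k j x * Y l i x)))"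
      by (simp add: sum_distrib_right mult.assoc)
    also have "\<dots> = (\<Sum>j=1..d k. LINT x|\<sigma>. c k j * complex_of_real (Y k j x * Y l i x))"
      by (intro Bochner_Integration.integral_sum integrable_sigma_continuous continuous_intros Y_continuous i) auto
    also have "\<dots> = (\<Sum>j=1..d k. c k j * complex_of_real (if k = l \<and> j = i then 1 else 0))"
      by (intro sum.cong refl) (simp only: integral_mult_right_zero integral_complex_of_real Y_orthonormal i)
    also have "\<dots> = (if k = l then c l i else 0)"
      using i by (auto simp: if_distrib[of complex_of_real] if_distrib[of "(*) _"] sum.delta cong: if_cong)
    finally show ?thesis .
  qed
  ultimately have "(\<lambda>k. if k = l then c l i else 0) sums (LINT x|\<sigma>. (\<Sum>k. ?f k x))" by simp
  moreover have "(\<lambda>k. if k = l then c l i else 0) sums c l i" using sums_single[of l "\<lambda>_. c l i"] by simp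
  ultimately have "(LINT x|\<sigma>. (\<Sum>k. ?f k x)) = c l i" by (rule sums_unique2)
  moreover have "(LINT x|\<sigma>. (\<Sum>k. ?f k x)) = (LINT x|\<sigma>. sphere_series c x * of_real (Y l i x))"
  proof (intro Bochner_Integration.integral_cong refl)
    fix x assume "x \<in> space \<sigma>"
    then show "(\<Sum>k. ?f k x) = sphere_series c x * of_real (Y l i x)"
      using sums_mult2[OF sphere_series_sums(1)[where c=c and M=M and x=x, OF c M], of "of_real (Y l i x)"] by (simp add: sums_iff)
  qed
  ultimately show ?thesis by simp
qed

text \<open>\<open>u\<close> is orthogonal to every finite combination p of the basis, so in L^2 the
  squared norm of u - p is the sum of those of u and p. Density then forces u to have norm 0, and
  continuity turns vanishing almost everywhere into vanishing everywhere.\<close>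

lemma basis_complete:
  fixes u :: "'a \<Rightarrow> complex"
  assumes uc: "continuous_on (sphere 0 1) u" 
    and u0: "\<And>k j. j \<in> {1..d k} \<Longrightarrow> (LINT x|\<sigma>. u x * of_real (Y k j x)) = 0" and x: "norm x = 1"
  shows "u x = 0"
proof -
  have uu: "continuous_on (sphere 0 1) (\<lambda>x. (cmod (u x))\<^sup>2)" by (intro continuous_intros uc)
  have le: "(LINT x|\<sigma>. (cmod (u x))\<^sup>2) \<le> 0 + e" if "e > 0" for e
  proof -
    have "u \<in> borel_measurable \<sigma> \<and> integrable \<sigma> (\<lambda>x. (cmod (u x))\<^sup>2)"
      using measurable_sigma_continuous[OF uc] integrable_sigma_continuous[OF uu] by simp
    with basis that have "\<exists>K a. (LINT x|\<sigma>. (cmod (u x - (\<Sum>k\<le>K. \<Sum>j=1..d k. a k j * complex_of_real (Y k j x))))\<^sup>2) < e"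
      unfolding spherical_harmonic_basis_def d_eq by blast
    then obtain K a where a: "(LINT x|\<sigma>. (cmod (u x - (\<Sum>k\<le>K. \<Sum>j=1..d k. a k j * complex_of_real (Y k j x))))\<^sup>2) < e"
      by (elim exE)
    define p where "p x = (\<Sum>k\<le>K. \<Sum>j=1..d k. a k j * complex_of_real (Y k j x))" for x
    have pc: "continuous_on (sphere 0 1) p" unfolding p_def by (intro continuous_intros Y_continuous) auto
    have i1: "integrable \<sigma> (\<lambda>x. cnj (a k j) * (u x * complex_of_real (Y k j x)))" if "j \<in> {1..d k}" for k j
      using that by (intro integrable_sigma_continuous continuous_intros uc Y_continuous)
    have "(LINT x|\<sigma>. u x * cnj (p x)) = (LINT x|\<sigma>. (\<Sum>k\<le>K. \<Sum>j=1..d k. cnj (a k j) * (u x * complex_of_real (Y k j x))))"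
      by (simp add: p_def sum_distrib_left mult_ac)
    also have "\<dots> = (\<Sum>k\<le>K. LINT x|\<sigma>. (\<Sum>j=1..d k. cnj (a k j) * (u x * complex_of_real (Y k j x))))"
      by (intro Bochner_Integration.integral_sum Bochner_Integration.integrable_sum i1)
    also have "\<dots> = (\<Sum>k\<le>K. \<Sum>j=1..d k. LINT x|\<sigma>. cnj (a k j) * (u x * complex_of_real (Y k j x)))"
      by (intro sum.cong refl Bochner_Integration.integral_sum i1)
    also have "\<dots> = 0"
      by (intro sum.neutral ballI) (simp only: integral_mult_right_zero u0 mult_zero_right)
    finally have up: "(LINT x|\<sigma>. u x * cnj (p x)) = 0" .
    have iup: "integrable \<sigma> (\<lambda>x. u x * cnj (p x))" by (intro integrable_sigma_continuous continuous_intros uc pc)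
    have ipp: "integrable \<sigma> (\<lambda>x. (cmod (p x))\<^sup>2)" by (intro integrable_sigma_continuous continuous_intros pc)
    define R where "R x = Re (u x * cnj (p x))" for x
    have iR: "integrable \<sigma> R" unfolding R_def by (rule integrable_Re[OF iup])
    have R0: "(LINT x|\<sigma>. R x) = 0" unfolding R_def using integral_Re[OF iup] by (simp only: up zero_complex.sel)
    have "(LINT x|\<sigma>. (cmod (u x - p x))\<^sup>2) = (LINT x|\<sigma>. (cmod (u x))\<^sup>2 + (cmod (p x))\<^sup>2 - 2 * R x)"
      unfolding R_def by (intro Bochner_Integration.integral_cong refl) 
         (simp add: cmod_power2 power2_diff algebra_simps)
    also have "\<dots> = (LINT x|\<sigma>. (cmod (u x))\<^sup>2) + (LINT x|\<sigma>. (cmod (p x))\<^sup>2)"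
      using integrable_sigma_continuous[OF uu] ipp iR R0 by simp
    finally have "(LINT x|\<sigma>. (cmod (u x))\<^sup>2) + (LINT x|\<sigma>. (cmod (p x))\<^sup>2) < e" using a by (simp add: p_def)
    moreover have "0 \<le> (LINT x|\<sigma>. (cmod (p x))\<^sup>2)" by simp
    ultimately show ?thesis by linarith
  qed
  have "(LINT x|\<sigma>. (cmod (u x))\<^sup>2) \<le> 0" by (rule field_le_epsilon) (rule le)
  moreover have "0 \<le> (LINT x|\<sigma>. (cmod (u x))\<^sup>2)" by simp
  ultimately have "(LINT x|\<sigma>. (cmod (u x))\<^sup>2) = 0" by (rule antisym)
  then have "AE x in \<sigma>. (cmod (u x))\<^sup>2 = 0"
    using integral_nonneg_eq_0_iff_AE[OF integrable_sigma_continuous[OF uu]] by simp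
  then have "AE x in \<sigma>. u x = 0" by eventually_elim simp
  then show ?thesis by (rule sigma_null_continuous[OF uc _ x])
qed

section \<open>Uniqueness and existence of expansions\<close>

lemma layer_unique:
  assumes "\<And>x. norm x = 1 \<Longrightarrow> (\<Sum>j=1..d k. e j * complex_of_real (Y k j x)) = 0" and i: "i \<in> {1..d k}"
  shows "e i = 0"
proof -
  have "0 = (LINT x|\<sigma>. (\<Sum>j=1..d k. e j * complex_of_real (Y k j x)) * complex_of_real (Y k i x))"
    by (rule sym) (rule integral_eq_zero_AE, rule AE_I2, simp add: assms(1) del: One_nat_def)
  also have "\<dots> = (LINT x|\<sigma>. (\<Sum>j=1..d k. e j * complex_of_real (Y k j x * Y k i x)))"
    by (simp add: sum_distrib_right mult.assoc)
  also have "\<dots> = (\<Sum>j=1..d k. LINT x|\<sigma>. e j * complex_of_real (Y k j x * Y k i x))"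
    by (intro Bochner_Integration.integral_sum integrable_sigma_continuous continuous_intros Y_continuous i) auto
  also have "\<dots> = (\<Sum>j=1..d k. e j * complex_of_real (if k = k \<and> j = i then 1 else 0))"
    by (intro sum.cong refl) (simp only: integral_mult_right_zero integral_complex_of_real Y_orthonormal i)
  also have "\<dots> = e i"
    using i by (auto simp: if_distrib[of complex_of_real] if_distrib[of "(*) _"] sum.delta cong: if_cong)
  finally show ?thesis by simp
qed

text \<open>For fixed \<open>x\<close> both sides are power series in \<open>r\<close>, which
  separates the degrees; within a degree orthonormality separates the orders. Agreement near the
  origin is enough, so that expansions of dilated functions can be compared.\<close>

lemma expansion_unique:
  assumes "\<delta> > 0" 
    and "\<And>r x. 0 < r \<Longrightarrow> r < \<delta> \<Longrightarrow> norm x = 1 \<Longrightarrow>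
       (\<lambda>k. \<Sum>j=1..d k. of_real (r ^ k) * b k j * of_real (Y k j x)) sums (f (r *\<^sub>R x) :: complex)"
    and "\<And>r x. 0 < r \<Longrightarrow> r < \<delta> \<Longrightarrow> norm x = 1 \<Longrightarrow>
       (\<lambda>k. \<Sum>j=1..d k. of_real (r ^ k) * b' k j * of_real (Y k j x)) sums f (r *\<^sub>R x)"
    and j: "j \<in> {1..d k}"
  shows "b k j = b' k j"
proof -
  have "(\<Sum>j=1..d k. (b k j - b' k j) * complex_of_real (Y k j x)) = 0" if x: "norm x = 1" for x k
  proof (rule powser_zero_coeff[of \<delta> "\<lambda>k. \<Sum>j=1..d k. (b k j - b' k j) * complex_of_real (Y k j x)" k, OF \<open>\<delta> > 0\<close>])
    fix r :: real assume r: "0 < r" "r < \<delta>"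
    have "(\<lambda>k. (\<Sum>j=1..d k. of_real (r ^ k) * b k j * of_real (Y k j x)) - (\<Sum>j=1..d k. of_real (r ^ k) * b' k j * of_real (Y k j x)))
       sums (f (r *\<^sub>R x) - f (r *\<^sub>R x))"
      by (intro sums_diff assms r x)
    then show "(\<lambda>k. (\<Sum>j=1..d k. (b k j - b' k j) * complex_of_real (Y k j x)) * of_real (r ^ k)) sums 0"
      by (simp add: sum_distrib_left sum_subtractf[symmetric] algebra_simps)
  qed
  then have "b k j - b' k j = 0" using layer_unique[where k=k and e="\<lambda>j. b k j - b' k j" and i=j] j by blast
  then show ?thesis by simp
qed

lemma coefficients_eq:
  assumes "\<And>x. x \<in> ball 0 1 \<Longrightarrow> harmonic_term Y b x sums f x" and j: "j \<in> {1..d k}"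
  shows "coefficients Y f k j = b k j"
proof (rule expansion_unique[where \<delta>=1 and f=f, OF _ _ _ j])
  have "\<forall>x\<in>ball 0 1. harmonic_term Y (coefficients Y f) x sums f x"
    unfolding coefficients_def by (rule someI[of _ b]) (use assms in auto)
  then have "harmonic_term Y (coefficients Y f) (r *\<^sub>R x) sums f (r *\<^sub>R x)" if "0 < r" "r < 1" "norm x = 1" for r x
    using that by auto
  then show "(\<lambda>k. \<Sum>j=1..d k. of_real (r ^ k) * coefficients Y f k j * of_real (Y k j x)) sums f (r *\<^sub>R x)"
    if "0 < r" "r < 1" "norm x = 1" for r x
    using that by (simp add: harmonic_term_polar_fun)
  have "harmonic_term Y b (r *\<^sub>R x) sums f (r *\<^sub>R x)" if "0 < r" "r < 1" "norm x = 1" for r x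
    using that assms by auto
  then show "(\<lambda>k. \<Sum>j=1..d k. of_real (r ^ k) * b k j * of_real (Y k j x)) sums f (r *\<^sub>R x)"
    if "0 < r" "r < 1" "norm x = 1" for r x
    using that by (simp add: harmonic_term_polar_fun)
qed simp

text \<open>By \<open>admissible_harmonic\<close> and \<open>harmonic_expansion\<close> these are,
  on the indices 1 \<le> j \<le> d k, exactly the coefficient families of harmonic functions on the
  ball.\<close>

definition admissible :: "(nat \<Rightarrow> nat \<Rightarrow> complex) \<Rightarrow> bool" where
  "admissible c \<longleftrightarrow> (\<exists>a. subexponential a \<and> (\<forall>k. \<forall>j\<in>{1..d k}. norm (c k j) \<le> a k))"

lemma admissibleI:
  "subexponential a \<Longrightarrow> (\<And>k j. j \<in> {1..d k} \<Longrightarrow> norm (c k j) \<le> a k) \<Longrightarrow> admissible c"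
  unfolding admissible_def by blast

lemma admissible_mult:
  assumes "admissible b" "admissible c"
  shows "admissible (\<lambda>k j. b k j * c k j)"
proof -
  obtain B C where B: "subexponential B" "\<And>k j. j \<in> {1..d k} \<Longrightarrow> norm (b k j) \<le> B k"
    and C: "subexponential C" "\<And>k j. j \<in> {1..d k} \<Longrightarrow> norm (c k j) \<le> C k"
    using assms unfolding admissible_def by blast
  show ?thesis
    by (rule admissibleI[OF subexponential_mult[OF B(1) C(1)]])
       (auto simp: norm_mult intro!: mult_mono B C intro: order_trans[OF norm_ge_zero B(2)])
qed

lemma admissible_Y: "norm x = 1 \<Longrightarrow> admissible (\<lambda>k j. of_real (Y k j x))"
  by (rule admissibleI[OF subexponential_ymax]) (auto intro: abs_Y_le_ymax)

lemma admissible_const: "subexponential a \<Longrightarrow> admissible (\<lambda>k j. of_real (a k))"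
  by (rule admissibleI[of "\<lambda>k. \<bar>a k\<bar>"]) (auto intro: subexponential_mono)

lemma subexponential_layer_summable:
  assumes "subexponential a" "0 \<le> r" "r < 1"
  shows "summable (\<lambda>k. (\<bar>a k\<bar> * r ^ k) * layer k)"
  using subexponential_summable[OF subexponential_mult[OF assms(1) subexponential_layer] assms(2,3)] layer_nonneg
  by (simp add: abs_mult mult_ac)

lemma admissible_dominated:
  assumes "admissible c" "0 \<le> r" "r < 1"
  obtains M where "\<And>k. 0 \<le> M k" "\<And>k j. j \<in> {1..d k} \<Longrightarrow> norm (of_real (r ^ k) * c k j) \<le> M k"
    "summable (\<lambda>k. M k * layer k)"
proof -
  obtain a where a: "subexponential a" "\<And>k j. j \<in> {1..d k} \<Longrightarrow> norm (c k j) \<le> a k"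
    using assms unfolding admissible_def by blast
  show ?thesis
  proof (rule that[of "\<lambda>k. \<bar>a k\<bar> * r ^ k"])
    show "norm (of_real (r ^ k) * c k j) \<le> \<bar>a k\<bar> * r ^ k" if "j \<in> {1..d k}" for k j
      using mult_left_mono[OF order_trans[OF a(2)[OF that] abs_ge_self], of "r ^ k"] assms(2) 
      by (simp add: norm_mult norm_power mult.commute)
  qed (use assms subexponential_layer_summable[OF a(1)] in auto)
qed

text \<open>As functions of \<open>z\<close> both sides are continuous with the coefficients
  \<open>r ^ k * Y k j x\<close>, so completeness identifies them; the summands are symmetric in
  \<open>x\<close> and \<open>z\<close>.\<close>

lemma poisson_expansion:
  assumes r: "0 \<le> r" "r < 1" and x: "norm x = 1" and z: "norm z = 1"
  shows "sphere_series (\<lambda>k j. of_real (r ^ k) * of_real (Y k j z)) x = of_real (poisson (r *\<^sub>R x) z)"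
proof -
  obtain M where M: "\<And>k. 0 \<le> M k" "\<And>k j. j \<in> {1..d k} \<Longrightarrow> norm (complex_of_real (r ^ k) * of_real (Y k j x)) \<le> M k"
    "summable (\<lambda>k. M k * layer k)"
    using admissible_dominated[OF admissible_Y[OF x] r] by metis
  define s where "s = sphere_series (\<lambda>k j. of_real (r ^ k) * of_real (Y k j x))"
  have sc: "continuous_on (sphere 0 1) s" unfolding s_def by (rule sphere_series_continuous[OF M(2,3)])
  have xb: "r *\<^sub>R x \<in> ball 0 1" using r x by simp
  have pc: "continuous_on (sphere 0 1) (\<lambda>z. complex_of_real (poisson (r *\<^sub>R x) z))" 
    by (intro continuous_intros poisson_continuous[OF xb])
  have "s z - of_real (poisson (r *\<^sub>R x) z) = 0"
  proof (rule basis_complete[OF _ _ z])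
    show "continuous_on (sphere 0 1) (\<lambda>z. s z - complex_of_real (poisson (r *\<^sub>R x) z))"
      by (intro continuous_on_diff sc pc)
    fix k j assume j: "j \<in> {1..d k}"
    have "(LINT z|\<sigma>. (s z - complex_of_real (poisson (r *\<^sub>R x) z)) * complex_of_real (Y k j z)) =
      (LINT z|\<sigma>. s z * complex_of_real (Y k j z)) - (LINT z|\<sigma>. complex_of_real (poisson (r *\<^sub>R x) z * Y k j z))"
    proof (subst Bochner_Integration.integral_diff[symmetric])
      show "integrable \<sigma> (\<lambda>z. s z * complex_of_real (Y k j z))"
        by (intro integrable_sigma_continuous continuous_intros sc Y_continuous j)
      show "integrable \<sigma> (\<lambda>z. complex_of_real (poisson (r *\<^sub>R x) z * Y k j z))"
        by (intro integrable_sigma_continuous continuous_intros poisson_continuous[OF xb] Y_continuous j)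
    qed (simp add: algebra_simps)
    also have "(LINT z|\<sigma>. s z * complex_of_real (Y k j z)) = of_real (r ^ k) * of_real (Y k j x)"
      unfolding s_def by (rule sphere_series_coeff[where c="\<lambda>k j. of_real (r ^ k) * of_real (Y k j x)" and M=M, OF M(2,3) j])
    also have "(LINT z|\<sigma>. complex_of_real (poisson (r *\<^sub>R x) z * Y k j z)) = of_real (r ^ k * Y k j x)"
      by (simp only: integral_complex_of_real poisson_Y[OF j r x])
    finally show "(LINT z|\<sigma>. (s z - complex_of_real (poisson (r *\<^sub>R x) z)) * complex_of_real (Y k j z)) = 0" by simp
  qed
  moreover have "s z = sphere_series (\<lambda>k j. of_real (r ^ k) * of_real (Y k j z)) x"
    unfolding s_def sphere_series_def by (simp add: mult_ac)
  ultimately show ?thesis by simp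
qed

lemma poisson_integral_series:
  fixes \<phi> :: "'a \<Rightarrow> complex"
  assumes phi: "continuous_on (sphere 0 1) \<phi>" and r: "0 \<le> r" "r < 1" and x: "norm x = 1"
  shows "poisson_integral \<phi> (r *\<^sub>R x) = sphere_series (\<lambda>k j. of_real (r ^ k) * (LINT z|\<sigma>. \<phi> z * of_real (Y k j z))) x"
proof -
  have sM: "summable (\<lambda>k. (\<bar>ymax k\<bar> * r ^ k) * layer k)"
    by (rule subexponential_layer_summable[OF subexponential_ymax r])
  have b: "norm (of_real (r ^ k) * complex_of_real (Y k j z)) \<le> \<bar>ymax k\<bar> * r ^ k" if "j \<in> {1..d k}" "norm z = 1" for k j z
    using abs_Y_le_ymax[OF that] r by (simp add: norm_mult norm_power mult.commute mult_left_mono)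
  have "poisson_integral \<phi> (r *\<^sub>R x) = (LINT z|\<sigma>. sphere_series (\<lambda>k j. \<phi> z * (of_real (r ^ k) * of_real (Y k j z))) x)"
    unfolding poisson_integral_def
  proof (intro Bochner_Integration.integral_cong refl)
    fix z assume "z \<in> space \<sigma>"
    then have z: "norm z = 1" by simp
    show "poisson (r *\<^sub>R x) z *\<^sub>R \<phi> z = sphere_series (\<lambda>k j. \<phi> z * (of_real (r ^ k) * of_real (Y k j z))) x"
    proof -
      have "sphere_series (\<lambda>k j. \<phi> z * (of_real (r ^ k) * of_real (Y k j z))) x = 
        \<phi> z * sphere_series (\<lambda>k j. of_real (r ^ k) * of_real (Y k j z)) x"
      proof (rule sphere_series_mult[OF _ sM x])
        show "norm (of_real (r ^ k) * complex_of_real (Y k j z)) \<le> \<bar>ymax k\<bar> * r ^ k" if "j \<in> {1..d k}" for k j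
          by (rule b[OF that z])
      qed
      then show ?thesis unfolding poisson_expansion[OF r x z] scaleR_conv_of_real by (simp only: mult.commute)
    qed
  qed
  also have "\<dots> = sphere_series (\<lambda>k j. LINT z|\<sigma>. \<phi> z * (of_real (r ^ k) * of_real (Y k j z))) x"
  proof (rule sphere_series_integral(2)[symmetric, OF _ _ _ sM _ x])
    show "(\<lambda>z. \<phi> z * (of_real (r ^ k) * of_real (Y k j z))) \<in> borel_measurable \<sigma>" if "j \<in> {1..d k}" for k j
      by (intro measurable_sigma_continuous continuous_intros phi Y_continuous that)
    show "norm (\<phi> z * (of_real (r ^ k) * of_real (Y k j z))) \<le> (\<bar>ymax k\<bar> * r ^ k) * norm (\<phi> z)"
      if "j \<in> {1..d k}" "z \<in> space \<sigma>" for k j z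
      using b[OF that(1), of z] that by (simp add: norm_mult mult.commute mult_left_mono)
    show "integrable \<sigma> (\<lambda>z. norm (\<phi> z))" by (intro integrable_norm integrable_sigma_continuous phi)
  qed (use r in auto)
  also have "\<dots> = sphere_series (\<lambda>k j. of_real (r ^ k) * (LINT z|\<sigma>. \<phi> z * of_real (Y k j z))) x"
    by (intro sphere_series_cong) (simp add: mult.left_commute flip: integral_mult_right_zero)
  finally show ?thesis .
qed

lemma admissible_series:
  assumes "admissible c"
  shows admissible_sums: "\<And>x. x \<in> ball 0 1 \<Longrightarrow> harmonic_term Y c x sums harmonic_series Y c x"
    and admissible_series_converges: "series_converges Y c"
    and admissible_coefficients: "\<And>j k. j \<in> {1..d k} \<Longrightarrow> coefficients Y (harmonic_series Y c) k j = c k j"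
    and admissible_harmonic: "harmonic_on (harmonic_series Y c) (ball 0 1)"
proof -
  show s: "harmonic_term Y c x sums harmonic_series Y c x" if "x \<in> ball 0 1" for x
  proof -
    have nx: "norm x < 1" using that by simp
    obtain M where M: "\<And>k. 0 \<le> M k" "\<And>k j. j \<in> {1..d k} \<Longrightarrow> norm (of_real (norm x ^ k) * c k j) \<le> M k"
      "summable (\<lambda>k. M k * layer k)" using admissible_dominated[OF assms norm_ge_zero nx] by metis
    have "summable (harmonic_term Y c (norm x *\<^sub>R direction x))"
      using sphere_series_sums(1)[OF M(2,3) norm_direction[of x]] norm_direction[of x]
      by (simp add: harmonic_term_polar_fun sums_iff)
    then show ?thesis unfolding harmonic_series_def scaleR_norm_direction by (rule summable_sums)
  qed
  then show "series_converges Y c" unfolding series_converges_def by (auto simp: sums_iff)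
  show "coefficients Y (harmonic_series Y c) k j = c k j" if "j \<in> {1..d k}" for k j
    by (rule coefficients_eq[OF s that])
  show "harmonic_on (harmonic_series Y c) (ball 0 1)"
  proof (rule harmonic_on_locally)
    fix x :: 'a assume "x \<in> ball 0 1"
    then have "norm x < 1" by simp
    then obtain R where R: "norm x < R" "R < 1" using dense by blast
    then have R0: "0 < R" using norm_ge_zero[of x] by linarith
    obtain M where M: "\<And>k. 0 \<le> M k" "\<And>k j. j \<in> {1..d k} \<Longrightarrow> norm (of_real (R ^ k) * c k j) \<le> M k"
      "summable (\<lambda>k. M k * layer k)" using admissible_dominated[OF assms less_imp_le[OF R0] R(2)] by metis
    \<comment> \<open>\<open>\<phi>\<close> is the trace of the series on the sphere of radius
      \<open>R\<close>. Its Poisson integral, dilated to that sphere, has the same expansion, so the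
      series is harmonic inside.\<close>
    define \<phi> where "\<phi> = sphere_series (\<lambda>k j. of_real (R ^ k) * c k j)"
    have pc: "continuous_on (sphere 0 1) \<phi>" unfolding \<phi>_def by (rule sphere_series_continuous[OF M(2,3)])
    obtain B where B: "\<forall>z\<in>sphere 0 1. norm (\<phi> z) \<le> B"
      using compact_imp_bounded[OF compact_continuous_image[OF pc compact_sphere]]
      unfolding bounded_iff by auto
    have h: "harmonic_on (poisson_integral \<phi>) (ball 0 1)"
      by (rule harmonic_poisson_integral[of _ B]) (use B in \<open>auto intro: measurable_sigma_continuous pc\<close>)
    have "harmonic_on (\<lambda>y. poisson_integral \<phi> ((1/R) *\<^sub>R y)) {y. (1/R) *\<^sub>R y \<in> ball 0 1}"
      by (rule harmonic_on_dilation[OF h])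
    then have "harmonic_on (\<lambda>y. poisson_integral \<phi> ((1/R) *\<^sub>R y)) (ball 0 R)"
      by (rule harmonic_on_subset) (use R0 in \<open>auto simp: field_simps\<close>)
    moreover have "poisson_integral \<phi> ((1/R) *\<^sub>R y) = harmonic_series Y c y" if "y \<in> ball 0 R" for y
    proof -
      have "poisson_integral \<phi> ((1/R) *\<^sub>R y) = poisson_integral \<phi> ((norm y / R) *\<^sub>R direction y)"
        using scaleR_norm_direction[of y] by (metis scaleR_scaleR mult.commute times_divide_eq_right mult.right_neutral)
      also have "\<dots> = sphere_series (\<lambda>k j. of_real ((norm y / R) ^ k) * (LINT z|\<sigma>. \<phi> z * of_real (Y k j z))) (direction y)"
        by (rule poisson_integral_series[OF pc]) (use that R0 norm_direction in auto)
      also have "\<dots> = sphere_series (\<lambda>k j. of_real (norm y ^ k) * c k j) (direction y)"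
      proof (rule sphere_series_cong)
        fix k j assume "j \<in> {1..d k}"
        then have "(LINT z|\<sigma>. \<phi> z * of_real (Y k j z)) = of_real (R ^ k) * c k j"
          unfolding \<phi>_def by (intro sphere_series_coeff[where c="\<lambda>k j. of_real (R ^ k) * c k j" and M=M, OF M(2,3)])
        then show "of_real ((norm y / R) ^ k) * (LINT z|\<sigma>. \<phi> z * of_real (Y k j z)) = of_real (norm y ^ k) * c k j"
          using R0 by (simp add: power_divide)
      qed
      finally show ?thesis by (simp add: harmonic_series_direction)
    qed
    ultimately have "harmonic_on (harmonic_series Y c) (ball 0 R)" using harmonic_on_cong[OF _ open_ball] by blast
    then show "\<exists>T. open T \<and> x \<in> T \<and> harmonic_on (harmonic_series Y c) T"
      using R by (intro exI[of _ "ball 0 R"]) auto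
  qed
qed

text \<open>The Poisson formula for the dilates x \<mapsto> f (R x) gives coefficients
  \<open>C R\<close> for each R < 1. Uniqueness near the origin shows that they are R^k times a
  single family \<open>b\<close>, and the bounds for \<open>C R\<close> with R arbitrarily close to
  1 make \<open>b\<close> subexponential.\<close>

lemma harmonic_expansion:
  assumes f: "harmonic_on f (ball 0 1)"
  shows "admissible (coefficients Y f)"
    and "\<And>x. x \<in> ball 0 1 \<Longrightarrow> harmonic_term Y (coefficients Y f) x sums f x"
proof -
  define C where "C R k j = (LINT z|\<sigma>. f (R *\<^sub>R z) * of_real (Y k j z))" for R k j
  have fc: "continuous_on (ball 0 1) f" by (rule harmonic_on_continuous[OF f])
  have fRc: "continuous_on (cball 0 1) (\<lambda>z. f (R *\<^sub>R z))" if "0 < R" "R < 1" for R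
  proof (intro continuous_on_compose2[OF fc] continuous_intros subsetI)
    fix x :: 'a assume "x \<in> (*\<^sub>R) R ` cball 0 1"
    then obtain y :: 'a where "norm y \<le> 1" "x = R *\<^sub>R y" by auto
    then show "x \<in> ball 0 1" using that mult_left_le[of "norm y" R] by (simp; linarith)
  qed
  have fRs: "continuous_on (sphere 0 1) (\<lambda>z. f (R *\<^sub>R z))" if "0 < R" "R < 1" for R
    by (rule continuous_on_subset[OF fRc[OF that]]) auto
  have fb: "\<exists>B\<ge>0. \<forall>z\<in>sphere 0 1. norm (f (R *\<^sub>R z)) \<le> B" if R: "0 < R" "R < 1" for R
  proof -
    obtain B where "\<forall>z\<in>sphere 0 1. norm (f (R *\<^sub>R z)) \<le> B"
      using compact_imp_bounded[OF compact_continuous_image[OF fRs[OF R] compact_sphere]]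
      unfolding bounded_iff by auto
    then show ?thesis by (intro exI[of _ "max 0 B"]) auto
  qed
  have Cb: "\<exists>B\<ge>0. \<forall>k. \<forall>j\<in>{1..d k}. norm (C R k j) \<le> B * ymax k" if R: "0 < R" "R < 1" for R
  proof -
    obtain B where B: "B \<ge> 0" "\<forall>z\<in>sphere 0 1. norm (f (R *\<^sub>R z)) \<le> B" using fb[OF R] by blast
    have "norm (C R k j) \<le> \<omega> * (B * ymax k)" if j: "j \<in> {1..d k}" for k j
      unfolding C_def
    proof (rule norm_sigma_integral_le)
      show "(\<lambda>z. f (R *\<^sub>R z) * complex_of_real (Y k j z)) \<in> borel_measurable \<sigma>"
        by (intro measurable_sigma_continuous continuous_intros fRs[OF R] Y_continuous j)
      show "norm (f (R *\<^sub>R z) * complex_of_real (Y k j z)) \<le> B * ymax k" if "norm z = 1" for z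
        using B that abs_Y_le_ymax[OF j that] by (auto simp: norm_mult intro!: mult_mono)
    qed
    then show ?thesis using B(1) omega_pos by (intro exI[of _ "\<omega> * B"]) (auto simp: mult.assoc)
  qed
  have expR: "(\<lambda>k. \<Sum>j=1..d k. of_real (r ^ k) * C R k j * of_real (Y k j x)) sums f ((R * r) *\<^sub>R x)"
    if R: "0 < R" "R < 1" and r: "0 \<le> r" "r < 1" and x: "norm x = 1" for R r x
  proof -
    obtain B where B: "B \<ge> 0" "\<forall>k. \<forall>j\<in>{1..d k}. norm (C R k j) \<le> B * ymax k" using Cb[OF R] by blast
    have "admissible (C R)"
      by (rule admissibleI[OF subexponential_mult[OF subexponential_const[of B] subexponential_ymax]]) (use B in auto)
    then obtain M where M: "\<And>k j. j \<in> {1..d k} \<Longrightarrow> norm (of_real (r ^ k) * C R k j) \<le> M k"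
      "summable (\<lambda>k. M k * layer k)" using admissible_dominated[OF _ r] by metis
    have "harmonic_on (\<lambda>z. f (R *\<^sub>R z)) (ball 0 1)"
    proof (rule harmonic_on_subset[OF harmonic_on_dilation[OF f]], clarsimp)
      fix y :: 'a assume "norm y < 1"
      then show "\<bar>R\<bar> * norm y < 1" using R mult_left_le[of "norm y" R] by (simp; linarith)
    qed
    then have "poisson_integral (\<lambda>z. f (R *\<^sub>R z)) (r *\<^sub>R x) = f (R *\<^sub>R (r *\<^sub>R x))"
      by (rule poisson_formula[OF fRc[OF R]]) (use r x in auto)
    then have "sphere_series (\<lambda>k j. of_real (r ^ k) * C R k j) x = f ((R * r) *\<^sub>R x)"
      using poisson_integral_series[OF fRs[OF R] r x] by (simp add: C_def)
    with sphere_series_sums(1)[where c="\<lambda>k j. of_real (r ^ k) * C R k j", OF M x] show ?thesis by simp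
  qed
  \<comment> \<open>Normalised at the radius 1/2; every other radius gives the same family, as shown
    next.\<close>
  define b where "b k j = of_real (2 ^ k) * C (1/2) k j" for k j
  have bR: "C R k j = of_real (R ^ k) * b k j" if R: "0 < R" "R < 1" and j: "j \<in> {1..d k}" for R k j
  proof -
    have "of_real ((1/R) ^ k) * C R k j = b k j"
    proof (rule expansion_unique[where \<delta>="min R (1/2)" and f=f, OF _ _ _ j])
      fix r :: real and x :: 'a assume r: "0 < r" "r < min R (1/2)" and x: "norm x = 1"
      have e: "of_real (r ^ k) * (of_real ((1/R) ^ k) * z) = of_real ((r / R) ^ k) * z" for k and z :: complex
        by (simp add: power_divide)
      show "(\<lambda>k. \<Sum>j=1..d k. of_real (r ^ k) * (of_real ((1/R) ^ k) * C R k j) * of_real (Y k j x)) sums f (r *\<^sub>R x)"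
        unfolding e using expR[OF R _ _ x, of "r / R"] R r by simp
      have e2: "of_real (r ^ k) * b k j = of_real ((r * 2) ^ k) * C (1/2) k j" for k j
        by (simp add: b_def power_mult_distrib)
      show "(\<lambda>k. \<Sum>j=1..d k. of_real (r ^ k) * b k j * of_real (Y k j x)) sums f (r *\<^sub>R x)"
        unfolding e2 using expR[of "1/2" "r * 2", OF _ _ _ _ x] r by simp
    qed (use R in auto)
    then show ?thesis using R by (auto simp: power_divide field_simps)
  qed
  have s: "harmonic_term Y b x sums f x" if "x \<in> ball 0 1" for x
  proof -
    have "norm x < 1" using that by simp
    then obtain R where R: "norm x < R" "R < 1" using dense by blast
    then have R0: "0 < R" using norm_ge_zero[of x] by linarith
    have "(\<lambda>k. \<Sum>j=1..d k. of_real ((norm x / R) ^ k) * C R k j * of_real (Y k j (direction x))) sums f ((R * (norm x / R)) *\<^sub>R direction x)"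
      by (rule expR) (use R R0 norm_direction in auto)
    moreover have "(\<Sum>j=1..d k. of_real ((norm x / R) ^ k) * C R k j * of_real (Y k j (direction x))) = harmonic_term Y b x k" for k
    proof -
      have "harmonic_term Y b x k = (\<Sum>j=1..d k. of_real (norm x ^ k) * b k j * of_real (Y k j (direction x)))"
        using harmonic_term_polar[of "norm x" "direction x" b k] by (simp add: scaleR_norm_direction norm_direction)
      also have "\<dots> = (\<Sum>j=1..d k. of_real ((norm x / R) ^ k) * C R k j * of_real (Y k j (direction x)))"
        using R0 R by (intro sum.cong refl) (simp add: bR power_divide)
      finally show ?thesis by simp
    qed
    ultimately show ?thesis using R0 by (simp add: scaleR_norm_direction)
  qed
  have eq: "coefficients Y f k j = b k j" if "j \<in> {1..d k}" for k j
    by (rule coefficients_eq[OF s that])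
  show "harmonic_term Y (coefficients Y f) x sums f x" if "x \<in> ball 0 1" for x
  proof -
    have "harmonic_term Y (coefficients Y f) x = harmonic_term Y b x"
      unfolding harmonic_term_def d_eq by (intro ext arg_cong2[where f="(*)"] sum.cong refl) (use eq in auto)
    then show ?thesis using s[OF that] by simp
  qed
  define a where "a k = Sup (insert 0 ((\<lambda>j. norm (b k j)) ` {1..d k}))" for k
  have fin: "finite (insert 0 ((\<lambda>j. norm (b k j)) ` {1..d k}))" for k by simp
  have a_Max: "a k = Max (insert 0 ((\<lambda>j. norm (b k j)) ` {1..d k}))" for k
    unfolding a_def by (rule cSup_eq_Max[OF fin]) simp
  have "subexponential a" unfolding subexponential_def
  proof (intro allI impI)
    fix r :: real assume r: "0 < r \<and> r < 1"
    \<comment> \<open>One factor \<open>R ^ k\<close> turns \<open>b\<close> into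
      \<open>C R\<close>, the other absorbs the growth of \<open>ymax\<close>.\<close>
    define R where "R = sqrt r"
    have R: "0 < R" "R < 1" "r = R * R" using r by (auto simp: R_def)
    obtain B where B: "B \<ge> 0" "\<forall>k. \<forall>j\<in>{1..d k}. norm (C R k j) \<le> B * ymax k" using Cb[OF R(1,2)] by blast
    obtain D where D: "D > 0" "\<And>k. \<bar>ymax k\<bar> * R ^ k \<le> D" using subexponentialE[OF subexponential_ymax R(1,2)] by blast
    have "\<bar>a k\<bar> * r ^ k \<le> B * D" for k
    proof -
      have "a k \<in> insert 0 ((\<lambda>j. norm (b k j)) ` {1..d k})" unfolding a_Max by (rule Max_in) auto
      then consider "a k = 0" | j where "j \<in> {1..d k}" "a k = norm (b k j)" by auto
      then show ?thesis
      proof cases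
        case 1
        then show ?thesis using B D by simp
      next
        case 2
        have "\<bar>a k\<bar> * r ^ k = norm (C R k j) * R ^ k"
          using 2 R by (simp add: bR norm_mult norm_power power_mult_distrib)
        also have "\<dots> \<le> B * ymax k * R ^ k" using B 2 R by (intro mult_right_mono) auto
        also have "\<dots> \<le> B * D" using D(2)[of k] ymax_nonneg[of k] B by (simp add: mult.assoc mult_left_mono)
        finally show ?thesis .
      qed
    qed
    then show "\<exists>C. \<forall>k. \<bar>a k\<bar> * r ^ k \<le> C" by blast
  qed
  then show "admissible (coefficients Y f)"
  proof (rule admissibleI)
    show "norm (coefficients Y f k j) \<le> a k" if "j \<in> {1..d k}" for k j
      unfolding eq[OF that] a_Max by (rule Max_ge) (use that in auto)
  qed
qed

end

section \<open>Zonal kernels\<close>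

lemma Beta_real_pos: "a > 0 \<Longrightarrow> b > 0 \<Longrightarrow> Beta a b > (0 :: real)"
  unfolding Beta_def by (intro divide_pos_pos mult_pos_pos Gamma_real_pos) auto

lemma LIMSEQ_linear_ratio:
  fixes b c :: real
  assumes "c > 0"
  shows "(\<lambda>k. (real k + b) / (real k + c)) \<longlonglongrightarrow> 1"
proof -
  have "filterlim (\<lambda>k. real k + c) at_infinity sequentially"
    using filterlim_tendsto_add_at_top[OF tendsto_const[of c] filterlim_real_sequentially]
    by (intro filterlim_at_top_imp_at_infinity) (simp add: add.commute)
  then have "(\<lambda>k. 1 + (b - c) / (real k + c)) \<longlonglongrightarrow> 1 + 0"
    by (intro tendsto_add tendsto_const tendsto_divide_0[OF tendsto_const])
  moreover have "1 + (b - c) / (real k + c) = (real k + b) / (real k + c)" for k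
    using assms by (simp add: field_simps add_nonneg_eq_0_iff)
  ultimately show ?thesis by simp
qed

text \<open>Left without the normalising constant, so that its moments are the values
  \<open>Beta (a + k) b\<close> themselves.\<close>

definition beta_measure :: "real \<Rightarrow> real \<Rightarrow> real measure" where
  "beta_measure a b = density (restrict_space lborel {0<..<1}) (\<lambda>s. ennreal (s powr (a - 1) * (1 - s) powr (b - 1)))"

lemma space_beta_measure [simp]: "space (beta_measure a b) = {0<..<1}"
  by (simp add: beta_measure_def space_restrict_space)

lemma measurable_beta_measure: "f \<in> borel_measurable borel \<Longrightarrow> f \<in> borel_measurable (beta_measure a b)"
  by (simp add: beta_measure_def measurable_restrict_space1)

lemma nn_integral_beta_measure:
  fixes f :: "real \<Rightarrow> ennreal"
  assumes [measurable]: "f \<in> borel_measurable borel"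
  shows "(\<integral>\<^sup>+s. f s \<partial>beta_measure a b) =
    (\<integral>\<^sup>+s. ennreal (s powr (a - 1) * (1 - s) powr (b - 1)) * f s * indicator {0<..<1} s \<partial>lborel)"
  unfolding beta_measure_def
  by (subst nn_integral_density) (auto simp: nn_integral_restrict_space intro!: measurable_restrict_space1)

lemma nn_integral_beta_measure_power:
  assumes "a > 0" "b > 0"
  shows "(\<integral>\<^sup>+s. ennreal (s ^ k) \<partial>beta_measure a b) = ennreal (Beta (a + real k) b)"
proof -
  have "(\<integral>\<^sup>+s. ennreal (s ^ k) \<partial>beta_measure a b) =
    (\<integral>\<^sup>+s. ennreal (s powr (a - 1) * (1 - s) powr (b - 1)) * ennreal (s ^ k) * indicator {0<..<1} s \<partial>lborel)"
    by (rule nn_integral_beta_measure) simp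
  also have "\<dots> = (\<integral>\<^sup>+s. ennreal (s powr (a + real k - 1) * (1 - s) powr (b - 1)) * indicator {0<..<1} s \<partial>lborel)"
  proof (rule nn_integral_cong)
    fix s :: real
    show "ennreal (s powr (a - 1) * (1 - s) powr (b - 1)) * ennreal (s ^ k) * indicator {0<..<1} s =
      ennreal (s powr (a + real k - 1) * (1 - s) powr (b - 1)) * indicator {0<..<1} s"
    proof (cases "s \<in> {0<..<1}")
      case True
      then have "s powr (a + real k - 1) = s powr (a - 1) * s ^ k"
        by (simp add: powr_realpow[symmetric] powr_add[symmetric] algebra_simps)
      then show ?thesis using True by (simp add: ennreal_mult[symmetric] mult_ac)
    qed simp
  qed
  also have "\<dots> = ennreal (Beta (a + real k) b)"
  proof (rule nn_integral_has_integral_lebesgue')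
    show "((\<lambda>s. s powr (a + real k - 1) * (1 - s) powr (b - 1)) has_integral Beta (a + real k) b) {0<..<1}"
      using has_integral_Beta_real[of "a + real k" b] assms by (simp add: has_integral_Icc_iff_Ioo)
  qed auto
  finally show ?thesis .
qed

lemma finite_beta_measure:
  assumes "a > 0" "b > 0"
  shows "finite_measure (beta_measure a b)"
proof
  have "emeasure (beta_measure a b) (space (beta_measure a b)) = (\<integral>\<^sup>+s. ennreal (s ^ 0) \<partial>beta_measure a b)"
    by (simp del: space_beta_measure)
  then show "emeasure (beta_measure a b) (space (beta_measure a b)) \<noteq> \<infinity>"
    unfolding nn_integral_beta_measure_power[OF assms] by simp
qed

lemma integral_beta_measure_power:
  assumes "a > 0" "b > 0"
  shows "(LINT s|beta_measure a b. s ^ k) = Beta (a + real k) b"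
proof -
  have "(LINT s|beta_measure a b. s ^ k) = enn2real (\<integral>\<^sup>+s. ennreal (s ^ k) \<partial>beta_measure a b)"
    by (rule integral_eq_nn_integral) (auto intro!: AE_I2 measurable_beta_measure)
  also have "\<dots> = Beta (a + real k) b"
    unfolding nn_integral_beta_measure_power[OF assms] using assms
    by (intro enn2real_ennreal less_imp_le Beta_real_pos) auto
  finally show ?thesis .
qed

text \<open>Split at s = r. Below, 1 - r s \<ge> 1 - s leaves (1 - s)^(-b-1); above, 1 - r s \<ge> 1
  - r leaves (1 - s)^(a-1). Both parts are of order (1 - r)^(-b); in the first this uses b > 0, as b
  = 0 would give a logarithm.\<close>

lemma nn_integral_one_minus_powr_le:
  assumes a: "a > 0" and b: "b > 0" and r: "0 \<le> r" "r < 1"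
  shows "(\<integral>\<^sup>+s. ennreal ((1 - s) powr (a - 1) * (1 - r * s) powr (- (a + b))) * indicator {0<..<1} s \<partial>lborel)
    \<le> ennreal ((1 / a + 1 / b) * (1 - r) powr (- b))"
proof -
  define f where "f s = (1 - s) powr (- b - 1)" for s :: real
  define g where "g s = (1 - s) powr (a - 1) * (1 - r) powr (- (a + b))" for s :: real
  have [measurable]: "f \<in> borel_measurable borel" "g \<in> borel_measurable borel" unfolding f_def g_def by simp_all
  have F: "(f has_integral ((1 - r) powr (- b) / b - 1 / b)) {0..r}"
  proof -
    have "(f has_integral ((1 - r) powr (- b) / b - (1 - 0) powr (- b) / b)) {0..r}"
    proof (rule fundamental_theorem_of_calculus[OF r(1)])
      fix s assume "s \<in> {0..r}"
      then have "s < 1" using r by simp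
      then have "((\<lambda>s. (1 - s) powr (- b) / b) has_real_derivative f s) (at s)"
        unfolding f_def using b by (auto intro!: derivative_eq_intros simp: field_simps)
      then show "((\<lambda>s. (1 - s) powr (- b) / b) has_vector_derivative f s) (at s within {0..r})"
        by (simp add: has_real_derivative_iff_has_vector_derivative has_vector_derivative_at_within)
    qed
    then show ?thesis by simp
  qed
  have G: "(g has_integral ((1 - r) powr (- b) / a)) {r..1}"
  proof -
    have "((\<lambda>s. (1 - s) powr (a - 1)) has_integral (- ((1 - 1) powr a / a) - (- ((1 - r) powr a / a)))) {r..1}"
    proof (rule fundamental_theorem_of_calculus_interior)
      show "continuous_on {r..1} (\<lambda>s. - ((1 - s) powr a / a))"
        using a by (intro continuous_on_minus continuous_on_divide continuous_on_powr' continuous_intros) auto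
      fix s assume "s \<in> {r<..<1}"
      then have "((\<lambda>s. - ((1 - s) powr a / a)) has_real_derivative (1 - s) powr (a - 1)) (at s)"
        using a by (auto intro!: derivative_eq_intros simp: field_simps)
      then show "((\<lambda>s. - ((1 - s) powr a / a)) has_vector_derivative (1 - s) powr (a - 1)) (at s)"
        by (simp add: has_real_derivative_iff_has_vector_derivative)
    qed (use r in simp)
    then have "(g has_integral ((1 - r) powr a / a * (1 - r) powr (- (a + b)))) {r..1}"
      unfolding g_def by (intro has_integral_mult_left) simp
    moreover have "(1 - r) powr a * (1 - r) powr (- (a + b)) = (1 - r) powr (- b)"
      by (simp add: powr_add[symmetric])
    ultimately show ?thesis by simp
  qed
  have "(\<integral>\<^sup>+s. ennreal ((1 - s) powr (a - 1) * (1 - r * s) powr (- (a + b))) * indicator {0<..<1} s \<partial>lborel)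
    \<le> (\<integral>\<^sup>+s. ennreal (f s) * indicator {0..r} s + ennreal (g s) * indicator {r..1} s \<partial>lborel)"
  proof (rule nn_integral_mono)
    fix s :: real
    show "ennreal ((1 - s) powr (a - 1) * (1 - r * s) powr (- (a + b))) * indicator {0<..<1} s
      \<le> ennreal (f s) * indicator {0..r} s + ennreal (g s) * indicator {r..1} s"
    proof (cases "s \<in> {0<..<1}")
      case s: True
      show ?thesis
      proof (cases "s \<le> r")
        case True
        have "r * s \<le> s" using s r by (simp add: mult_le_cancel_right1)
        then have "(1 - r * s) powr (- (a + b)) \<le> (1 - s) powr (- (a + b))"
          using s a b by (intro powr_mono2') auto
        then have "(1 - s) powr (a - 1) * (1 - r * s) powr (- (a + b)) \<le> (1 - s) powr (a - 1) * (1 - s) powr (- (a + b))"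
          by (intro mult_left_mono) auto
        also have "\<dots> = f s"
        proof -
          have e: "(a - 1) + - (a + b) = - b - 1" by simp
          show ?thesis by (simp only: f_def powr_add[symmetric] e)
        qed
        finally have "ennreal ((1 - s) powr (a - 1) * (1 - r * s) powr (- (a + b))) \<le> ennreal (f s)" by (rule ennreal_leI)
        then show ?thesis using s True by (simp add: add_increasing2)
      next
        case False
        have "r * s \<le> r" using s r by (simp add: mult_left_le)
        then have "(1 - r * s) powr (- (a + b)) \<le> (1 - r) powr (- (a + b))"
          using r a b by (intro powr_mono2') auto
        then have "(1 - s) powr (a - 1) * (1 - r * s) powr (- (a + b)) \<le> g s"
          unfolding g_def by (intro mult_left_mono) auto
        then have "ennreal ((1 - s) powr (a - 1) * (1 - r * s) powr (- (a + b))) \<le> ennreal (g s)" by (rule ennreal_leI)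
        then show ?thesis using s False by simp
      qed
    qed simp
  qed
  also have "\<dots> = ennreal ((1 - r) powr (- b) / b - 1 / b) + ennreal ((1 - r) powr (- b) / a)"
  proof -
    have "(\<integral>\<^sup>+s. ennreal (f s) * indicator {0..r} s \<partial>lborel) = ennreal ((1 - r) powr (- b) / b - 1 / b)"
      by (rule nn_integral_has_integral_lebesgue'[OF _ F]) (simp add: f_def)
    moreover have "(\<integral>\<^sup>+s. ennreal (g s) * indicator {r..1} s \<partial>lborel) = ennreal ((1 - r) powr (- b) / a)"
      by (rule nn_integral_has_integral_lebesgue'[OF _ G]) (simp add: g_def)
    ultimately show ?thesis by (subst nn_integral_add) auto
  qed
  also have "\<dots> \<le> ennreal ((1 - r) powr (- b) / b) + ennreal ((1 - r) powr (- b) / a)"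
    using b by (intro add_mono ennreal_leI) auto
  also have "\<dots> = ennreal ((1 / a + 1 / b) * (1 - r) powr (- b))"
    using a b by (simp add: ennreal_plus[symmetric] algebra_simps del: ennreal_plus)
  finally show ?thesis .
qed

text \<open>For 0 < r < 1 the ratio of consecutive terms of \<open>a k * r ^ k\<close> tends to r,
  so this sequence is eventually decreasing.\<close>

lemma subexponential_ratio:
  fixes a :: "nat \<Rightarrow> real"
  assumes pos: "\<And>k. a k > 0" and lim: "(\<lambda>k. a (Suc k) / a k) \<longlonglongrightarrow> 1"
  shows "subexponential a"
  unfolding subexponential_def
proof (intro allI impI)
  fix r :: real assume r: "0 < r \<and> r < 1"
  then have "1 < 1 / r" by simp
  with lim have "\<forall>\<^sub>F k in sequentially. a (Suc k) / a k < 1 / r" by (rule order_tendstoD)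
  then obtain K where K: "\<And>k. k \<ge> K \<Longrightarrow> a (Suc k) / a k < 1 / r" unfolding eventually_sequentially by blast
  have step: "a (Suc k) * r ^ Suc k \<le> a k * r ^ k" if "k \<ge> K" for k
  proof -
    have "a (Suc k) * r \<le> a k" using K[OF that] pos[of k] r by (simp add: field_simps)
    then have "a (Suc k) * r * r ^ k \<le> a k * r ^ k" using r by (intro mult_right_mono) auto
    then show ?thesis by (simp add: mult_ac)
  qed
  define C where "C = Max ((\<lambda>k. a k * r ^ k) ` {..K})"
  have C: "a k * r ^ k \<le> C" if "k \<le> K" for k unfolding C_def by (rule Max_ge) (use that in auto)
  have "a k * r ^ k \<le> C" for k
  proof (cases "k \<le> K")
    case False
    then have "K \<le> k" by simp
    then show ?thesis
    proof (induction rule: dec_induct)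
      case base
      show ?case by (rule C) simp
    next
      case (step n)
      show ?case using assms step.IH \<open>K \<le> n\<close> \<open>\<And>k. k \<ge> K \<Longrightarrow> a (Suc k) * r ^ Suc k \<le> a k * r ^ k\<close>[of n] by linarith
    qed
  qed (rule C)
  then show "\<exists>C. \<forall>k. \<bar>a k\<bar> * r ^ k \<le> C" using pos by (intro exI[of _ C]) (simp add: less_imp_le)
qed

lemma subexponential_linear:
  assumes "c > 0"
  shows "subexponential (\<lambda>k. real k + c)"
proof (rule subexponential_ratio)
  show "(\<lambda>k. (real (Suc k) + c) / (real k + c)) \<longlonglongrightarrow> 1" 
    using LIMSEQ_linear_ratio[OF assms, of "1 + c"] by (simp add: add_ac)
qed (use assms in auto)

lemma subexponential_pochhammer:
  assumes "c > 0"
  shows "subexponential (\<lambda>k. pochhammer (real k + c) N)"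
proof (induction N)
  case (Suc N)
  have "subexponential (\<lambda>k. pochhammer (real k + c) N * (real k + (c + real N)))"
    using assms by (intro subexponential_mult Suc subexponential_linear) auto
  then show ?case by (simp add: pochhammer_Suc add.assoc)
qed (simp add: subexponential_const)

text \<open>With h = n/2, the factor by which the fractional derivative of order t acts on terms of
  degree k.\<close>

definition frac_factor :: "real \<Rightarrow> real \<Rightarrow> nat \<Rightarrow> real" where
  "frac_factor h t k = Gamma (real k + h + t) / (Gamma (real k + h) * Gamma t)"

lemma frac_factor_pos: "h > 0 \<Longrightarrow> t > 0 \<Longrightarrow> 0 < frac_factor h t k"
  unfolding frac_factor_def by (intro divide_pos_pos mult_pos_pos Gamma_real_pos) auto

lemma frac_factor_Beta:
  assumes "h > 0" "t > 0"
  shows "frac_factor h t k * Beta (h + real k) t = 1"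
proof -
  have "Gamma (real k + h) > 0" "Gamma t > 0" "Gamma (real k + h + t) > 0" using assms by (auto intro!: Gamma_real_pos)
  then show ?thesis by (simp add: frac_factor_def Beta_def add_ac)
qed

text \<open>Reduces a real order t to an integer order N > t: the factor is a beta moment times a
  polynomial of degree N in k, and a beta moment acts on a kernel by averaging it over smaller
  radii.\<close>

lemma frac_factor_pochhammer:
  assumes "h > 0" "t > 0" "t < real N"
  shows "frac_factor h t k = Beta (h + t + real k) (real N - t) * pochhammer (real k + h) N / (Gamma (real N - t) * Gamma t)"
proof -
  have g: "Gamma (real k + h) > 0" "Gamma (real N - t) > 0" "Gamma (real k + h + real N) > 0" using assms by (auto intro!: Gamma_real_pos)
  have "real k + h \<notin> \<int>\<^sub>\<le>\<^sub>0" using assms by (auto elim!: nonpos_Ints_cases)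
  then have "pochhammer (real k + h) N = Gamma (real k + h + real N) / Gamma (real k + h)"
    using pochhammer_Gamma[of "real k + h" N] by simp
  then show ?thesis using g by (simp add: frac_factor_def Beta_def add_ac)
qed

lemma subexponential_frac_factor:
  assumes "h > 0" "t > 0"
  shows "subexponential (frac_factor h t)"
proof (rule subexponential_ratio)
  have "frac_factor h t (Suc k) / frac_factor h t k = (real k + h + t) / (real k + h)" for k
  proof -
    have g: "Gamma (real k + h) > 0" "Gamma (real k + h + t) > 0" "Gamma t > 0" using assms by (auto intro!: Gamma_real_pos)
    have np: "real k + x \<notin> \<int>\<^sub>\<le>\<^sub>0" if "x > 0" for x using that by (auto elim!: nonpos_Ints_cases)
    have e1: "Gamma (real (Suc k) + h) = (real k + h) * Gamma (real k + h)"
      using Gamma_plus1[of "real k + h"] np[of h] assms by (simp add: add_ac)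
    have e2: "Gamma (real (Suc k) + h + t) = (real k + h + t) * Gamma (real k + h + t)"
      using Gamma_plus1[of "real k + (h + t)"] np[of "h + t"] assms by (simp add: add_ac)
    have c: "((x + t) * G2 / (x * G1 * G3)) / (G2 / (G1 * G3)) = (x + t) / x" 
      if "x > 0" "G1 > 0" "G2 > 0" "G3 > 0" for x G1 G2 G3 :: real
      using that by (simp add: field_simps)
    show ?thesis unfolding frac_factor_def e1 e2 using assms by (intro c g) auto
  qed
  moreover have "(\<lambda>k. (real k + h + t) / (real k + h)) \<longlonglongrightarrow> 1" 
    using LIMSEQ_linear_ratio[OF assms(1), of "h + t"] by (simp add: add_ac)
  ultimately show "(\<lambda>k. frac_factor h t (Suc k) / frac_factor h t k) \<longlonglongrightarrow> 1" by simp
qed (use assms frac_factor_pos in auto)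

lemma norm_integral_le_nn_integral:
  fixes f :: "'a \<Rightarrow> 'b::{banach,second_countable_topology}"
  shows "ennreal (norm (LINT x|M. f x)) \<le> (\<integral>\<^sup>+x. ennreal (norm (f x)) \<partial>M)"
  by (cases "integrable M f") (auto simp: integral_norm_bound_ennreal not_integrable_integral_eq)

section \<open>Kernels with coefficients depending on the degree, and their L^1 norms\<close>

context sphere_basis
begin

lemma Y_measurable_compose [measurable (raw)]:
  "j \<in> {1..d k} \<Longrightarrow> f \<in> M \<rightarrow>\<^sub>M \<sigma> \<Longrightarrow> (\<lambda>x. Y k j (f x)) \<in> borel_measurable M"
  using measurable_compose[OF _ Y_measurable] by blast

text \<open>The constant sequence 1 gives the Poisson kernel with pole \<open>z\<close>, and
  \<open>frac_factor h t\<close> with h = n/2 gives its fractional derivative. Products of the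
  sequences \<open>A\<close> correspond to convolutions of the kernels.\<close>

definition zonal :: "(nat \<Rightarrow> real) \<Rightarrow> real \<Rightarrow> 'a \<Rightarrow> 'a \<Rightarrow> complex" where
  "zonal A r x z = sphere_series (\<lambda>k j. of_real (r ^ k) * (of_real (A k) * of_real (Y k j z))) x"

lemma zonal_coeff_bound:
  assumes "0 \<le> r" "norm z = 1" "j \<in> {1..d k}"
  shows "norm (of_real (r ^ k) * (of_real (A k) * complex_of_real (Y k j z))) \<le> \<bar>A k * ymax k\<bar> * r ^ k"
proof -
  have "norm (of_real (r ^ k) * (of_real (A k) * complex_of_real (Y k j z))) = r ^ k * (\<bar>A k\<bar> * \<bar>Y k j z\<bar>)"
    using assms by (simp add: norm_mult norm_power)
  also have "\<dots> \<le> r ^ k * (\<bar>A k\<bar> * ymax k)"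
    using assms abs_Y_le_ymax[OF assms(3,2)] by (intro mult_left_mono) auto
  finally show ?thesis using ymax_nonneg[of k] by (simp add: abs_mult mult_ac)
qed

lemma zonal_summable:
  assumes "subexponential A" "0 \<le> r" "r < 1"
  shows "summable (\<lambda>k. (\<bar>A k * ymax k\<bar> * r ^ k) * layer k)"
  by (intro subexponential_layer_summable subexponential_mult subexponential_ymax assms)

text \<open>The basis is real, hence so are the kernels; the real power series in \<open>r\<close>
  is the form that can be differentiated radially.\<close>

lemma zonal_real:
  assumes A: "subexponential A" and r: "0 \<le> r" "r < 1" and x: "norm x = 1" and z: "norm z = 1"
  shows "(\<lambda>k. A k * (\<Sum>j=1..d k. Y k j x * Y k j z) * r ^ k) sums Re (zonal A r x z)"
    and "zonal A r x z = of_real (Re (zonal A r x z))"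
proof -
  have "(\<lambda>k. \<Sum>j=1..d k. of_real (r ^ k) * (of_real (A k) * of_real (Y k j z)) * complex_of_real (Y k j x)) sums zonal A r x z"
    unfolding zonal_def
    by (rule sphere_series_sums(1)[where c="\<lambda>k j. of_real (r ^ k) * (of_real (A k) * of_real (Y k j z))", 
        OF zonal_coeff_bound[where A=A, OF r(1) z] zonal_summable[OF A r] x])
  moreover have "(\<Sum>j=1..d k. of_real (r ^ k) * (of_real (A k) * of_real (Y k j z)) * complex_of_real (Y k j x)) =
    complex_of_real (A k * (\<Sum>j=1..d k. Y k j x * Y k j z) * r ^ k)" for k
    by (simp add: sum_distrib_left sum_distrib_right mult_ac)
  ultimately have s: "(\<lambda>k. complex_of_real (A k * (\<Sum>j=1..d k. Y k j x * Y k j z) * r ^ k)) sums zonal A r x z" by simp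
  show 1: "(\<lambda>k. A k * (\<Sum>j=1..d k. Y k j x * Y k j z) * r ^ k) sums Re (zonal A r x z)"
    using sums_Re[OF s] by simp
  show "zonal A r x z = of_real (Re (zonal A r x z))"
    using sums_unique2[OF s sums_of_real[OF 1]] .
qed

lemma zonal_one:
  assumes "0 \<le> r" "r < 1" "norm x = 1" "norm z = 1"
  shows "zonal (\<lambda>_. 1) r x z = of_real (poisson (r *\<^sub>R x) z)"
  using poisson_expansion[OF assms] by (simp add: zonal_def)

lemma zonal_measurable_pair [measurable]: "(\<lambda>(x, z). zonal A r x z) \<in> borel_measurable (\<sigma> \<Otimes>\<^sub>M \<sigma>)"
  unfolding zonal_def sphere_series_def split_beta by measurable

lemma zonal_measurable: "norm z = 1 \<Longrightarrow> (\<lambda>x. zonal A r x z) \<in> borel_measurable \<sigma>"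
  using measurable_compose[OF measurable_Pair2'[of z \<sigma> \<sigma>] zonal_measurable_pair[of A r]]
    measurable_compose[OF measurable_Pair1'[of z \<sigma> \<sigma>] zonal_measurable_pair[of A r]] by simp

text \<open>Differentiating \<open>r \<mapsto> P(r x, z)\<close> logarithmically gives the factor in brackets.\<close>

lemma poisson_radial_derivative:
  assumes r: "0 < r" "r < 1" and x: "norm x = 1" and z: "norm z = 1"
  defines "h \<equiv> real DIM('a) / 2" and "D \<equiv> (r *\<^sub>R x - z) \<bullet> (r *\<^sub>R x - z)"
  shows "Re (zonal (\<lambda>k. real k + h) r x z) = poisson (r *\<^sub>R x) z * (h * (1 - r\<^sup>2) / D - 2 * r\<^sup>2 / (1 - r\<^sup>2))"
proof -
  define S where "S k = (\<Sum>j=1..d k. Y k j x * Y k j z)" for k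
  define u where "u = x \<bullet> z"
  have sq: "(t *\<^sub>R x - z) \<bullet> (t *\<^sub>R x - z) = t\<^sup>2 - 2 * t * u + 1" for t
  proof -
    have "x \<bullet> x = 1" "z \<bullet> z = 1" using x z by (simp_all add: dot_square_norm)
    then show ?thesis by (simp add: inner_diff inner_commute u_def power2_eq_square algebra_simps)
  qed
  have xx: "(t *\<^sub>R x) \<bullet> (t *\<^sub>R x) = t\<^sup>2" for t using x by (simp add: dot_square_norm power2_eq_square)
  define g where "g t = (1 - t\<^sup>2) * (t\<^sup>2 - 2 * t * u + 1) powr (- h) / \<omega>" for t
  have gp: "poisson (t *\<^sub>R x) z = g t" for t unfolding poisson_def sq xx g_def h_def by simp
  define F where "F t = (\<Sum>k. S k * t ^ k)" for t
  have Fs: "(\<lambda>k. S k * t ^ k) sums g t" if "0 \<le> t" "t < 1" for t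
    using zonal_real(1)[OF subexponential_const[of 1] that x z] unfolding zonal_one[OF that x z] gp S_def by simp
  have Fg: "F t = g t" if "0 \<le> t" "t < 1" for t using Fs[OF that] by (simp add: F_def sums_iff)
  have D: "D = r\<^sup>2 - 2 * r * u + 1" unfolding D_def by (rule sq)
  have Dpos: "D > 0" unfolding D_def using r x z ball_sphere_neq[of "r *\<^sub>R x" z] by simp
  \<comment> \<open>A radius between \<open>r\<close> and 1 at which the power series still
    converges, for termwise differentiation at \<open>r\<close>.\<close>
  define K where "K = (1 + r) / 2"
  have K: "r < K" "K < 1" "0 \<le> K" using r by (auto simp: K_def)
  have sK: "summable (\<lambda>k. S k * K ^ k)" using Fs[OF K(3,2)] by (simp add: sums_iff)
  have dF: "(F has_real_derivative (\<Sum>k. diffs S k * r ^ k)) (at r)"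
    unfolding F_def[abs_def] using r K by (intro termdiffs_strong[OF sK]) auto
  have "(g has_real_derivative ((- 2 * r) * D powr (- h) + (1 - r\<^sup>2) * ((- h) * D powr (- h - 1) * (2 * r - 2 * u))) / \<omega>) (at r)"
  proof -
    have e: "((\<lambda>t. t\<^sup>2 - 2 * t * u + 1) has_real_derivative (2 * r - 2 * u)) (at r)"
      by (auto intro!: derivative_eq_intros)
    have e1: "((\<lambda>t. 1 - t\<^sup>2) has_real_derivative (- 2 * r)) (at r)"
      by (auto intro!: derivative_eq_intros)
    have "((\<lambda>y. y powr (- h)) has_real_derivative (- h) * D powr (- h - 1)) (at (r\<^sup>2 - 2 * r * u + 1))"
      unfolding D[symmetric] by (rule has_real_derivative_powr[OF Dpos])
    from DERIV_cdivide[OF DERIV_mult[OF e1 DERIV_chain2[OF this e]], of \<omega>]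
    show ?thesis unfolding g_def[abs_def] D[symmetric] by (simp add: mult_ac)
  qed
  moreover have "(F has_real_derivative g') (at r) \<longleftrightarrow> (g has_real_derivative g') (at r)" for g'
    by (rule has_field_derivative_cong_ev[OF refl _ refl refl])
       (use r Fg in \<open>auto simp: eventually_nhds intro!: exI[of _ "{0<..<1}"]\<close>)
  ultimately have dd: "(\<Sum>k. diffs S k * r ^ k) = ((- 2 * r) * D powr (- h) + (1 - r\<^sup>2) * ((- h) * D powr (- h - 1) * (2 * r - 2 * u))) / \<omega>"
    using DERIV_unique dF by blast
  have "summable (\<lambda>k. diffs S k * r ^ k)"
    using termdiff_converges[of r K S] r K powser_inside[OF sK] by auto
  then have "(\<lambda>n. real n * S n * r ^ (n - Suc 0)) sums (\<Sum>k. diffs S k * r ^ k)" by (rule diffs_equiv)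
  then have "(\<lambda>n. (real n * S n * r ^ (n - Suc 0)) * r) sums ((\<Sum>k. diffs S k * r ^ k) * r)" by (rule sums_mult2)
  moreover have "(real n * S n * r ^ (n - Suc 0)) * r = real n * S n * r ^ n" for n by (cases n) auto
  ultimately have "(\<lambda>n. real n * S n * r ^ n) sums ((\<Sum>k. diffs S k * r ^ k) * r)" by simp
  then have "(\<lambda>n. real n * S n * r ^ n + h * (S n * r ^ n)) sums ((\<Sum>k. diffs S k * r ^ k) * r + h * g r)"
    using r by (intro sums_add sums_mult Fs) auto
  then have s: "(\<lambda>n. (real n + h) * S n * r ^ n) sums ((\<Sum>k. diffs S k * r ^ k) * r + h * g r)"
    by (simp add: algebra_simps)
  have "subexponential (\<lambda>k. real k + h)" by (rule subexponential_linear) (simp add: h_def)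
  from zonal_real(1)[OF this less_imp_le[OF r(1)] r(2) x z]
  have "Re (zonal (\<lambda>k. real k + h) r x z) = (\<Sum>k. diffs S k * r ^ k) * r + h * g r"
    unfolding S_def[symmetric] using s by (rule sums_unique2)
  also have "\<dots> = g r * (h * (1 - r\<^sup>2) / D - 2 * r\<^sup>2 / (1 - r\<^sup>2))"
  proof -
    define p where "p = D powr (- h - 1)"
    have p: "D powr (- h) = p * D" using powr_add[of D "- h - 1" 1] Dpos by (simp add: p_def)
    have r2: "1 - r\<^sup>2 > 0" using r by (simp add: power_less_one_iff)
    have gr: "g r = (1 - r\<^sup>2) * (p * D) / \<omega>" unfolding g_def D[symmetric] p ..
    \<comment> \<open>The inner product \<open>u\<close> is eliminated in favour of
      \<open>D\<close>, so that the powers of \<open>D\<close> combine.\<close>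
    have "2 * r * u = r\<^sup>2 + 1 - D" using D by simp
    then have ru: "r * (2 * r - 2 * u) = D - (1 - r\<^sup>2)" by (simp add: algebra_simps power2_eq_square)
    have "(\<Sum>k. diffs S k * r ^ k) * r = (- 2 * r\<^sup>2 * (p * D) - (1 - r\<^sup>2) * h * p * (r * (2 * r - 2 * u))) / \<omega>"
      unfolding dd p p_def[symmetric] by (simp add: power2_eq_square algebra_simps)
    also have "\<dots> = (- 2 * r\<^sup>2 * (p * D) - (1 - r\<^sup>2) * h * p * (D - (1 - r\<^sup>2))) / \<omega>" unfolding ru ..
    finally have 0: "(\<Sum>k. diffs S k * r ^ k) * r = (- 2 * r\<^sup>2 * (p * D) - (1 - r\<^sup>2) * h * p * (D - (1 - r\<^sup>2))) / \<omega>" .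
    have 1: "(\<Sum>k. diffs S k * r ^ k) * r + h * g r = (- 2 * r\<^sup>2 * (p * D) + (1 - r\<^sup>2) * h * p * (1 - r\<^sup>2)) / \<omega>"
      unfolding 0 gr times_divide_eq_right add_divide_distrib[symmetric]
      by (intro arg_cong[of _ _ "\<lambda>v. v / \<omega>"]) (simp add: algebra_simps)
    define q where "q = 1 - r\<^sup>2"
    have "(- 2 * r\<^sup>2 * (p * D) + q * h * p * q) / \<omega> = (q * (p * D) / \<omega>) * (h * q / D - 2 * r\<^sup>2 / q)"
      using Dpos r2 omega_pos unfolding q_def[symmetric] by (simp add: field_simps)
    then show ?thesis unfolding 1 unfolding gr q_def .
  qed
  finally show ?thesis by (simp add: gp)
qed

text \<open>Adding \<open>b\<close> to \<open>k + h\<close> adds \<open>b\<close> to the bracket of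
  \<open>poisson_radial_derivative\<close>. As D \<ge> (1 - r)^2 and 1 - r^2 \<ge> 1 - r, the
  bracket is of order 1 / (1 - r). Keeping the positive Poisson kernel as a factor makes the later
  L^1 bound immediate.\<close>

lemma zonal_linear_bound:
  assumes r: "0 < r" "r < 1" and x: "norm x = 1" and z: "norm z = 1" and b: "0 \<le> b"
  defines "h \<equiv> real DIM('a) / 2"
  shows "norm (zonal (\<lambda>k. real k + (h + b)) r x z) \<le> ((2 * h + 2 + b) / (1 - r)) * poisson (r *\<^sub>R x) z"
proof -
  let ?P = "poisson (r *\<^sub>R x) z"
  define D where "D = (r *\<^sub>R x - z) \<bullet> (r *\<^sub>R x - z)"
  have h: "h > 0" by (simp add: h_def)
  have P: "?P > 0" using r x by (intro poisson_pos z) simp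
  have r01: "0 \<le> r" using r by simp
  have s1: "(\<lambda>k. (real k + h) * (\<Sum>j=1..d k. Y k j x * Y k j z) * r ^ k) sums Re (zonal (\<lambda>k. real k + h) r x z)"
    by (intro zonal_real(1) subexponential_linear h r01 r x z)
  have s2: "(\<lambda>k. 1 * (\<Sum>j=1..d k. Y k j x * Y k j z) * r ^ k) sums Re (zonal (\<lambda>k. 1) r x z)"
    by (intro zonal_real(1) subexponential_const r01 r x z)
  have s3: "(\<lambda>k. (real k + (h + b)) * (\<Sum>j=1..d k. Y k j x * Y k j z) * r ^ k) sums Re (zonal (\<lambda>k. real k + (h + b)) r x z)"
    using h b by (intro zonal_real(1) subexponential_linear r01 r x z) auto
  have "(\<lambda>k. (real k + (h + b)) * (\<Sum>j=1..d k. Y k j x * Y k j z) * r ^ k) sums 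
     (Re (zonal (\<lambda>k. real k + h) r x z) + b * Re (zonal (\<lambda>k. 1) r x z))"
    using sums_add[OF s1 sums_mult[OF s2, of b]] by (simp add: algebra_simps)
  then have e: "Re (zonal (\<lambda>k. real k + (h + b)) r x z) = ?P * (h * (1 - r\<^sup>2) / D - 2 * r\<^sup>2 / (1 - r\<^sup>2)) + b * ?P"
    using s3 sums_unique2 poisson_radial_derivative[OF r x z] zonal_one[OF r01 r(2) x z]
    unfolding h_def D_def by fastforce
  have r2: "1 - r\<^sup>2 > 0" using r by (simp add: power_less_one_iff)
  have "\<bar>h * (1 - r\<^sup>2) / D - 2 * r\<^sup>2 / (1 - r\<^sup>2) + b\<bar> \<le> (2 * h + 2 + b) / (1 - r)"
  proof -
    have "norm z - norm (r *\<^sub>R x) \<le> norm (r *\<^sub>R x - z)" by (metis norm_minus_commute norm_triangle_ineq2)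
    then have "1 - r \<le> norm (r *\<^sub>R x - z)" using x z r by simp
    then have D: "(1 - r)\<^sup>2 \<le> D" unfolding D_def dot_square_norm using r by (intro power_mono) auto
    have "h * (1 - r\<^sup>2) / D \<le> h * (1 - r\<^sup>2) / (1 - r)\<^sup>2"
      using D r h r2 by (intro divide_left_mono mult_pos_pos) (auto intro: less_le_trans[of 0 "(1 - r)\<^sup>2"])
    also have "\<dots> = h * (1 + r) / (1 - r)"
    proof -
      have "1 - r\<^sup>2 = (1 - r) * (1 + r)" by (simp add: power2_eq_square algebra_simps)
      moreover have "h * (q * w) / q\<^sup>2 = h * w / q" if "q \<noteq> 0" for q w :: real
        using that by (simp add: power2_eq_square)
      ultimately show ?thesis using r by simp
    qed
    also have "\<dots> \<le> 2 * h / (1 - r)" using r h by (intro divide_right_mono) auto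
    finally have 1: "h * (1 - r\<^sup>2) / D \<le> 2 * h / (1 - r)" .
    have "1 - r \<le> 1 - r\<^sup>2" using r by (simp add: power2_eq_square mult_left_le)
    then have 2: "2 * r\<^sup>2 / (1 - r\<^sup>2) \<le> 2 / (1 - r)" using r r2 by (intro frac_le) (auto simp: power_le_one)
    have 3: "b \<le> b / (1 - r)" using b r by (simp add: field_simps mult_left_le)
    have "0 \<le> D" unfolding D_def by simp
    then have 4: "0 \<le> h * (1 - r\<^sup>2) / D" using h r2 by simp
    have 5: "0 \<le> 2 * r\<^sup>2 / (1 - r\<^sup>2)" using r2 by simp
    have "(2 * h + 2 + b) / (1 - r) = 2 * h / (1 - r) + 2 / (1 - r) + b / (1 - r)" by (simp add: add_divide_distrib)
    moreover have "0 \<le> 2 / (1 - r)" "0 \<le> 2 * h / (1 - r)" using r h by auto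
    ultimately show ?thesis using 1 2 3 4 5 b unfolding abs_le_iff by linarith
  qed
  then have "\<bar>Re (zonal (\<lambda>k. real k + (h + b)) r x z)\<bar> \<le> ?P * ((2 * h + 2 + b) / (1 - r))"
    unfolding e using P by (simp add: distrib_left[symmetric] mult.commute[of b] abs_mult mult_left_mono del: times_divide_eq_right)
  moreover have "norm (zonal (\<lambda>k. real k + (h + b)) r x z) = \<bar>Re (zonal (\<lambda>k. real k + (h + b)) r x z)\<bar>"
    using h b by (subst zonal_real(2)[OF subexponential_linear r01 r(2) x z]) (auto simp only: norm_of_real)
  ultimately show ?thesis by (simp only: mult.commute)
qed

lemma poisson_symmetric:
  assumes "norm x = 1" "norm z = 1"
  shows "poisson (r *\<^sub>R x) z = poisson (r *\<^sub>R z) x"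
proof -
  have 1: "x \<bullet> x = 1" "z \<bullet> z = 1" using assms by (simp_all add: dot_square_norm)
  then have "(r *\<^sub>R x - z) \<bullet> (r *\<^sub>R x - z) = (r *\<^sub>R z - x) \<bullet> (r *\<^sub>R z - x)"
    by (simp add: inner_diff inner_commute)
  then show ?thesis using 1 by (simp add: poisson_def)
qed

definition zonal_L1 :: "(nat \<Rightarrow> real) \<Rightarrow> real \<Rightarrow> 'a \<Rightarrow> ennreal" where
  "zonal_L1 A r z = (\<integral>\<^sup>+x. ennreal (norm (zonal A r x z)) \<partial>\<sigma>)"

lemma zonal_L1_linear:
  assumes r: "0 < r" "r < 1" and z: "norm z = 1" and b: "0 \<le> b"
  shows "zonal_L1 (\<lambda>k. real k + (real DIM('a) / 2 + b)) r z \<le> ennreal ((2 * (real DIM('a) / 2) + 2 + b) / (1 - r))"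
proof -
  let ?C = "(2 * (real DIM('a) / 2) + 2 + b) / (1 - r)"
  have zb: "r *\<^sub>R z \<in> ball 0 1" using r z by simp
  have ip: "integrable \<sigma> (\<lambda>x. ?C * poisson (r *\<^sub>R z) x)"
    by (intro integrable_sigma_continuous continuous_intros poisson_continuous[OF zb])
  have "zonal_L1 (\<lambda>k. real k + (real DIM('a) / 2 + b)) r z \<le> (\<integral>\<^sup>+x. ennreal (?C * poisson (r *\<^sub>R z) x) \<partial>\<sigma>)"
    unfolding zonal_L1_def
    by (intro nn_integral_mono ennreal_leI) (use zonal_linear_bound[OF r _ z b] poisson_symmetric[OF _ z] in auto)
  also have "\<dots> = ennreal (LINT x|\<sigma>. ?C * poisson (r *\<^sub>R z) x)"
  proof (rule nn_integral_eq_integral[OF ip])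
    show "AE x in \<sigma>. 0 \<le> ?C * poisson (r *\<^sub>R z) x"
      using poisson_pos[OF zb] r b by (intro AE_I2) (auto intro!: mult_nonneg_nonneg divide_nonneg_pos less_imp_le)
  qed
  also have "(LINT x|\<sigma>. ?C * poisson (r *\<^sub>R z) x) = ?C" using integral_poisson[OF zb] by simp
  finally show ?thesis .
qed

text \<open>By orthonormality, integrating against one kernel reads off the coefficients of the
  other, so both coefficients and radii multiply. A product of factors in k can thus be estimated
  one factor at a time, at the price of splitting the radius.\<close>

lemma zonal_compose:
  assumes A: "subexponential A" and B: "subexponential B" and r: "0 \<le> r" "r < 1" and s: "0 \<le> s" "s < 1"
    and x: "norm x = 1" and z: "norm z = 1"
  shows "zonal (\<lambda>k. A k * B k) (r * s) x z = (LINT \<xi>|\<sigma>. zonal A r x \<xi> * zonal B s \<xi> z)"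
proof -
  let ?M = "\<lambda>k. \<bar>A k * ymax k\<bar> * r ^ k"
  let ?a = "\<lambda>\<xi> k j. zonal B s \<xi> z * (of_real (r ^ k) * (of_real (A k) * complex_of_real (Y k j \<xi>)))"
  have Bc: "continuous_on (sphere 0 1) (\<lambda>\<xi>. zonal B s \<xi> z)"
    unfolding zonal_def
    by (rule sphere_series_continuous[where c="\<lambda>k j. of_real (s ^ k) * (of_real (B k) * of_real (Y k j z))", 
        OF zonal_coeff_bound[where A=B, OF s(1) z] zonal_summable[OF B s]])
  have "(LINT \<xi>|\<sigma>. zonal A r x \<xi> * zonal B s \<xi> z) = (LINT \<xi>|\<sigma>. sphere_series (?a \<xi>) x)"
  proof (intro Bochner_Integration.integral_cong refl)
    fix \<xi> assume "\<xi> \<in> space \<sigma>"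
    then have \<xi>: "norm \<xi> = 1" by simp
    have "sphere_series (?a \<xi>) x = zonal B s \<xi> z * sphere_series (\<lambda>k j. of_real (r ^ k) * (of_real (A k) * complex_of_real (Y k j \<xi>))) x"
      by (rule sphere_series_mult[where c="\<lambda>k j. of_real (r ^ k) * (of_real (A k) * complex_of_real (Y k j \<xi>))", 
            OF zonal_coeff_bound[where A=A, OF r(1) \<xi>] zonal_summable[OF A r] x])
    then show "zonal A r x \<xi> * zonal B s \<xi> z = sphere_series (?a \<xi>) x"
      unfolding zonal_def[of A] by simp
  qed
  also have "\<dots> = sphere_series (\<lambda>k j. LINT \<xi>|\<sigma>. ?a \<xi> k j) x"
  proof (rule sphere_series_integral(2)[symmetric, OF _ _ _ zonal_summable[OF A r] _ x])
    show "(\<lambda>\<xi>. ?a \<xi> k j) \<in> borel_measurable \<sigma>" if "j \<in> {1..d k}" for k j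
      by (intro measurable_sigma_continuous continuous_intros Bc Y_continuous that)
    show "norm (?a \<xi> k j) \<le> ?M k * norm (zonal B s \<xi> z)" if "j \<in> {1..d k}" "\<xi> \<in> space \<sigma>" for k j \<xi>
      using zonal_coeff_bound[OF r(1) _ that(1), of \<xi> A] that(2)
      unfolding norm_mult[of "zonal B s \<xi> z"] by (subst mult.commute) (auto intro!: mult_right_mono)
    show "integrable \<sigma> (\<lambda>\<xi>. norm (zonal B s \<xi> z))" by (intro integrable_norm integrable_sigma_continuous Bc)
  qed (use r in auto)
  also have "\<dots> = zonal (\<lambda>k. A k * B k) (r * s) x z"
    unfolding zonal_def[of "\<lambda>k. A k * B k"]
  proof (rule sphere_series_cong)
    fix k j assume j: "j \<in> {1..d k}"
    have "(LINT \<xi>|\<sigma>. ?a \<xi> k j) = (LINT \<xi>|\<sigma>. (of_real (r ^ k) * of_real (A k)) * (zonal B s \<xi> z * complex_of_real (Y k j \<xi>)))"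
      by (intro Bochner_Integration.integral_cong refl) (simp only: mult_ac)
    also have "\<dots> = (of_real (r ^ k) * of_real (A k)) * (LINT \<xi>|\<sigma>. zonal B s \<xi> z * complex_of_real (Y k j \<xi>))"
      by (rule integral_mult_right_zero)
    also have "(LINT \<xi>|\<sigma>. zonal B s \<xi> z * complex_of_real (Y k j \<xi>)) = of_real (s ^ k) * (of_real (B k) * of_real (Y k j z))"
      unfolding zonal_def
      by (rule sphere_series_coeff[where c="\<lambda>k j. of_real (s ^ k) * (of_real (B k) * of_real (Y k j z))", 
        OF zonal_coeff_bound[where A=B, OF s(1) z] zonal_summable[OF B s] j])
    finally show "(LINT \<xi>|\<sigma>. ?a \<xi> k j) = of_real ((r * s) ^ k) * (of_real (A k * B k) * of_real (Y k j z))"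
      by (simp add: power_mult_distrib mult_ac)
  qed
  finally show ?thesis by simp
qed

text \<open>Young's inequality for the convolution of two L^1 kernels; after the exchange of
  integrals the norm of the first kernel has to be bounded uniformly in its pole
  \<open>\<xi>\<close>.\<close>

lemma zonal_L1_compose:
  assumes A: "subexponential A" and B: "subexponential B" and r: "0 \<le> r" "r < 1" and s: "0 \<le> s" "s < 1"
    and z: "norm z = 1" and a: "\<And>\<xi>. norm \<xi> = 1 \<Longrightarrow> zonal_L1 A r \<xi> \<le> a" 
  shows "zonal_L1 (\<lambda>k. A k * B k) (r * s) z \<le> a * zonal_L1 B s z"
proof -
  interpret pair_sigma_finite \<sigma> \<sigma> ..
  have [measurable]: "(\<lambda>\<xi>. zonal B s \<xi> z) \<in> borel_measurable \<sigma>" by (rule zonal_measurable[OF z])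
  have "zonal_L1 (\<lambda>k. A k * B k) (r * s) z \<le> (\<integral>\<^sup>+x. \<integral>\<^sup>+\<xi>. ennreal (norm (zonal A r x \<xi>)) * ennreal (norm (zonal B s \<xi> z)) \<partial>\<sigma> \<partial>\<sigma>)"
    unfolding zonal_L1_def
  proof (rule nn_integral_mono)
    fix x assume "x \<in> space \<sigma>"
    then have x: "norm x = 1" by simp
    have "ennreal (norm (zonal (\<lambda>k. A k * B k) (r * s) x z)) \<le> (\<integral>\<^sup>+\<xi>. ennreal (norm (zonal A r x \<xi> * zonal B s \<xi> z)) \<partial>\<sigma>)"
      unfolding zonal_compose[OF A B r s x z] by (rule norm_integral_le_nn_integral)
    then show "ennreal (norm (zonal (\<lambda>k. A k * B k) (r * s) x z)) \<le> (\<integral>\<^sup>+\<xi>. ennreal (norm (zonal A r x \<xi>)) * ennreal (norm (zonal B s \<xi> z)) \<partial>\<sigma>)"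
      by (simp add: norm_mult ennreal_mult)
  qed
  also have "\<dots> = (\<integral>\<^sup>+\<xi>. \<integral>\<^sup>+x. ennreal (norm (zonal A r x \<xi>)) * ennreal (norm (zonal B s \<xi> z)) \<partial>\<sigma> \<partial>\<sigma>)"
    by (rule Fubini'[symmetric]) measurable
  also have "\<dots> = (\<integral>\<^sup>+\<xi>. zonal_L1 A r \<xi> * ennreal (norm (zonal B s \<xi> z)) \<partial>\<sigma>)"
    unfolding zonal_L1_def by (intro nn_integral_cong nn_integral_multc) (auto intro!: measurable_compose[OF zonal_measurable])
  also have "\<dots> \<le> (\<integral>\<^sup>+\<xi>. a * ennreal (norm (zonal B s \<xi> z)) \<partial>\<sigma>)"
    by (intro nn_integral_mono mult_right_mono a) auto
  also have "\<dots> = a * zonal_L1 B s z" unfolding zonal_L1_def by (intro nn_integral_cmult) measurable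
  finally show ?thesis .
qed

text \<open>Induction over the linear factors k + n/2 + i of the Pochhammer symbol. With r = s s,
  the last factor is taken at radius s by \<open>zonal_L1_linear\<close> and the others at radius s
  by the induction hypothesis. Each costs one power of 1 / (1 - s), and 1 - r \<le> 2 (1 - s) leads
  back to r.\<close>

lemma zonal_L1_pochhammer:
  "\<exists>C>0. \<forall>r z. 0 < r \<longrightarrow> r < 1 \<longrightarrow> norm z = 1 \<longrightarrow>
     zonal_L1 (\<lambda>k. pochhammer (real k + real DIM('a) / 2) (Suc N)) r z \<le> ennreal (C * (1 - r) powr (- real (Suc N)))"
proof (induction N)
  case 0
  show ?case
  proof (intro exI[of _ "real DIM('a) + 2"] conjI allI impI)
    fix r :: real and z :: 'a assume r: "0 < r" "r < 1" and z: "norm z = 1"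
    have "(\<lambda>k. pochhammer (real k + real DIM('a) / 2) (Suc 0)) = (\<lambda>k. real k + (real DIM('a) / 2 + 0))"
      by simp
    moreover have "(real DIM('a) + 2) * (1 - r) powr - real (Suc 0) = (2 * (real DIM('a) / 2) + 2 + 0) / (1 - r)"
      using r by (simp add: powr_minus_divide)
    ultimately show "zonal_L1 (\<lambda>k. pochhammer (real k + real DIM('a) / 2) (Suc 0)) r z \<le> ennreal ((real DIM('a) + 2) * (1 - r) powr - real (Suc 0))"
      using zonal_L1_linear[OF r z order_refl] by (simp only:)
  qed simp
next
  case (Suc N)
  let ?h = "real DIM('a) / 2"
  let ?A = "\<lambda>k. real k + (?h + real (Suc N))" and ?B = "\<lambda>k. pochhammer (real k + ?h) (Suc N)"
  from Suc obtain C where C0: "C > 0" and C1: "\<forall>r z. 0 < r \<longrightarrow> r < 1 \<longrightarrow> norm z = 1 \<longrightarrow>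
     zonal_L1 ?B r z \<le> ennreal (C * (1 - r) powr (- real (Suc N)))"
    by (elim exE conjE)
  note C = C0 C1[rule_format]
  define E where "E = (2 * ?h + 2 + real (Suc N)) * C * 2 powr (real (Suc (Suc N)))"
  show ?case
  proof (intro exI[of _ E] conjI allI impI)
    show "E > 0" using C(1) by (simp add: E_def)
    fix r :: real and z :: 'a assume r: "0 < r" "r < 1" and z: "norm z = 1"
    define s where "s = sqrt r"
    have s: "0 < s" "s < 1" "r = s * s" using r by (auto simp: s_def)
    have "zonal_L1 (\<lambda>k. ?A k * ?B k) (s * s) z \<le> ennreal ((2 * ?h + 2 + real (Suc N)) / (1 - s)) * zonal_L1 ?B s z"
    proof (rule zonal_L1_compose[where A="?A" and B="?B"])
      show "subexponential ?A" by (rule subexponential_linear) (simp add: add_pos_pos)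
      show "subexponential ?B" by (rule subexponential_pochhammer) simp
      show "zonal_L1 ?A s \<xi> \<le> ennreal ((2 * ?h + 2 + real (Suc N)) / (1 - s))" if "norm \<xi> = 1" for \<xi>
        by (rule zonal_L1_linear) (use s that in auto)
    qed (use s z in auto)
    also have "\<dots> \<le> ennreal ((2 * ?h + 2 + real (Suc N)) / (1 - s)) * ennreal (C * (1 - s) powr (- real (Suc N)))"
      by (intro mult_left_mono C s z) auto
    also have "\<dots> = ennreal ((2 * ?h + 2 + real (Suc N)) * C * ((1 - s) powr (- 1) * (1 - s) powr (- real (Suc N))))"
    proof -
      have "(2 * ?h + 2 + real (Suc N)) / (1 - s) * (C * (1 - s) powr (- real (Suc N))) = 
        (2 * ?h + 2 + real (Suc N)) * C * ((1 - s) powr (- 1) * (1 - s) powr (- real (Suc N)))"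
        using s by (simp add: powr_minus_divide)
      then show ?thesis using s C(1) by (subst ennreal_mult[symmetric]) auto
    qed
    also have "\<dots> = ennreal ((2 * ?h + 2 + real (Suc N)) * C * (1 - s) powr (- real (Suc (Suc N))))"
    proof -
      have "- 1 + - real (Suc N) = - real (Suc (Suc N))" by simp
      then show ?thesis unfolding powr_add[symmetric] by (simp only:)
    qed
    also have "\<dots> \<le> ennreal (E * (1 - r) powr (- real (Suc (Suc N))))"
    proof (rule ennreal_leI)
      have "(1 - r) / 2 \<le> 1 - s"
      proof -
        have "1 - r = (1 - s) * (1 + s)" using s by (simp add: algebra_simps)
        also have "\<dots> \<le> (1 - s) * 2" using s by (intro mult_left_mono) auto
        finally show ?thesis by simp
      qed
      then have "(1 - s) powr (- real (Suc (Suc N))) \<le> ((1 - r) / 2) powr (- real (Suc (Suc N)))"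
        using r by (intro powr_mono2') auto
      also have "\<dots> = 2 powr (real (Suc (Suc N))) * (1 - r) powr (- real (Suc (Suc N)))"
      proof -
        have half: "(q / 2) powr (- e) = 2 powr e * q powr (- e)" if "q > 0" for q e :: real
          using that by (simp add: powr_divide powr_minus_divide)
        show ?thesis by (rule half) (use r in simp)
      qed
      finally have "(2 * ?h + 2 + real (Suc N)) * C * (1 - s) powr (- real (Suc (Suc N))) \<le> (2 * ?h + 2 + real (Suc N)) * C * (2 powr (real (Suc (Suc N))) * (1 - r) powr (- real (Suc (Suc N))))"
        using C(1) by (intro mult_left_mono) auto
      then show "(2 * ?h + 2 + real (Suc N)) * C * (1 - s) powr (- real (Suc (Suc N))) \<le> E * (1 - r) powr (- real (Suc (Suc N)))"
        by (simp add: E_def mult.assoc)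
    qed
    finally have "zonal_L1 (\<lambda>k. ?A k * ?B k) r z \<le> ennreal (E * (1 - r) powr (- real (Suc (Suc N))))" using s(3) by simp
    moreover have "?A k * ?B k = pochhammer (real k + ?h) (Suc (Suc N))" for k
      by (subst (2) pochhammer_Suc) (simp add: mult.commute add.assoc)
    ultimately show "zonal_L1 (\<lambda>k. pochhammer (real k + ?h) (Suc (Suc N))) r z \<le> ennreal (E * (1 - r) powr (- real (Suc (Suc N))))"
      by simp
  qed
qed

end

section \<open>Norms on the sphere\<close>

text \<open>The graph of the q-th power lies above its tangent at \<open>y\<close>. This form also
  covers q = 1, where no finite conjugate exponent exists.\<close>

lemma Youngs_tangent:
  fixes u y q :: real
  assumes "q \<ge> 1" "u \<ge> 0" "y > 0"
  shows "q * y powr (q - 1) * u \<le> u powr q + (q - 1) * y powr q"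
proof (cases "q = 1")
  case True
  then show ?thesis using assms by simp
next
  case False
  then have q: "q > 1" using assms by simp
  define q' where "q' = q / (q - 1)"
  have q': "q' > 1" "1 / q + 1 / q' = 1" using q by (auto simp: q'_def field_simps)
  have "u * y powr (q - 1) \<le> u powr q / q + (y powr (q - 1)) powr q' / q'"
    by (rule Youngs_inequality[OF q q']) (use assms in auto)
  also have "(y powr (q - 1)) powr q' = y powr q" using q by (simp add: powr_powr q'_def)
  finally have "u * y powr (q - 1) \<le> u powr q / q + y powr q / q'" .
  then have "q * (u * y powr (q - 1)) \<le> q * (u powr q / q + y powr q / q')" using q by (intro mult_left_mono) auto
  also have "\<dots> = u powr q + (q - 1) * y powr q" using q by (simp add: q'_def distrib_left)
  finally show ?thesis by (simp add: mult_ac)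
qed

context sphere_basis
begin

lemma sphere_norm_infinity: "sphere_norm \<sigma> \<infinity> u = (SUP x\<in>sphere 0 1. ennreal (cmod (u x)))"
  by (simp add: sphere_norm_def)

lemma enn2real_ge_1:
  assumes "1 \<le> p" "p \<noteq> (\<infinity> :: ennreal)"
  shows "1 \<le> enn2real p"
  using assms enn2real_mono[of 1 p] by (simp add: less_top)

text \<open>Trades the p-th root for a bound on the integral; as \<open>A\<close> is a real number,
  an infinite integral makes both sides false.\<close>

lemma sphere_norm_le_iff:
  assumes p: "1 \<le> p" "p \<noteq> \<infinity>" and A: "A \<ge> 0"
  shows "sphere_norm \<sigma> p u \<le> ennreal A \<longleftrightarrow> (\<integral>\<^sup>+x. ennreal (cmod (u x) powr enn2real p) \<partial>\<sigma>) \<le> ennreal (A powr enn2real p)"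
proof -
  let ?q = "enn2real p" and ?I = "\<integral>\<^sup>+x. ennreal (cmod (u x) powr enn2real p) \<partial>\<sigma>"
  have q: "?q \<ge> 1" by (rule enn2real_ge_1[OF p])
  show ?thesis
  proof (cases "?I = \<infinity>")
    case True
    then show ?thesis using p by (simp add: sphere_norm_def Let_def top_unique)
  next
    case False
    then obtain i where i: "i \<ge> 0" "?I = ennreal i" by (cases ?I) auto
    have "sphere_norm \<sigma> p u = ennreal (i powr (1 / ?q))"
      using p i by (simp add: sphere_norm_def Let_def)
    moreover have "i powr (1 / ?q) \<le> A \<longleftrightarrow> i \<le> A powr ?q"
    proof
      assume "i powr (1 / ?q) \<le> A"
      then have "(i powr (1 / ?q)) powr ?q \<le> A powr ?q" using q by (intro powr_mono2) auto
      then show "i \<le> A powr ?q" using q i by (simp add: powr_powr)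
    next
      assume "i \<le> A powr ?q"
      then have "i powr (1 / ?q) \<le> (A powr ?q) powr (1 / ?q)" using q i by (intro powr_mono2) auto
      then show "i powr (1 / ?q) \<le> A" using q A by (simp add: powr_powr)
    qed
    ultimately show ?thesis using i A by (simp add: ennreal_le_iff)
  qed
qed

lemma sphere_norm_le_infinity_iff:
  assumes "A \<ge> 0"
  shows "sphere_norm \<sigma> \<infinity> u \<le> ennreal A \<longleftrightarrow> (\<forall>x. norm x = 1 \<longrightarrow> cmod (u x) \<le> A)"
  using assms unfolding sphere_norm_infinity SUP_le_iff by (auto simp: ennreal_le_iff)

lemma sphere_norm_mono:
  assumes "\<And>x. norm x = 1 \<Longrightarrow> cmod (u x) \<le> cmod (v x)"
  shows "sphere_norm \<sigma> p u \<le> sphere_norm \<sigma> p v"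
proof (cases "p = \<infinity>")
  case True
  show ?thesis unfolding True sphere_norm_infinity by (intro SUP_mono) (use assms in \<open>auto intro!: bexI ennreal_leI\<close>)
next
  case False
  let ?I = "\<lambda>u. \<integral>\<^sup>+x. ennreal (cmod (u x) powr enn2real p) \<partial>\<sigma>"
  have le: "?I u \<le> ?I v" using assms by (intro nn_integral_mono ennreal_leI powr_mono2) auto
  show ?thesis
  proof (cases "?I v = \<infinity>")
    case True
    then show ?thesis using False by (simp add: sphere_norm_def Let_def)
  next
    case F: False
    then have "enn2real (?I u) \<le> enn2real (?I v)" using le by (intro enn2real_mono) (auto simp: less_top)
    moreover have "?I u \<noteq> \<infinity>" using F le by (auto simp: top_unique)
    ultimately show ?thesis using False F
      by (simp add: sphere_norm_def Let_def) (intro ennreal_leI powr_mono2; simp)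
  qed
qed

lemma sphere_norm_cong:
  assumes "\<And>x. norm x = 1 \<Longrightarrow> u x = v x"
  shows "sphere_norm \<sigma> p u = sphere_norm \<sigma> p v"
  using assms by (intro antisym sphere_norm_mono) auto

lemma sphere_norm_bounded:
  assumes p: "1 \<le> p" and u: "\<And>x. norm x = 1 \<Longrightarrow> cmod (u x) \<le> B"
  shows "sphere_norm \<sigma> p u < \<infinity>"
proof -
  have B: "B \<ge> 0" using u vector_choose_size[of 1] by (metis norm_ge_zero order_trans zero_le_one)
  show ?thesis
  proof (cases "p = \<infinity>")
    case True
    then have "sphere_norm \<sigma> p u \<le> ennreal B" using u sphere_norm_le_infinity_iff[OF B] by simp
    then show ?thesis using ennreal_less_top le_less_trans by (metis infinity_ennreal_def)
  next
    case False
    have "(\<integral>\<^sup>+x. ennreal (cmod (u x) powr enn2real p) \<partial>\<sigma>) \<le> (\<integral>\<^sup>+x. ennreal (B powr enn2real p) \<partial>\<sigma>)"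
      using u by (intro nn_integral_mono ennreal_leI powr_mono2) auto
    also have "\<dots> < \<infinity>" by (simp add: emeasure_eq_measure ennreal_mult_less_top)
    finally show ?thesis using False by (simp add: sphere_norm_def Let_def)
  qed
qed

text \<open>For finite exponents \<open>q\<close> and fixed \<open>x\<close>, Young's inequality with
  weight \<open>\<lambda> * A w\<close> is integrated over \<open>w\<close>; the choice \<open>\<lambda> = norm (h x) / \<integral>A\<close> yields Jensen's inequality
  \<open>norm (h x) ^ q \<le> (\<integral>A) ^ (q - 1) * \<integral>A ^ (1 - q) norm (u w x) ^ q\<close>.\<close>

lemma sphere_norm_integral_le:
  assumes p: "1 \<le> p" and \<nu>: "sigma_finite_measure \<nu>"
    and u[measurable]: "(\<lambda>(w, x). u w x) \<in> borel_measurable (\<nu> \<Otimes>\<^sub>M \<sigma>)"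
    and A[measurable]: "A \<in> borel_measurable \<nu>" and A0: "\<And>w. w \<in> space \<nu> \<Longrightarrow> 0 < A w"
    and uA: "\<And>w. w \<in> space \<nu> \<Longrightarrow> sphere_norm \<sigma> p (u w) \<le> ennreal (A w)"
    and h: "\<And>x. norm x = 1 \<Longrightarrow> ennreal (cmod (h x)) \<le> (\<integral>\<^sup>+w. ennreal (cmod (u w x)) \<partial>\<nu>)"
  shows "sphere_norm \<sigma> p h \<le> (\<integral>\<^sup>+w. ennreal (A w) \<partial>\<nu>)"
proof (cases "(\<integral>\<^sup>+w. ennreal (A w) \<partial>\<nu>) = \<infinity>")
  case True
  then show ?thesis by simp
next
  case False
  interpret \<nu>: sigma_finite_measure \<nu> by fact
  interpret pair_sigma_finite \<nu> \<sigma> ..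
  obtain b where b: "b \<ge> 0" "(\<integral>\<^sup>+w. ennreal (A w) \<partial>\<nu>) = ennreal b" using False by (cases "\<integral>\<^sup>+w. ennreal (A w) \<partial>\<nu>") auto
  show ?thesis
  proof (cases "p = \<infinity>")
    case True
    have "cmod (h x) \<le> b" if x: "norm x = 1" for x
    proof -
      have "ennreal (cmod (h x)) \<le> (\<integral>\<^sup>+w. ennreal (A w) \<partial>\<nu>)"
      proof (rule order_trans[OF h[OF x] nn_integral_mono])
        fix w assume w: "w \<in> space \<nu>"
        then show "ennreal (cmod (u w x)) \<le> ennreal (A w)"
          using uA[OF w] A0[OF w] x sphere_norm_le_infinity_iff[of "A w" "u w"] True by (auto intro!: ennreal_leI)
      qed
      then show ?thesis using b by simp
    qed
    then show ?thesis unfolding b(2) True using sphere_norm_le_infinity_iff[OF b(1)] by blast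
  next
    case p': False
    define q where "q = enn2real p"
    have q: "q \<ge> 1" unfolding q_def by (rule enn2real_ge_1[OF p p'])
    \<comment> \<open>The weight A^(1-q) is chosen so that integrating the q-th powers over the
      sphere returns at most A^(1-q) A^q = A.\<close>
    define J where "J x = (\<integral>\<^sup>+w. ennreal (A w powr (1 - q)) * ennreal (cmod (u w x) powr q) \<partial>\<nu>)" for x
    have um: "(\<lambda>w. u w x) \<in> borel_measurable \<nu>" if "norm x = 1" for x
      using measurable_compose[OF measurable_Pair2'[of x \<sigma> \<nu>] u] that by simp
    have jensen: "ennreal (cmod (h x) powr q) \<le> ennreal (b powr (q - 1)) * J x" if x: "norm x = 1" for x
    proof (cases "h x = 0")
      case True
      then show ?thesis using q by simp
    next
      case False
      define v where "v = cmod (h x)"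
      have v: "v > 0" using False by (simp add: v_def)
      note [measurable] = um[OF x]
      \<comment> \<open>\<open>A\<close> is strictly positive, so b = 0 would make
        \<open>\<nu>\<close> the null measure and force h x = 0.\<close>
      have b0: "b > 0"
      proof (rule ccontr)
        assume "\<not> b > 0"
        then have "(\<integral>\<^sup>+w. ennreal (A w) \<partial>\<nu>) = 0" using b by simp
        then have "AE w in \<nu>. ennreal (A w) = 0" by (subst (asm) nn_integral_0_iff_AE) auto
        then have "AE w in \<nu>. False" using AE_space
        proof eventually_elim
          case (elim w)
          then show False using A0[of w] by (simp add: ennreal_eq_0_iff)
        qed
        then have "AE w in \<nu>. ennreal (cmod (u w x)) = 0" by eventually_elim simp
        then have "(\<integral>\<^sup>+w. ennreal (cmod (u w x)) \<partial>\<nu>) = 0" by (subst nn_integral_0_iff_AE) auto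
        then show False using h[OF x] False by simp
      qed
      define l where "l = v / b"
      have l: "l > 0" using v b0 by (simp add: l_def)
      have "ennreal (q * l powr (q - 1) * v) \<le> ennreal (q * l powr (q - 1)) * (\<integral>\<^sup>+w. ennreal (cmod (u w x)) \<partial>\<nu>)"
        using h[OF x] q l v by (subst ennreal_mult) (auto intro!: mult_left_mono simp: v_def)
      also have "\<dots> = (\<integral>\<^sup>+w. ennreal (q * l powr (q - 1)) * ennreal (cmod (u w x)) \<partial>\<nu>)"
        by (rule nn_integral_cmult[symmetric]) measurable
      also have "\<dots> \<le> (\<integral>\<^sup>+w. ennreal (A w powr (1 - q)) * ennreal (cmod (u w x) powr q) + ennreal ((q - 1) * l powr q) * ennreal (A w) \<partial>\<nu>)"
      proof (rule nn_integral_mono)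
        fix w assume w: "w \<in> space \<nu>"
        have a: "A w > 0" by (rule A0[OF w])
        have "q * (l * A w) powr (q - 1) * cmod (u w x) \<le> cmod (u w x) powr q + (q - 1) * (l * A w) powr q"
          by (rule Youngs_tangent) (use q l a in auto)
        then have "A w powr (1 - q) * (q * (l * A w) powr (q - 1) * cmod (u w x)) \<le> A w powr (1 - q) * (cmod (u w x) powr q + (q - 1) * (l * A w) powr q)"
          by (rule mult_left_mono) simp
        moreover have "A w powr (1 - q) * (q * (l * A w) powr (q - 1) * cmod (u w x)) = q * l powr (q - 1) * cmod (u w x)"
        proof -
          have "A w powr (1 - q) * A w powr (q - 1) = 1" using a by (simp flip: powr_add)
          then show ?thesis using l a by (simp add: powr_mult)
        qed
        moreover have "A w powr (1 - q) * (cmod (u w x) powr q + (q - 1) * (l * A w) powr q) = A w powr (1 - q) * cmod (u w x) powr q + (q - 1) * l powr q * A w"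
        proof -
          have "A w powr (1 - q) * A w powr q = A w" using a by (simp flip: powr_add)
          then have "A w powr (1 - q) * ((q - 1) * (l powr q * A w powr q)) = (q - 1) * l powr q * A w" by simp
          then show ?thesis using l a by (simp add: powr_mult distrib_left)
        qed
        ultimately have "q * l powr (q - 1) * cmod (u w x) \<le> A w powr (1 - q) * cmod (u w x) powr q + (q - 1) * l powr q * A w" by simp
        then have "ennreal (q * l powr (q - 1) * cmod (u w x)) \<le> ennreal (A w powr (1 - q) * cmod (u w x) powr q + (q - 1) * l powr q * A w)"
          by (rule ennreal_leI)
        then show "ennreal (q * l powr (q - 1)) * ennreal (cmod (u w x)) \<le> ennreal (A w powr (1 - q)) * ennreal (cmod (u w x) powr q) + ennreal ((q - 1) * l powr q) * ennreal (A w)"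
          using q l a by (simp add: ennreal_mult[symmetric] ennreal_plus[symmetric] del: ennreal_plus)
      qed
      also have "\<dots> = J x + ennreal ((q - 1) * l powr q) * ennreal b"
        unfolding J_def by (subst nn_integral_add) (auto simp: nn_integral_cmult b)
      finally have main: "ennreal (q * l powr (q - 1) * v) \<le> J x + ennreal ((q - 1) * l powr q * b)"
        using q l b0 by (simp add: ennreal_mult)
      show ?thesis
      proof (cases "J x = \<infinity>")
        case True
        then show ?thesis using b0 by (simp add: ennreal_mult_top)
      next
        case False
        then obtain j where j: "j \<ge> 0" "J x = ennreal j" by (cases "J x") auto
        have "q * l powr (q - 1) * v \<le> j + (q - 1) * l powr q * b"
          using main j q l b0 by (simp add: ennreal_plus[symmetric] del: ennreal_plus)
        moreover have "l powr q = l powr (q - 1) * l" using l powr_add[of l "q - 1" 1] by simp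
        moreover have "l * b = v" using b0 by (simp add: l_def)
        ultimately have "q * l powr (q - 1) * v \<le> j + (q - 1) * l powr (q - 1) * v" by (simp add: mult.assoc)
        then have "l powr (q - 1) * v \<le> j" by (simp add: algebra_simps)
        then have "b powr (q - 1) * (l powr (q - 1) * v) \<le> b powr (q - 1) * j" by (rule mult_left_mono) simp
        moreover have "b powr (q - 1) * (l powr (q - 1) * v) = v powr q"
        proof -
          have "b powr (q - 1) * l powr (q - 1) = (b * l) powr (q - 1)" using b0 l by (simp add: powr_mult)
          also have "b * l = v" using b0 by (simp add: l_def)
          finally have "b powr (q - 1) * (l powr (q - 1) * v) = v powr (q - 1) * v" by (simp add: mult.assoc[symmetric])
          then show ?thesis using v powr_add[of v "q - 1" 1] by simp
        qed
        ultimately have "v powr q \<le> b powr (q - 1) * j" by simp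
        then show ?thesis using j by (simp add: v_def ennreal_mult[symmetric] ennreal_leI)
      qed
    qed
    have "(\<integral>\<^sup>+x. ennreal (cmod (h x) powr q) \<partial>\<sigma>) \<le> (\<integral>\<^sup>+x. ennreal (b powr (q - 1)) * J x \<partial>\<sigma>)"
      by (intro nn_integral_mono jensen) simp
    also have "\<dots> = ennreal (b powr (q - 1)) * (\<integral>\<^sup>+x. J x \<partial>\<sigma>)"
      unfolding J_def by (rule nn_integral_cmult) measurable
    also have "(\<integral>\<^sup>+x. J x \<partial>\<sigma>) = (\<integral>\<^sup>+w. \<integral>\<^sup>+x. ennreal (A w powr (1 - q)) * ennreal (cmod (u w x) powr q) \<partial>\<sigma> \<partial>\<nu>)"
      unfolding J_def by (rule Fubini') measurable
    also have "\<dots> \<le> (\<integral>\<^sup>+w. ennreal (A w) \<partial>\<nu>)"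
    proof (rule nn_integral_mono)
      fix w assume w: "w \<in> space \<nu>"
      have [measurable]: "u w \<in> borel_measurable \<sigma>"
        using measurable_compose[OF measurable_Pair1'[OF w, of \<sigma>] u] by simp
      have "(\<integral>\<^sup>+x. ennreal (A w powr (1 - q)) * ennreal (cmod (u w x) powr q) \<partial>\<sigma>) = ennreal (A w powr (1 - q)) * (\<integral>\<^sup>+x. ennreal (cmod (u w x) powr q) \<partial>\<sigma>)"
        by (rule nn_integral_cmult) measurable
      also have "\<dots> \<le> ennreal (A w powr (1 - q)) * ennreal (A w powr q)"
        using uA[OF w] sphere_norm_le_iff[OF p p' less_imp_le[OF A0[OF w]], of "u w"] by (intro mult_left_mono) (auto simp: q_def)
      also have "\<dots> = ennreal (A w)" using A0[OF w] by (simp add: ennreal_mult[symmetric] powr_add[symmetric])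
      finally show "(\<integral>\<^sup>+x. ennreal (A w powr (1 - q)) * ennreal (cmod (u w x) powr q) \<partial>\<sigma>) \<le> ennreal (A w)" .
    qed
    finally have "(\<integral>\<^sup>+x. ennreal (cmod (h x) powr q) \<partial>\<sigma>) \<le> ennreal (b powr (q - 1)) * ennreal b"
      unfolding b by (simp add: mult_left_mono)
    also have "\<dots> = ennreal (b powr q)"
    proof (cases "b = 0")
      case False
      then show ?thesis using b powr_add[of b "q - 1" 1] by (simp add: ennreal_mult[symmetric])
    qed (use q in simp)
    finally show ?thesis unfolding b(2) using sphere_norm_le_iff[OF p p' b(1), of h] by (simp add: q_def)
  qed
qed

text \<open>Minkowski's inequality for two functions is the integral version over a counting measure
  with two points. Strictly positive bounds are assumed because the integral version asks for
  them.\<close>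

lemma sphere_norm_triangle_le:
  assumes p: "1 \<le> p" and [measurable]: "u \<in> borel_measurable \<sigma>" "v \<in> borel_measurable \<sigma>"
    and A: "A > 0" "sphere_norm \<sigma> p u \<le> ennreal A" and B: "B > 0" "sphere_norm \<sigma> p v \<le> ennreal B"
  shows "sphere_norm \<sigma> p (\<lambda>x. u x + v x) \<le> ennreal (A + B)"
proof -
  have "sphere_norm \<sigma> p (\<lambda>x. u x + v x) \<le> (\<integral>\<^sup>+w. ennreal (if w then A else B) \<partial>count_space (UNIV :: bool set))"
  proof (rule sphere_norm_integral_le[where u="\<lambda>w x. if w then u x else v x", OF p])
    show "sigma_finite_measure (count_space (UNIV :: bool set))" by (rule sigma_finite_measure_count_space)
    show "(\<lambda>(w, x). if w then u x else v x) \<in> borel_measurable (count_space UNIV \<Otimes>\<^sub>M \<sigma>)" by measurable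
    show "ennreal (cmod (u x + v x)) \<le> (\<integral>\<^sup>+w. ennreal (cmod (if w then u x else v x)) \<partial>count_space UNIV)" for x
      by (simp add: nn_integral_count_space_finite UNIV_bool ennreal_plus[symmetric] norm_triangle_ineq add.commute ennreal_leI del: ennreal_plus)
  qed (use A B in auto)
  then show ?thesis using A B by (simp add: nn_integral_count_space_finite UNIV_bool ennreal_plus[symmetric] add.commute del: ennreal_plus)
qed

lemma sphere_norm_scale_le:
  assumes p: "1 \<le> p" and [measurable]: "u \<in> borel_measurable \<sigma>" and c: "c > 0" and A: "A \<ge> 0" "sphere_norm \<sigma> p u \<le> ennreal A"
  shows "sphere_norm \<sigma> p (\<lambda>x. of_real c * u x) \<le> ennreal (c * A)"
proof (cases "p = \<infinity>")
  case True
  then show ?thesis using A c sphere_norm_le_infinity_iff[OF A(1), of u] 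
      sphere_norm_le_infinity_iff[of "c * A" "\<lambda>x. of_real c * u x"] by (auto simp: norm_mult intro!: mult_left_mono)
next
  case False
  let ?q = "enn2real p"
  have *: "cmod (of_real c * u x) powr ?q = c powr ?q * cmod (u x) powr ?q" for x
    using c by (simp add: norm_mult powr_mult)
  have "(\<integral>\<^sup>+x. ennreal (cmod (of_real c * u x) powr ?q) \<partial>\<sigma>) = (\<integral>\<^sup>+x. ennreal (c powr ?q) * ennreal (cmod (u x) powr ?q) \<partial>\<sigma>)"
    unfolding * by (simp add: ennreal_mult)
  also have "\<dots> = ennreal (c powr ?q) * (\<integral>\<^sup>+x. ennreal (cmod (u x) powr ?q) \<partial>\<sigma>)"
    by (rule nn_integral_cmult) measurable
  also have "\<dots> \<le> ennreal (c powr ?q) * ennreal (A powr ?q)"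
    using A sphere_norm_le_iff[OF p False A(1), of u] by (intro mult_left_mono) auto
  also have "\<dots> = ennreal ((c * A) powr ?q)" using c A(1) by (simp add: powr_mult ennreal_mult)
  finally show ?thesis using sphere_norm_le_iff[OF p False, of "c * A" "\<lambda>x. of_real c * u x"] c A(1) by simp
qed

end

text \<open>Turns a finite weighted supremum into a pointwise bound with a positive real constant, a
  form shared by \<open>H_space\<close> and \<open>N_p\<close>.\<close>

lemma SUP_weighted_finite_iff:
  fixes F :: "'i \<Rightarrow> ennreal" and w :: "'i \<Rightarrow> real"
  assumes w: "\<And>i. i \<in> I \<Longrightarrow> 0 < w i"
  shows "(SUP i\<in>I. F i * ennreal (w i)) < \<infinity> \<longleftrightarrow> (\<exists>N>0. \<forall>i\<in>I. F i \<le> ennreal (N / w i))"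
proof
  assume "(SUP i\<in>I. F i * ennreal (w i)) < \<infinity>"
  then obtain N where N: "N \<ge> 0" "(SUP i\<in>I. F i * ennreal (w i)) = ennreal N"
    by (cases "SUP i\<in>I. F i * ennreal (w i)") auto
  have "F i \<le> ennreal ((N + 1) / w i)" if i: "i \<in> I" for i
  proof -
    have "F i * ennreal (w i) \<le> ennreal N" unfolding N(2)[symmetric] using i by (rule SUP_upper)
    then have "F i * ennreal (w i) \<le> ennreal (N + 1)" using N(1) by (meson ennreal_leI le_add_same_cancel1 order_trans zero_le_one)
    then have "F i * ennreal (w i) * ennreal (1 / w i) \<le> ennreal (N + 1) * ennreal (1 / w i)" by (rule mult_right_mono) simp
    moreover have "ennreal (w i) * ennreal (1 / w i) = 1" using w[OF i] by (simp add: ennreal_mult[symmetric])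
    ultimately show ?thesis using N(1) w[OF i] by (simp add: mult.assoc ennreal_mult[symmetric] del: ennreal_plus)
  qed
  then show "\<exists>N>0. \<forall>i\<in>I. F i \<le> ennreal (N / w i)" using N(1) by (intro exI[of _ "N + 1"]) auto
next
  assume "\<exists>N>0. \<forall>i\<in>I. F i \<le> ennreal (N / w i)"
  then obtain N where N: "N > 0" "\<And>i. i \<in> I \<Longrightarrow> F i \<le> ennreal (N / w i)" by blast
  have "(SUP i\<in>I. F i * ennreal (w i)) \<le> ennreal N"
  proof (rule SUP_least)
    fix i assume i: "i \<in> I"
    have "F i * ennreal (w i) \<le> ennreal (N / w i) * ennreal (w i)" by (intro mult_right_mono N i) simp
    also have "\<dots> = ennreal N" using N(1) w[OF i] by (simp add: ennreal_mult[symmetric])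
    finally show "F i * ennreal (w i) \<le> ennreal N" .
  qed
  then show "(SUP i\<in>I. F i * ennreal (w i)) < \<infinity>" using ennreal_less_top le_less_trans by (metis infinity_ennreal_def)
qed

lemma SUP_pair_times:
  fixes f :: "'b \<times> 'c \<Rightarrow> 'a::complete_lattice"
  shows "(SUP p\<in>A \<times> B. f p) = (SUP x\<in>A. SUP y\<in>B. f (x, y))"
  by (rule antisym) (auto intro!: SUP_least intro: SUP_upper2 SUP_upper)

section \<open>Multipliers\<close>

text \<open>The dimension condition n \<ge> 2 enters as \<open>1 \<le> hd\<close>, by which the
  factor \<open>s powr (hd - 1)\<close> of the beta density is at most 1.\<close>

locale sphere_multiplier = sphere_basis \<sigma> \<kappa> Y d for \<sigma> :: "'a::euclidean_space measure" and \<kappa> Y d +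
  fixes hd :: real
  assumes hd_eq: "hd = real DIM('a) / 2" and hd_ge_1: "1 \<le> hd"
begin

lemma hd_pos: "0 < hd" using hd_ge_1 by simp

lemma zonal_cmult:
  assumes A: "subexponential A" and r: "0 \<le> r" "r < 1" and x: "norm x = 1" and z: "norm z = 1"
  shows "zonal (\<lambda>k. c * A k) r x z = of_real c * zonal A r x z"
proof -
  have "zonal (\<lambda>k. c * A k) r x z = sphere_series (\<lambda>k j. of_real c * (of_real (r ^ k) * (of_real (A k) * of_real (Y k j z)))) x"
    unfolding zonal_def by (rule sphere_series_cong) (simp add: mult_ac)
  also have "\<dots> = of_real c * sphere_series (\<lambda>k j. of_real (r ^ k) * (of_real (A k) * of_real (Y k j z))) x"
    by (rule sphere_series_mult[where c="\<lambda>k j. of_real (r ^ k) * (of_real (A k) * of_real (Y k j z))",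
        OF zonal_coeff_bound[where A=A, OF r(1) z] zonal_summable[OF A r] x])
  finally show ?thesis by (simp add: zonal_def)
qed

lemma zonal_L1_one:
  assumes r: "0 \<le> r" "r < 1" and z: "norm z = 1"
  shows "zonal_L1 (\<lambda>_. 1) r z = 1"
proof -
  have zb: "r *\<^sub>R z \<in> ball 0 1" using r z by simp
  have "zonal_L1 (\<lambda>_. 1) r z = (\<integral>\<^sup>+x. ennreal (poisson (r *\<^sub>R z) x) \<partial>\<sigma>)"
    unfolding zonal_L1_def
  proof (rule nn_integral_cong)
    fix x assume "x \<in> space \<sigma>"
    then have x: "norm x = 1" by simp
    show "ennreal (norm (zonal (\<lambda>_. 1) r x z)) = ennreal (poisson (r *\<^sub>R z) x)"
      unfolding zonal_one[OF r x z] poisson_symmetric[OF x z] using poisson_pos[OF zb x] by simp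
  qed
  also have "\<dots> = ennreal (LINT x|\<sigma>. poisson (r *\<^sub>R z) x)"
    by (intro nn_integral_eq_integral integrable_sigma_continuous poisson_continuous[OF zb] AE_I2)
       (use poisson_pos[OF zb] in \<open>auto intro: less_imp_le\<close>)
  finally show ?thesis using integral_poisson[OF zb] by simp
qed

text \<open>The beta moment in \<open>frac_factor_pochhammer\<close> is the integral of s^k, and r^k
  s^k belongs to the radius r s.\<close>

lemma zonal_frac_integral:
  assumes t: "t > 0" "t < real N" and r: "0 \<le> r" "r < 1" and x: "norm x = 1" and z: "norm z = 1"
  defines "A \<equiv> \<lambda>k. (1 / (Gamma (real N - t) * Gamma t)) * pochhammer (real k + hd) N"
  shows "zonal (frac_factor hd t) r x z = (LINT s|beta_measure (hd + t) (real N - t). zonal A (r * s) x z)"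
proof -
  let ?B = "beta_measure (hd + t) (real N - t)"
  have A: "subexponential A" unfolding A_def
    by (intro subexponential_mult subexponential_const subexponential_pochhammer hd_pos)
  have ab: "hd + t > 0" "real N - t > 0" using hd_pos t by auto
  interpret B: finite_measure ?B by (rule finite_beta_measure[OF ab])
  let ?a = "\<lambda>s k j. of_real ((r * s) ^ k) * (of_real (A k) * complex_of_real (Y k j z))"
  have "(LINT s|?B. zonal A (r * s) x z) = sphere_series (\<lambda>k j. LINT s|?B. ?a s k j) x"
    unfolding zonal_def
  proof (rule sphere_series_integral(2)[symmetric, where W="\<lambda>_. 1", OF _ _ _ zonal_summable[OF A r] _ x])
    show "(\<lambda>s. ?a s k j) \<in> borel_measurable ?B" for k j
      by (rule measurable_beta_measure) measurable
    show "norm (?a s k j) \<le> (\<bar>A k * ymax k\<bar> * r ^ k) * 1" if "j \<in> {1..d k}" "s \<in> space ?B" for k j s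
    proof -
      have s: "0 \<le> r * s" "r * s \<le> r" using that r by (auto intro!: mult_left_le)
      have "norm (?a s k j) \<le> \<bar>A k * ymax k\<bar> * (r * s) ^ k"
        by (rule zonal_coeff_bound[OF s(1) z that(1)])
      also have "\<dots> \<le> \<bar>A k * ymax k\<bar> * r ^ k" using s by (intro mult_left_mono power_mono) auto
      finally show ?thesis by simp
    qed
  qed (use r in auto)
  also have "\<dots> = zonal (frac_factor hd t) r x z"
    unfolding zonal_def
  proof (rule sphere_series_cong)
    fix k j
    have "(LINT s|?B. ?a s k j) = (LINT s|?B. (of_real (r ^ k) * (of_real (A k) * complex_of_real (Y k j z))) * complex_of_real (s ^ k))"
      by (intro Bochner_Integration.integral_cong refl) (simp add: power_mult_distrib)
    also have "\<dots> = (of_real (r ^ k) * (of_real (A k) * complex_of_real (Y k j z))) * complex_of_real (Beta (hd + t + real k) (real N - t))"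
      by (simp only: integral_mult_right_zero integral_complex_of_real integral_beta_measure_power[OF ab])
    also have "\<dots> = of_real (r ^ k) * (complex_of_real (A k * Beta (hd + t + real k) (real N - t)) * complex_of_real (Y k j z))"
      by simp
    also have "A k * Beta (hd + t + real k) (real N - t) = frac_factor hd t k"
      unfolding frac_factor_pochhammer[OF hd_pos t] A_def by simp
    finally show "(LINT s|?B. ?a s k j) = of_real (r ^ k) * (complex_of_real (frac_factor hd t k) * complex_of_real (Y k j z))" .
  qed
  finally show ?thesis by simp
qed

lemma beta_fst_measurable: "fst \<in> borel_measurable (beta_measure a b \<Otimes>\<^sub>M \<sigma>)"
  by (rule measurable_compose[OF measurable_fst measurable_beta_measure]) simp

lemma zonal_beta_measurable: 
  assumes z: "norm z = 1"
  shows "(\<lambda>(s, x). zonal A (r * s) x z) \<in> borel_measurable (beta_measure a b \<Otimes>\<^sub>M \<sigma>)"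
proof -
  note [measurable] = beta_fst_measurable[of a b]
  show ?thesis unfolding zonal_def sphere_series_def split_beta by measurable
qed

text \<open>With a = N - t the bound (1 - r s)^(-N) for integer order is averaged against (1 -
  s)^(a-1), which leaves (1 - r)^(-t). The remaining factor s^(n/2+t-1) of the beta density is at
  most 1.\<close>

lemma zonal_L1_frac:
  assumes t: "t > 0"
  shows "\<exists>C>0. \<forall>r z. 0 \<le> r \<longrightarrow> r < 1 \<longrightarrow> norm z = 1 \<longrightarrow>
     zonal_L1 (frac_factor hd t) r z \<le> ennreal (C * (1 - r) powr (- t))"
proof -
  obtain M where M: "t < real M" using reals_Archimedean2 by blast
  \<comment> \<open>\<open>zonal_L1_pochhammer\<close> is stated for the positive orders
    \<open>Suc M\<close>.\<close>
  define N where "N = Suc M"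
  have N: "t < real N" using M by (simp add: N_def)
  define a where "a = real N - t"
  have a: "a > 0" using N by (simp add: a_def)
  let ?B = "beta_measure (hd + t) a"
  have ab: "hd + t > 0" using hd_pos t by auto
  interpret B: finite_measure ?B by (rule finite_beta_measure[OF ab a])
  interpret pair_sigma_finite ?B \<sigma> ..
  define g where "g = 1 / (Gamma a * Gamma t)"
  have g: "g > 0" using a t by (auto simp: g_def intro!: divide_pos_pos mult_pos_pos Gamma_real_pos)
  let ?P = "\<lambda>k. pochhammer (real k + hd) N"
  have P: "subexponential ?P" by (rule subexponential_pochhammer[OF hd_pos])
  from zonal_L1_pochhammer[of M] obtain C where C0: "C > 0" and C1: "\<forall>r z. 0 < r \<longrightarrow> r < 1 \<longrightarrow> norm z = 1 \<longrightarrow>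
     zonal_L1 ?P r z \<le> ennreal (C * (1 - r) powr (- real N))"
    unfolding hd_eq[symmetric] N_def[symmetric] by (elim exE conjE)
  define E where "E = g * C * (1 / a + 1 / t)"
  have E: "E > 0" using g C0 a t by (simp add: E_def add_pos_pos)
  have main: "zonal_L1 (frac_factor hd t) r z \<le> ennreal (E * (1 - r) powr (- t))" if r: "0 < r" "r < 1" and z: "norm z = 1" for r z
  proof -
    have r0: "0 \<le> r" using r by simp
    note [measurable] = zonal_beta_measurable[OF z, of ?P r "hd + t" a]
    have "zonal_L1 (frac_factor hd t) r z \<le> (\<integral>\<^sup>+x. \<integral>\<^sup>+s. ennreal g * ennreal (norm (zonal ?P (r * s) x z)) \<partial>?B \<partial>\<sigma>)"
      unfolding zonal_L1_def
    proof (rule nn_integral_mono)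
      fix x assume "x \<in> space \<sigma>"
      then have x: "norm x = 1" by simp
      have "ennreal (norm (zonal (frac_factor hd t) r x z)) \<le> (\<integral>\<^sup>+s. ennreal (norm (zonal (\<lambda>k. g * ?P k) (r * s) x z)) \<partial>?B)"
        unfolding zonal_frac_integral[OF t N r0 r(2) x z] a_def[symmetric] g_def[symmetric] by (rule norm_integral_le_nn_integral)
      also have "\<dots> = (\<integral>\<^sup>+s. ennreal g * ennreal (norm (zonal ?P (r * s) x z)) \<partial>?B)"
      proof (rule nn_integral_cong)
        fix s assume "s \<in> space ?B"
        then have "0 \<le> r * s" "r * s < 1" using r by (auto intro: le_less_trans[OF mult_left_le])
        then show "ennreal (norm (zonal (\<lambda>k. g * ?P k) (r * s) x z)) = ennreal g * ennreal (norm (zonal ?P (r * s) x z))"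
          using zonal_cmult[OF P _ _ x z, of "r * s" g] g by (simp add: norm_mult ennreal_mult)
      qed
      finally show "ennreal (norm (zonal (frac_factor hd t) r x z)) \<le> (\<integral>\<^sup>+s. ennreal g * ennreal (norm (zonal ?P (r * s) x z)) \<partial>?B)" .
    qed
    also have "\<dots> = (\<integral>\<^sup>+s. \<integral>\<^sup>+x. ennreal g * ennreal (norm (zonal ?P (r * s) x z)) \<partial>\<sigma> \<partial>?B)"
      by (rule Fubini') measurable
    also have "\<dots> = (\<integral>\<^sup>+s. ennreal g * zonal_L1 ?P (r * s) z \<partial>?B)"
      unfolding zonal_L1_def
      by (intro nn_integral_cong nn_integral_cmult) (auto intro!: measurable_compose[OF zonal_measurable] z)
    also have "\<dots> \<le> (\<integral>\<^sup>+s. ennreal (g * C * (1 - r * s) powr (- (a + t))) \<partial>?B)"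
    proof (rule nn_integral_mono)
      fix s assume "s \<in> space ?B"
      then have rs: "0 < r * s" "r * s < 1" using r by (auto intro: le_less_trans[OF mult_left_le])
      have "ennreal g * zonal_L1 ?P (r * s) z \<le> ennreal g * ennreal (C * (1 - r * s) powr (- real N))"
        using C1 rs z by (intro mult_left_mono) auto
      then show "ennreal g * zonal_L1 ?P (r * s) z \<le> ennreal (g * C * (1 - r * s) powr (- (a + t)))"
        using g C0 by (simp add: ennreal_mult[symmetric] mult.assoc a_def)
    qed
    also have "\<dots> = (\<integral>\<^sup>+s. ennreal (s powr (hd + t - 1) * (1 - s) powr (a - 1)) * ennreal (g * C * (1 - r * s) powr (- (a + t))) * indicator {0<..<1} s \<partial>lborel)"
      by (rule nn_integral_beta_measure) measurable
    also have "\<dots> \<le> (\<integral>\<^sup>+s. ennreal (g * C) * (ennreal ((1 - s) powr (a - 1) * (1 - r * s) powr (- (a + t))) * indicator {0<..<1} s) \<partial>lborel)"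
    proof (rule nn_integral_mono)
      fix s :: real
      show "ennreal (s powr (hd + t - 1) * (1 - s) powr (a - 1)) * ennreal (g * C * (1 - r * s) powr (- (a + t))) * indicator {0<..<1} s
        \<le> ennreal (g * C) * (ennreal ((1 - s) powr (a - 1) * (1 - r * s) powr (- (a + t))) * indicator {0<..<1} s)"
      proof (cases "s \<in> {0<..<1}")
        case True
        have "s powr (hd + t - 1) \<le> 1" using True hd_ge_1 t by (intro powr_le1) auto
        then have "s powr (hd + t - 1) * ((1 - s) powr (a - 1) * (g * C * (1 - r * s) powr (- (a + t)))) \<le> 1 * ((1 - s) powr (a - 1) * (g * C * (1 - r * s) powr (- (a + t))))"
          using g C0 by (intro mult_right_mono) auto
        then have "ennreal (s powr (hd + t - 1) * ((1 - s) powr (a - 1) * (g * C * (1 - r * s) powr (- (a + t))))) \<le> ennreal ((1 - s) powr (a - 1) * (g * C * (1 - r * s) powr (- (a + t))))"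
          by (intro ennreal_leI) simp
        then show ?thesis using True g C0 by (simp add: ennreal_mult[symmetric] mult_ac)
      qed simp
    qed
    also have "\<dots> = ennreal (g * C) * (\<integral>\<^sup>+s. ennreal ((1 - s) powr (a - 1) * (1 - r * s) powr (- (a + t))) * indicator {0<..<1} s \<partial>lborel)"
      by (rule nn_integral_cmult) measurable
    also have "\<dots> \<le> ennreal (g * C) * ennreal ((1 / a + 1 / t) * (1 - r) powr (- t))"
      by (intro mult_left_mono nn_integral_one_minus_powr_le a t r0 r) simp
    also have "\<dots> = ennreal (E * (1 - r) powr (- t))"
      using g C0 a t by (simp add: E_def ennreal_mult[symmetric] mult.assoc)
    finally show ?thesis .
  qed
  \<comment> \<open>The integer bound excludes radius 0. There the kernel at radius 1/2 is composed
    with the Poisson kernel at radius 0, whose L^1 norm is 1; the value at 1/2 brings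
    \<open>2 powr t\<close> into the final constant.\<close>
  have zero: "zonal_L1 (frac_factor hd t) 0 z \<le> ennreal (E * 2 powr t)" if z: "norm z = 1" for z
  proof -
    have "zonal_L1 (\<lambda>k. 1 * frac_factor hd t k) (0 * (1/2)) z \<le> 1 * zonal_L1 (frac_factor hd t) (1/2) z"
    proof (rule zonal_L1_compose[where A="\<lambda>_. 1" and B="frac_factor hd t"])
      show "zonal_L1 (\<lambda>_. 1) 0 \<xi> \<le> 1" if "norm \<xi> = 1" for \<xi> using zonal_L1_one[of 0 \<xi>] that by simp
    qed (use z subexponential_const subexponential_frac_factor[OF hd_pos t] in auto)
    also have "\<dots> \<le> ennreal (E * (1 - 1/2) powr (- t))" using main[of "1/2" z] z by simp
    also have "(1 - 1/2 :: real) powr (- t) = 2 powr t" by (simp add: powr_divide powr_minus_divide)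
    finally show ?thesis by simp
  qed
  show ?thesis
  proof (intro exI[of _ "E * 2 powr t"] conjI allI impI)
    show "0 < E * 2 powr t" using E by simp
    fix r :: real and z :: 'a assume r: "0 \<le> r" "r < 1" and z: "norm z = 1"
    have one: "1 \<le> 2 powr t" using t by (simp add: ge_one_powr_ge_zero)
    show "zonal_L1 (frac_factor hd t) r z \<le> ennreal (E * 2 powr t * (1 - r) powr (- t))"
    proof (cases "r = 0")
      case True
      then show ?thesis using zero[OF z] by simp
    next
      case False
      then have "zonal_L1 (frac_factor hd t) r z \<le> ennreal (E * (1 - r) powr (- t))" using main r z by simp
      also have "\<dots> \<le> ennreal (E * 2 powr t * (1 - r) powr (- t))"
        using one E by (intro ennreal_leI mult_right_mono) auto
      finally show ?thesis .
    qed
  qed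
qed

text \<open>The value at \<open>\<rho> y\<close> of the fractional derivative of \<open>g * P\<^sub>x\<close>, where \<open>g\<close> has coefficients \<open>c\<close>.\<close>

definition kern :: "real \<Rightarrow> (nat \<Rightarrow> nat \<Rightarrow> complex) \<Rightarrow> real \<Rightarrow> 'a \<Rightarrow> 'a \<Rightarrow> complex" where
  "kern t c \<rho> x y = sphere_series (\<lambda>k j. of_real (\<rho> ^ k) * (of_real (frac_factor hd t k) * (c k j * of_real (Y k j x)))) y"

lemma kern_symmetric: "kern t c \<rho> x y = kern t c \<rho> y x"
  unfolding kern_def sphere_series_def by (intro suminf_cong sum.cong refl) (simp add: mult_ac)

lemma admissible_cong:
  assumes "admissible c" "\<And>k j. j \<in> {1..d k} \<Longrightarrow> c k j = c' k j"
  shows "admissible c'"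
  using assms unfolding admissible_def by fastforce

lemma admissible_kern:
  assumes "admissible c" "t > 0" "norm x = 1"
  shows "admissible (\<lambda>k j. of_real (frac_factor hd t k) * (c k j * of_real (Y k j x)))"
  by (intro admissible_mult admissible_const subexponential_frac_factor admissible_Y assms hd_pos)

lemma frac_deriv_convolution:
  assumes c: "admissible c" and t: "t > 0" and x: "norm x = 1" and y: "norm y = 1" and \<rho>: "0 \<le> \<rho>" "\<rho> < 1"
  shows "frac_deriv Y t (convolution Y (harmonic_series Y c) (poisson_kernel Y x)) (\<rho> *\<^sub>R y) = kern t c \<rho> x y"
proof -
  have "convolution Y (harmonic_series Y c) (poisson_kernel Y x) = harmonic_series Y (\<lambda>k j. c k j * of_real (Y k j x))"
    unfolding convolution_def poisson_kernel_def
    by (rule harmonic_series_cong) (simp only: admissible_coefficients[OF c] admissible_coefficients[OF admissible_Y[OF x]])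
  moreover have "frac_deriv Y t (harmonic_series Y (\<lambda>k j. c k j * of_real (Y k j x))) =
    harmonic_series Y (\<lambda>k j. of_real (frac_factor hd t k) * (c k j * of_real (Y k j x)))"
    unfolding frac_deriv_def
    by (rule harmonic_series_cong)
       (simp only: admissible_coefficients[OF admissible_mult[OF c admissible_Y[OF x]]] frac_factor_def hd_eq)
  ultimately show ?thesis
    unfolding kern_def using harmonic_series_polar[OF \<rho>(1) y] by simp
qed

text \<open>For subexponential \<open>c\<close> the chosen coefficients of g, of the convolution and
  of the Poisson kernel are the expected ones, so the expression in \<open>N_p\<close> is
  \<open>kern\<close>, and the two suprema merge into one pointwise bound.\<close>

lemma N_p_finite_iff:
  assumes c: "admissible c" and m: "m > -1"
  shows "N_p \<sigma> Y m \<alpha> \<beta> p (harmonic_series Y c) < \<infinity> \<longleftrightarrow>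
    (\<exists>N>0. \<forall>\<rho> y. 0 \<le> \<rho> \<longrightarrow> \<rho> < 1 \<longrightarrow> norm y = 1 \<longrightarrow>
       sphere_norm \<sigma> p (\<lambda>x. kern (m + 1) c \<rho> x y) \<le> ennreal (N / (1 - \<rho>) powr (m + 1 - \<alpha> + \<beta>)))"
proof -
  let ?e = "m + 1 - \<alpha> + \<beta>"
  have "N_p \<sigma> Y m \<alpha> \<beta> p (harmonic_series Y c) =
    (SUP (\<rho>, y)\<in>{0..<1} \<times> sphere 0 1. sphere_norm \<sigma> p (\<lambda>x. kern (m + 1) c \<rho> x y) * ennreal ((1 - \<rho>) powr ?e))"
  proof -
    have eq: "sphere_norm \<sigma> p (\<lambda>x. frac_deriv Y (m + 1) (convolution Y (harmonic_series Y c) (poisson_kernel Y x)) (\<rho> *\<^sub>R y))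
      = sphere_norm \<sigma> p (\<lambda>x. kern (m + 1) c \<rho> x y)" if "\<rho> \<in> {0..<1}" "y \<in> sphere 0 1" for \<rho> y
      by (rule sphere_norm_cong) (use that m in \<open>auto intro!: frac_deriv_convolution c\<close>)
    show ?thesis unfolding N_p_def SUP_pair_times
      by (intro SUP_cong refl) (simp only: eq mult.commute prod.case)
  qed
  moreover have "(SUP (\<rho>, y)\<in>{0..<1} \<times> sphere 0 1. sphere_norm \<sigma> p (\<lambda>x. kern (m + 1) c \<rho> x y) * ennreal ((1 - \<rho>) powr ?e)) < \<infinity> \<longleftrightarrow>
    (\<exists>N>0. \<forall>i\<in>{0..<1} \<times> sphere 0 1. sphere_norm \<sigma> p (\<lambda>x. kern (m + 1) c (fst i) x (snd i)) \<le> ennreal (N / (1 - fst i) powr ?e))"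
    unfolding split_beta by (rule SUP_weighted_finite_iff) auto
  ultimately show ?thesis by auto
qed

lemma H_space_iff:
  "f \<in> H_space \<sigma> p \<alpha> \<longleftrightarrow> harmonic_on f (ball 0 1) \<and>
    (\<exists>N>0. \<forall>r. 0 \<le> r \<longrightarrow> r < 1 \<longrightarrow> mean_p \<sigma> p f r \<le> ennreal (N / (1 - r) powr \<alpha>))"
proof -
  have "(SUP r\<in>{0..<1}. mean_p \<sigma> p f r * ennreal ((1 - r) powr \<alpha>)) < \<infinity> \<longleftrightarrow>
    (\<exists>N>0. \<forall>r\<in>{0..<1}. mean_p \<sigma> p f r \<le> ennreal (N / (1 - r) powr \<alpha>))"
    by (rule SUP_weighted_finite_iff) auto
  then show ?thesis unfolding H_space_def by auto
qed

lemma coeff_dominated: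
  assumes a: "\<And>k j. j \<in> {1..d k} \<Longrightarrow> norm (c k j) \<le> a k" and \<rho>: "0 \<le> \<rho>" "\<rho> \<le> r" and x: "norm x = 1" and j: "j \<in> {1..d k}"
  shows "norm (of_real (\<rho> ^ k) * (of_real (w k) * (c k j * complex_of_real (Y k j x)))) \<le> \<bar>w k * a k * ymax k\<bar> * r ^ k"
proof -
  have "norm (of_real (\<rho> ^ k) * (of_real (w k) * (c k j * complex_of_real (Y k j x)))) = \<rho> ^ k * (\<bar>w k\<bar> * (norm (c k j) * \<bar>Y k j x\<bar>))"
    using \<rho> by (simp add: norm_mult norm_power)
  also have "\<dots> \<le> r ^ k * (\<bar>w k\<bar> * (\<bar>a k\<bar> * ymax k))"
    using \<rho> abs_Y_le_ymax[OF j x] order_trans[OF a[OF j] abs_ge_self] 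
    by (intro mult_mono mult_left_mono power_mono) auto
  finally show ?thesis using ymax_nonneg[of k] by (simp add: abs_mult mult_ac)
qed

section \<open>Integral representation and sufficiency\<close>

lemma kern_measurable_triple:
  shows "(\<lambda>p. kern t c (r * sqrt (fst (fst p))) (snd (fst p)) (snd p)) \<in> borel_measurable ((beta_measure a b \<Otimes>\<^sub>M \<sigma>) \<Otimes>\<^sub>M \<sigma>)"
proof -
  have [measurable]: "(\<lambda>q. fst (fst q)) \<in> borel_measurable ((beta_measure a b \<Otimes>\<^sub>M \<sigma>) \<Otimes>\<^sub>M \<sigma>)"
    by (rule measurable_compose[OF measurable_fst beta_fst_measurable])
  show ?thesis unfolding kern_def sphere_series_def by measurable
qed

text \<open>The moments of the beta distribution are the reciprocals of the factors of the fractional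
  derivative, so that integrating against it undoes that derivative.\<close>

lemma multiplier_representation:
  assumes c: "admissible c" and f: "harmonic_on f (ball 0 1)" and t: "t > 0" and r: "0 \<le> r" "r < 1" and x: "norm x = 1"
  shows "sphere_series (\<lambda>k j. of_real ((r\<^sup>2) ^ k) * (c k j * coefficients Y f k j)) x =
    (LINT q|(beta_measure hd t \<Otimes>\<^sub>M \<sigma>). kern t c (r * sqrt (fst q)) (snd q) x * f ((r * sqrt (fst q)) *\<^sub>R snd q))"
    and "\<And>y. norm y = 1 \<Longrightarrow> \<rho> \<in> {0..<1} \<Longrightarrow> f (\<rho> *\<^sub>R y) = sphere_series (\<lambda>k j. of_real (\<rho> ^ k) * coefficients Y f k j) y"
    and "(\<lambda>q. f ((r * sqrt (fst q)) *\<^sub>R snd q)) \<in> borel_measurable (beta_measure hd t \<Otimes>\<^sub>M \<sigma>)"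
proof -
  let ?B = "beta_measure hd t" and ?\<nu> = "beta_measure hd t \<Otimes>\<^sub>M \<sigma>"
  let ?b = "coefficients Y f"
  have sf: "sigma_finite_measure \<sigma>" by unfold_locales
  have fin: "emeasure \<sigma> (space \<sigma>) \<noteq> \<infinity>" by simp
  interpret B: finite_measure ?B by (rule finite_beta_measure[OF hd_pos t])
  interpret pair_sigma_finite ?B \<sigma> ..
  interpret PF: finite_measure ?\<nu>
  proof
    have "emeasure ?\<nu> (space ?\<nu>) = emeasure ?B (space ?B) * emeasure \<sigma> (space \<sigma>)"
      unfolding space_pair_measure by (rule sigma_finite_measure.emeasure_pair_measure_Times[OF sf]) (rule sets.top)+
    also have "\<dots> \<noteq> \<infinity>" using B.emeasure_finite fin by (simp add: ennreal_mult_eq_top_iff del: space_beta_measure space_sigma)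
    finally show "emeasure ?\<nu> (space ?\<nu>) \<noteq> \<infinity>" .
  qed
  have b: "admissible ?b" by (rule harmonic_expansion(1)[OF f])
  show fs: "f (\<rho> *\<^sub>R y) = sphere_series (\<lambda>k j. of_real (\<rho> ^ k) * ?b k j) y" if "norm y = 1" "\<rho> \<in> {0..<1}" for \<rho> y
  proof -
    have "\<rho> *\<^sub>R y \<in> ball 0 1" using that by simp
    from harmonic_expansion(2)[OF f this] have "f (\<rho> *\<^sub>R y) = harmonic_series Y ?b (\<rho> *\<^sub>R y)"
      by (simp add: harmonic_series_def sums_iff)
    then show ?thesis using harmonic_series_polar[of \<rho> y ?b] that by simp
  qed
  have sp: "0 \<le> r * sqrt s" "r * sqrt s \<le> r" "r * sqrt s < 1" if "s \<in> {0<..<1}" for s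
  proof -
    show "0 \<le> r * sqrt s" using r that by simp
    show "r * sqrt s \<le> r" using r that by (intro mult_left_le) auto
    then show "r * sqrt s < 1" using r by simp
  qed
  have sq: "fst q \<in> {0<..<1}" "norm (snd q) = 1" if "q \<in> space ?\<nu>" for q
    using that by (auto simp: space_pair_measure)
  have fst_m [measurable]: "fst \<in> borel_measurable ?\<nu>" by (rule beta_fst_measurable)
  \<comment> \<open>\<open>f\<close> is arbitrary outside the ball, so measurability is read off its
    expansion.\<close>
  show fm: "(\<lambda>q. f ((r * sqrt (fst q)) *\<^sub>R snd q)) \<in> borel_measurable ?\<nu>"
  proof (subst measurable_cong)
    show "f ((r * sqrt (fst q)) *\<^sub>R snd q) = sphere_series (\<lambda>k j. of_real ((r * sqrt (fst q)) ^ k) * ?b k j) (snd q)" if "q \<in> space ?\<nu>" for q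
      by (rule fs) (use sq[OF that] sp[of "fst q"] in auto)
    show "(\<lambda>q. sphere_series (\<lambda>k j. of_real ((r * sqrt (fst q)) ^ k) * ?b k j) (snd q)) \<in> borel_measurable ?\<nu>"
      unfolding sphere_series_def by measurable
  qed
  obtain a where a: "subexponential a" "\<And>k j. j \<in> {1..d k} \<Longrightarrow> norm (c k j) \<le> a k"
    using c unfolding admissible_def by blast
  have fc: "continuous_on (cball 0 r) f"
    by (rule continuous_on_subset[OF harmonic_on_continuous[OF f]]) (use r in auto)
  obtain F where F: "\<forall>y\<in>cball 0 r. norm (f y) \<le> F"
    using compact_imp_bounded[OF compact_continuous_image[OF fc compact_cball]]
    unfolding bounded_iff by auto
  have F': "norm (f (\<rho> *\<^sub>R y)) \<le> F" if "0 \<le> \<rho>" "\<rho> \<le> r" "norm y = 1" for \<rho> y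
    using F that by simp
  define A where "A k j q = f ((r * sqrt (fst q)) *\<^sub>R snd q) * (of_real ((r * sqrt (fst q)) ^ k) * (of_real (frac_factor hd t k) * (c k j * complex_of_real (Y k j (snd q)))))"
    for k j q
  let ?M = "\<lambda>k. \<bar>frac_factor hd t k * a k * ymax k\<bar> * r ^ k"
  have sM: "summable (\<lambda>k. ?M k * layer k)"
    by (intro subexponential_layer_summable subexponential_mult subexponential_frac_factor hd_pos t a subexponential_ymax r)
  have F0: "F \<ge> 0" using F' r x by (meson norm_ge_zero order_trans order_refl)
  have Ab: "norm (A k j q) \<le> ?M k * F" if j: "j \<in> {1..d k}" and q: "q \<in> space ?\<nu>" for k j q
  proof -
    have "norm (A k j q) \<le> F * ?M k" unfolding A_def norm_mult[of "f _"]
      by (rule mult_mono[OF F' coeff_dominated[where a=a, OF a(2)]]) (use sq[OF q] sp[of "fst q"] j F0 in auto)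
    then show ?thesis by (simp add: mult.commute)
  qed
  have Am: "A k j \<in> borel_measurable ?\<nu>" if "j \<in> {1..d k}" for k j
    unfolding A_def using that by (intro borel_measurable_times fm) measurable
  have Ai: "integrable ?\<nu> (A k j)" if "j \<in> {1..d k}" for k j
    by (rule PF.integrable_const_bound[where B="?M k * F"]) (use Ab[OF that] Am[OF that] in \<open>auto intro!: AE_I2\<close>)
  have AI: "(LINT q|?\<nu>. A k j q) = of_real ((r\<^sup>2) ^ k) * (c k j * ?b k j)" if j: "j \<in> {1..d k}" for k j
  proof -
    have "(LINT q|?\<nu>. A k j q) = (LINT s|?B. LINT \<xi>|\<sigma>. A k j (s, \<xi>))"
      by (rule integral_fst'[symmetric, OF Ai[OF j]])
    also have "\<dots> = (LINT s|?B. (of_real (frac_factor hd t k * (r\<^sup>2) ^ k) * (c k j * ?b k j)) * complex_of_real (s ^ k))"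
    proof (intro Bochner_Integration.integral_cong refl)
      fix s assume "s \<in> space ?B"
      then have s: "s \<in> {0<..<1}" by simp
      let ?\<rho> = "r * sqrt s"
      obtain M where M: "\<And>k j. j \<in> {1..d k} \<Longrightarrow> norm (of_real (?\<rho> ^ k) * ?b k j) \<le> M k" "summable (\<lambda>k. M k * layer k)"
        using admissible_dominated[OF b sp(1,3)[OF s]] by metis
      have "(LINT \<xi>|\<sigma>. A k j (s, \<xi>)) = (LINT \<xi>|\<sigma>. (of_real (?\<rho> ^ k) * (of_real (frac_factor hd t k) * c k j)) * (f (?\<rho> *\<^sub>R \<xi>) * complex_of_real (Y k j \<xi>)))"
        by (intro Bochner_Integration.integral_cong refl) (simp only: A_def fst_conv snd_conv mult_ac)
      also have "\<dots> = (of_real (?\<rho> ^ k) * (of_real (frac_factor hd t k) * c k j)) * (LINT \<xi>|\<sigma>. f (?\<rho> *\<^sub>R \<xi>) * complex_of_real (Y k j \<xi>))"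
        by (rule integral_mult_right_zero)
      also have "(LINT \<xi>|\<sigma>. f (?\<rho> *\<^sub>R \<xi>) * complex_of_real (Y k j \<xi>)) = (LINT \<xi>|\<sigma>. sphere_series (\<lambda>k j. of_real (?\<rho> ^ k) * ?b k j) \<xi> * complex_of_real (Y k j \<xi>))"
        by (intro Bochner_Integration.integral_cong refl arg_cong2[where f="(*)"] fs) (use sp[OF s] in auto)
      also have "\<dots> = of_real (?\<rho> ^ k) * ?b k j"
        by (rule sphere_series_coeff[where c="\<lambda>k j. of_real (?\<rho> ^ k) * ?b k j" and M=M, OF M j])
      also have "(of_real (?\<rho> ^ k) * (of_real (frac_factor hd t k) * c k j)) * (of_real (?\<rho> ^ k) * ?b k j) =
        (of_real (frac_factor hd t k) * (c k j * ?b k j)) * complex_of_real (?\<rho> ^ k * ?\<rho> ^ k)"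
        by (simp only: mult_ac of_real_mult)
      \<comment> \<open>Kernel and \<open>f\<close> are taken at the same radius r \<surd>s.
        Together they give r^(2k) s^k, and the integral of s^k is the moment that cancels the factor
        of the fractional derivative.\<close>
      also have "?\<rho> ^ k * ?\<rho> ^ k = (r\<^sup>2) ^ k * s ^ k"
        using s by (simp add: power_mult_distrib[symmetric] power2_eq_square mult.left_commute mult.commute)
      finally show "(LINT \<xi>|\<sigma>. A k j (s, \<xi>)) = (of_real (frac_factor hd t k * (r\<^sup>2) ^ k) * (c k j * ?b k j)) * complex_of_real (s ^ k)"
        by (simp only: of_real_mult mult_ac)
    qed
    also have "\<dots> = (of_real (frac_factor hd t k * (r\<^sup>2) ^ k) * (c k j * ?b k j)) * complex_of_real (Beta (hd + real k) t)"
      by (simp only: integral_mult_right_zero integral_complex_of_real integral_beta_measure_power[OF hd_pos t])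
    also have "\<dots> = of_real (frac_factor hd t k * Beta (hd + real k) t) * (of_real ((r\<^sup>2) ^ k) * (c k j * ?b k j))"
      by (simp only: of_real_mult mult_ac)
    finally show ?thesis unfolding frac_factor_Beta[OF hd_pos t] by simp
  qed
  have "sphere_series (\<lambda>k j. of_real ((r\<^sup>2) ^ k) * (c k j * ?b k j)) x = sphere_series (\<lambda>k j. LINT q|?\<nu>. A k j q) x"
    by (rule sphere_series_cong) (simp only: AI)
  also have "\<dots> = (LINT q|?\<nu>. sphere_series (\<lambda>k j. A k j q) x)"
    by (rule sphere_series_integral(2)[where a="\<lambda>q k j. A k j q" and M="?M" and W="\<lambda>_. F", OF Am Ab _ sM _ x]) (use r in auto)
  also have "\<dots> = (LINT q|?\<nu>. kern t c (r * sqrt (fst q)) (snd q) x * f ((r * sqrt (fst q)) *\<^sub>R snd q))"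
  proof (intro Bochner_Integration.integral_cong refl)
    fix q assume q: "q \<in> space ?\<nu>"
    have "sphere_series (\<lambda>k j. A k j q) x = f ((r * sqrt (fst q)) *\<^sub>R snd q) * kern t c (r * sqrt (fst q)) (snd q) x"
      unfolding A_def kern_def
    proof (rule sphere_series_mult[where M="?M", OF _ sM x])
      show "norm (of_real ((r * sqrt (fst q)) ^ k) * (of_real (frac_factor hd t k) * (c k j * complex_of_real (Y k j (snd q))))) \<le> ?M k"
        if "j \<in> {1..d k}" for k j
        by (rule coeff_dominated[where a=a, OF a(2)]) (use sq[OF q] sp[of "fst q"] that in auto)
    qed
    then show "sphere_series (\<lambda>k j. A k j q) x = kern t c (r * sqrt (fst q)) (snd q) x * f ((r * sqrt (fst q)) *\<^sub>R snd q)"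
      by (simp only: mult.commute)
  qed
  finally show "sphere_series (\<lambda>k j. of_real ((r\<^sup>2) ^ k) * (c k j * ?b k j)) x =
    (LINT q|?\<nu>. kern t c (r * sqrt (fst q)) (snd q) x * f ((r * sqrt (fst q)) *\<^sub>R snd q))" .
qed

text \<open>The inequality of arithmetic and geometric means gives 1 - r s \<le> 2 (1 - r \<surd>s),
  so replacing r \<surd>s by r s costs only a constant.\<close>

lemma one_minus_sqrt_powr_le:
  assumes s: "0 < s" "s < 1" and r: "0 \<le> r" "r < 1" and e: "e \<ge> 0"
  shows "(1 - r * sqrt s) powr (- e) \<le> 2 powr e * (1 - r * s) powr (- e)"
proof -
  have "sqrt s \<le> (1 + s) / 2" using arith_geo_mean_sqrt[of 1 s] s by simp
  then have "r * sqrt s \<le> r * ((1 + s) / 2)" using r by (intro mult_left_mono) auto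
  moreover have "r * s < 1" using r s by (metis less_eq_real_def less_trans mult_left_le_one_le mult.commute le_less_trans)
  ultimately have *: "(1 - r * s) / 2 \<le> 1 - r * sqrt s" using r by (simp add: field_simps)
  have pos: "0 < 1 - r * s" using \<open>r * s < 1\<close> by simp
  have "(1 - r * sqrt s) powr (- e) \<le> ((1 - r * s) / 2) powr (- e)"
    using * pos e by (intro powr_mono2') auto
  also have "\<dots> = 2 powr e * (1 - r * s) powr (- e)" using pos by (simp add: powr_divide powr_minus_divide)
  finally show ?thesis .
qed

lemma sqrt_powr_le:
  fixes \<rho> e :: real
  assumes "0 \<le> \<rho>" "\<rho> < 1" "0 \<le> e"
  shows "(1 - sqrt \<rho>) powr (- e) \<le> 2 powr e * (1 - \<rho>) powr (- e)"
proof -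
  have "sqrt \<rho> \<le> (1 + \<rho>) / 2" using arith_geo_mean_sqrt[of 1 \<rho>] assms by simp
  then have "(1 - \<rho>) / 2 \<le> 1 - sqrt \<rho>" by (simp add: field_simps)
  then have "(1 - sqrt \<rho>) powr (- e) \<le> ((1 - \<rho>) / 2) powr (- e)"
    using assms by (intro powr_mono2') auto
  also have "\<dots> = 2 powr e * (1 - \<rho>) powr (- e)" using assms by (simp add: powr_divide powr_minus_divide)
  finally show ?thesis .
qed

text \<open>At radius \<rho> = r \<surd>s the norm of the kernel is bounded by a multiple of (1 -
  \<rho>)^(-(m+1-\<alpha>+\<beta>)) and the mean of |f| by a multiple of (1 - \<rho>)^(-\<alpha>).
  The exponents add up to t + \<beta> with t = m + 1, and the factor (1 - s)^(t-1) of the beta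
  density reduces the integral to order (1 - r)^(-\<beta>).\<close>

lemma multiplier_sufficient:
  assumes c: "admissible c" and m: "m > \<alpha> - 1" and \<alpha>: "0 \<le> \<alpha>" and \<beta>: "0 < \<beta>" and p: "1 \<le> p"
    and N: "N_p \<sigma> Y m \<alpha> \<beta> p (harmonic_series Y c) < \<infinity>"
  shows "c \<in> multipliers Y (H_space \<sigma> 1 \<alpha>) (H_space \<sigma> p \<beta>)"
  unfolding multipliers_def
proof (intro CollectI ballI conjI)
  fix f assume fH: "f \<in> H_space \<sigma> 1 \<alpha>"
  define t where "t = m + 1"
  have t: "t > 0" using m \<alpha> by (simp add: t_def)
  let ?b = "coefficients Y f"
  let ?B = "beta_measure hd t" and ?\<nu> = "beta_measure hd t \<Otimes>\<^sub>M \<sigma>"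
  have sf: "sigma_finite_measure \<sigma>" by unfold_locales
  interpret B: finite_measure ?B by (rule finite_beta_measure[OF hd_pos t])
  interpret pair_sigma_finite ?B \<sigma> ..
  from fH obtain K where f: "harmonic_on f (ball 0 1)" and K: "K > 0"
    "\<And>r. 0 \<le> r \<Longrightarrow> r < 1 \<Longrightarrow> mean_p \<sigma> 1 f r \<le> ennreal (K / (1 - r) powr \<alpha>)"
    unfolding H_space_iff by blast
  have m1: "m > -1" using t by (simp add: t_def)
  define e where "e = m + 1 - \<alpha> + \<beta>"
  obtain L where L: "L > 0" "\<And>\<rho> y. 0 \<le> \<rho> \<Longrightarrow> \<rho> < 1 \<Longrightarrow> norm y = 1 \<Longrightarrow>
       sphere_norm \<sigma> p (\<lambda>x. kern t c \<rho> x y) \<le> ennreal (L / (1 - \<rho>) powr e)"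
    using N unfolding N_p_finite_iff[OF c m1] t_def e_def by blast
  have b: "admissible ?b" by (rule harmonic_expansion(1)[OF f])
  have cb: "admissible (\<lambda>k j. c k j * ?b k j)" by (rule admissible_mult[OF c b])
  show "series_converges Y (\<lambda>k j. c k j * ?b k j)" by (rule admissible_series_converges[OF cb])
  let ?h = "harmonic_series Y (\<lambda>k j. c k j * ?b k j)"
  \<comment> \<open>\<open>2 powr (t + \<beta>)\<close> pays for the passage from r \<surd>s to r s,
    and \<open>1 / t + 1 / \<beta>\<close> is the constant of
    \<open>nn_integral_one_minus_powr_le\<close>.\<close>
  define E where "E = L * K * 2 powr (t + \<beta>) * (1 / t + 1 / \<beta>)"
  have E: "E > 0" using L(1) K(1) t \<beta> by (simp add: E_def add_pos_pos)
  have main: "mean_p \<sigma> p ?h (r\<^sup>2) \<le> ennreal (E * (1 - r) powr (- \<beta>))" if r: "0 \<le> r" "r < 1" for r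
  proof -
    have sp: "0 \<le> r * sqrt s" "r * sqrt s < 1" if "s \<in> {0<..<1}" for s
    proof -
      show "0 \<le> r * sqrt s" using r that by simp
      have "r * sqrt s \<le> r" using r that by (intro mult_left_le) auto
      then show "r * sqrt s < 1" using r by simp
    qed
    define w where "w q = norm (f ((r * sqrt (fst q)) *\<^sub>R snd q))" for q
    have wm[measurable]: "w \<in> borel_measurable ?\<nu>" unfolding w_def
    proof -
      obtain x0 :: 'a where x0: "norm x0 = 1" using vector_choose_size[of 1] by auto
      show "(\<lambda>q. norm (f ((r * sqrt (fst q)) *\<^sub>R snd q))) \<in> borel_measurable ?\<nu>"
        by (rule measurable_compose[OF multiplier_representation(3)[OF c f t r x0] borel_measurable_norm])
    qed
    \<comment> \<open>The modulus of \<open>f\<close> goes into the measure, so that Minkowski's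
      inequality concerns the kernel alone.\<close>
    define \<mu> where "\<mu> = density ?\<nu> (\<lambda>q. ennreal (w q))"
    define A where "A q = L * (1 - r * sqrt (fst q)) powr (- e)" for q :: "real \<times> 'a"
    have [measurable]: "fst \<in> borel_measurable ?\<nu>" by (rule beta_fst_measurable)
    have Am[measurable]: "A \<in> borel_measurable ?\<nu>" unfolding A_def by measurable
    have space: "space \<mu> = {0<..<1} \<times> sphere 0 1" by (simp add: \<mu>_def space_pair_measure)
    have "sphere_norm \<sigma> p (\<lambda>x. ?h (r\<^sup>2 *\<^sub>R x)) \<le> (\<integral>\<^sup>+q. ennreal (A q) \<partial>\<mu>)"
    proof (rule sphere_norm_integral_le[where u="\<lambda>q x. kern t c (r * sqrt (fst q)) (snd q) x", OF p])
      show "sigma_finite_measure \<mu>"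
      proof -
        show ?thesis unfolding \<mu>_def by (subst P.sigma_finite_iff_density_finite) auto
      qed
      have "sets (\<mu> \<Otimes>\<^sub>M \<sigma>) = sets (?\<nu> \<Otimes>\<^sub>M \<sigma>)" by (intro sets_pair_measure_cong) (auto simp: \<mu>_def)
      then show "(\<lambda>(q, x). kern t c (r * sqrt (fst q)) (snd q) x) \<in> borel_measurable (\<mu> \<Otimes>\<^sub>M \<sigma>)"
        using kern_measurable_triple[of t c r hd t] by (subst measurable_cong_sets[OF _ refl]) (auto simp: split_beta)
      show "A \<in> borel_measurable \<mu>" unfolding \<mu>_def by simp
      fix q assume q: "q \<in> space \<mu>"
      then have q': "fst q \<in> {0<..<1}" "norm (snd q) = 1" unfolding space by auto
      show "0 < A q" unfolding A_def using L(1) sp(2)[OF q'(1)] by simp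
      \<comment> \<open>The hypothesis bounds the norm in the pole of the Poisson kernel, whereas
        here the norm is taken in the other variable; the symmetry of \<open>kern\<close> exchanges
        them.\<close>
      have "sphere_norm \<sigma> p (\<lambda>x. kern t c (r * sqrt (fst q)) x (snd q)) \<le> ennreal (L / (1 - r * sqrt (fst q)) powr e)"
        by (rule L(2)) (use q' sp in auto)
      then show "sphere_norm \<sigma> p (kern t c (r * sqrt (fst q)) (snd q)) \<le> ennreal (A q)"
        unfolding A_def kern_symmetric[of t c _ "snd q"] by (simp add: powr_minus divide_inverse)
    next
      fix x :: 'a assume x: "norm x = 1"
      have km: "(\<lambda>q. kern t c (r * sqrt (fst q)) (snd q) x) \<in> borel_measurable ?\<nu>"
        using measurable_compose[OF measurable_Pair2'[of x \<sigma> ?\<nu>] kern_measurable_triple[of t c r hd t]] x by (simp add: split_beta)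
      have hx: "?h (r\<^sup>2 *\<^sub>R x) = (LINT q|?\<nu>. kern t c (r * sqrt (fst q)) (snd q) x * f ((r * sqrt (fst q)) *\<^sub>R snd q))"
        unfolding multiplier_representation(1)[OF c f t r x, symmetric]
        using harmonic_series_polar[OF _ x, of "r\<^sup>2" "\<lambda>k j. c k j * ?b k j"] by simp
      have "ennreal (cmod (?h (r\<^sup>2 *\<^sub>R x))) \<le> (\<integral>\<^sup>+q. ennreal (norm (kern t c (r * sqrt (fst q)) (snd q) x * f ((r * sqrt (fst q)) *\<^sub>R snd q))) \<partial>?\<nu>)"
        unfolding hx by (rule norm_integral_le_nn_integral)
      also have "\<dots> = (\<integral>\<^sup>+q. ennreal (w q) * ennreal (norm (kern t c (r * sqrt (fst q)) (snd q) x)) \<partial>?\<nu>)"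
        by (intro nn_integral_cong) (simp add: w_def norm_mult ennreal_mult mult.commute)
      also have "\<dots> = (\<integral>\<^sup>+q. ennreal (norm (kern t c (r * sqrt (fst q)) (snd q) x)) \<partial>\<mu>)"
        unfolding \<mu>_def by (rule nn_integral_density[symmetric]) (simp_all add: measurable_compose[OF km])
      finally show "ennreal (cmod (?h (r\<^sup>2 *\<^sub>R x))) \<le> (\<integral>\<^sup>+q. ennreal (norm (kern t c (r * sqrt (fst q)) (snd q) x)) \<partial>\<mu>)" .
    qed
    also have "\<dots> = (\<integral>\<^sup>+q. ennreal (w q) * ennreal (A q) \<partial>?\<nu>)"
      unfolding \<mu>_def by (rule nn_integral_density) simp_all
    also have "\<dots> = (\<integral>\<^sup>+s. \<integral>\<^sup>+\<xi>. ennreal (w (s, \<xi>)) * ennreal (A (s, \<xi>)) \<partial>\<sigma> \<partial>?B)"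
      by (rule sigma_finite_measure.nn_integral_fst[OF sf, symmetric]) measurable
    also have "\<dots> \<le> (\<integral>\<^sup>+s. ennreal (L * K * 2 powr (t + \<beta>) * (1 - r * s) powr (- (t + \<beta>))) \<partial>?B)"
    proof (rule nn_integral_mono)
      fix s assume "s \<in> space ?B"
      then have s: "s \<in> {0<..<1}" by simp
      let ?\<rho> = "r * sqrt s"
      have "(\<integral>\<^sup>+\<xi>. ennreal (w (s, \<xi>)) \<partial>\<sigma>) \<le> ennreal (K / (1 - ?\<rho>) powr \<alpha>)"
      proof -
        have "sphere_norm \<sigma> 1 (\<lambda>\<xi>. f (?\<rho> *\<^sub>R \<xi>)) \<le> ennreal (K / (1 - ?\<rho>) powr \<alpha>)"
          using K(2)[OF sp[OF s]] by (simp add: mean_p_def)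
        then show ?thesis using sphere_norm_le_iff[of 1 "K / (1 - ?\<rho>) powr \<alpha>" "\<lambda>\<xi>. f (?\<rho> *\<^sub>R \<xi>)"] K(1) by (simp add: w_def)
      qed
      moreover have wms: "(\<lambda>\<xi>. w (s, \<xi>)) \<in> borel_measurable \<sigma>" using measurable_compose[OF measurable_Pair1'[of s ?B \<sigma>] wm] s by simp
      have "(\<integral>\<^sup>+\<xi>. ennreal (w (s, \<xi>)) * ennreal (A (s, \<xi>)) \<partial>\<sigma>) = (\<integral>\<^sup>+\<xi>. ennreal (w (s, \<xi>)) \<partial>\<sigma>) * ennreal (L * (1 - ?\<rho>) powr (- e))"
        unfolding A_def fst_conv by (intro nn_integral_multc measurable_compose[OF wms]) simp
      ultimately have "(\<integral>\<^sup>+\<xi>. ennreal (w (s, \<xi>)) * ennreal (A (s, \<xi>)) \<partial>\<sigma>) \<le> ennreal (K / (1 - ?\<rho>) powr \<alpha>) * ennreal (L * (1 - ?\<rho>) powr (- e))"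
        by (simp add: mult_right_mono)
      also have "\<dots> = ennreal (L * K * ((1 - ?\<rho>) powr (- \<alpha>) * (1 - ?\<rho>) powr (- e)))"
        using K(1) L(1) by (simp add: ennreal_mult[symmetric] powr_minus divide_inverse mult_ac)
      also have "(1 - ?\<rho>) powr (- \<alpha>) * (1 - ?\<rho>) powr (- e) = (1 - ?\<rho>) powr (- (t + \<beta>))"
        unfolding powr_add[symmetric] by (rule arg_cong[of _ _ "\<lambda>v. _ powr v"]) (simp add: e_def t_def)
      also have "ennreal (L * K * (1 - ?\<rho>) powr (- (t + \<beta>))) \<le> ennreal (L * K * (2 powr (t + \<beta>) * (1 - r * s) powr (- (t + \<beta>))))"
        using one_minus_sqrt_powr_le[of s r "t + \<beta>"] s r t \<beta> L(1) K(1) by (intro ennreal_leI mult_left_mono) auto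
      finally show "(\<integral>\<^sup>+\<xi>. ennreal (w (s, \<xi>)) * ennreal (A (s, \<xi>)) \<partial>\<sigma>) \<le> ennreal (L * K * 2 powr (t + \<beta>) * (1 - r * s) powr (- (t + \<beta>)))"
        by (simp add: mult.assoc)
    qed
    also have "\<dots> = (\<integral>\<^sup>+s. ennreal (s powr (hd - 1) * (1 - s) powr (t - 1)) * ennreal (L * K * 2 powr (t + \<beta>) * (1 - r * s) powr (- (t + \<beta>))) * indicator {0<..<1} s \<partial>lborel)"
      by (rule nn_integral_beta_measure) measurable
    also have "\<dots> \<le> (\<integral>\<^sup>+s. ennreal (L * K * 2 powr (t + \<beta>)) * (ennreal ((1 - s) powr (t - 1) * (1 - r * s) powr (- (t + \<beta>))) * indicator {0<..<1} s) \<partial>lborel)"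
    proof (rule nn_integral_mono)
      fix s :: real
      let ?G = "L * K * 2 powr (t + \<beta>)"
      have G: "?G > 0" using L(1) K(1) by simp
      show "ennreal (s powr (hd - 1) * (1 - s) powr (t - 1)) * ennreal (?G * (1 - r * s) powr (- (t + \<beta>))) * indicator {0<..<1} s
        \<le> ennreal ?G * (ennreal ((1 - s) powr (t - 1) * (1 - r * s) powr (- (t + \<beta>))) * indicator {0<..<1} s)"
      proof (cases "s \<in> {0<..<1}")
        case True
        have "s powr (hd - 1) \<le> 1" using True hd_ge_1 by (intro powr_le1) auto
        then have "s powr (hd - 1) * ((1 - s) powr (t - 1) * (?G * (1 - r * s) powr (- (t + \<beta>)))) \<le> 1 * ((1 - s) powr (t - 1) * (?G * (1 - r * s) powr (- (t + \<beta>))))"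
          using G by (intro mult_right_mono) auto
        then have "ennreal (s powr (hd - 1) * ((1 - s) powr (t - 1) * (?G * (1 - r * s) powr (- (t + \<beta>))))) \<le> ennreal ((1 - s) powr (t - 1) * (?G * (1 - r * s) powr (- (t + \<beta>))))"
          by (intro ennreal_leI) simp
        then show ?thesis using True L(1) K(1) by (simp add: ennreal_mult[symmetric] mult_ac)
      qed simp
    qed
    also have "\<dots> = ennreal (L * K * 2 powr (t + \<beta>)) * (\<integral>\<^sup>+s. ennreal ((1 - s) powr (t - 1) * (1 - r * s) powr (- (t + \<beta>))) * indicator {0<..<1} s \<partial>lborel)"
      by (rule nn_integral_cmult) measurable
    also have "\<dots> \<le> ennreal (L * K * 2 powr (t + \<beta>)) * ennreal ((1 / t + 1 / \<beta>) * (1 - r) powr (- \<beta>))"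
      by (intro mult_left_mono nn_integral_one_minus_powr_le t \<beta> r) simp
    also have "\<dots> = ennreal (E * (1 - r) powr (- \<beta>))"
      using L(1) K(1) t \<beta> by (simp add: E_def ennreal_mult[symmetric] mult.assoc)
    finally show ?thesis by (simp add: mean_p_def)
  qed
  show "?h \<in> H_space \<sigma> p \<beta>"
    unfolding H_space_iff
  proof (intro conjI exI[of _ "E * 2 powr \<beta>"] allI impI)
    show "harmonic_on ?h (ball 0 1)" by (rule admissible_harmonic[OF cb])
    show "0 < E * 2 powr \<beta>" using E by simp
    fix \<rho> :: real assume \<rho>: "0 \<le> \<rho>" "\<rho> < 1"
    have "mean_p \<sigma> p ?h ((sqrt \<rho>)\<^sup>2) \<le> ennreal (E * (1 - sqrt \<rho>) powr (- \<beta>))" by (rule main) (use \<rho> in auto)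
    also have "\<dots> \<le> ennreal (E * (2 powr \<beta> * (1 - \<rho>) powr (- \<beta>)))"
      using E \<beta> by (intro ennreal_leI mult_left_mono sqrt_powr_le \<rho>) auto
    finally show "mean_p \<sigma> p ?h \<rho> \<le> ennreal (E * 2 powr \<beta> / (1 - \<rho>) powr \<beta>)"
      using \<rho> by (simp add: powr_minus divide_inverse mult.assoc)
  qed
qed

end

section \<open>The gliding hump\<close>

lemma ennreal_norm_sums_le:
  fixes f :: "nat \<Rightarrow> 'b::real_normed_vector"
  assumes "f sums s"
  shows "ennreal (norm s) \<le> (\<Sum>l. ennreal (norm (f l)))"
proof (rule LIMSEQ_le_const2)
  show "(\<lambda>n. ennreal (norm (\<Sum>l<n. f l))) \<longlonglongrightarrow> ennreal (norm s)"
    using assms unfolding sums_def by (intro tendsto_ennrealI tendsto_norm)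
  have "ennreal (norm (\<Sum>l<n. f l)) \<le> (\<Sum>l. ennreal (norm (f l)))" for n
  proof -
    have "ennreal (norm (\<Sum>l<n. f l)) \<le> ennreal (\<Sum>l<n. norm (f l))" by (intro ennreal_leI norm_sum)
    also have "\<dots> = (\<Sum>l<n. ennreal (norm (f l)))" by simp
    also have "\<dots> \<le> (\<Sum>l. ennreal (norm (f l)))" by (rule sum_le_suminf) auto
    finally show ?thesis .
  qed
  then show "\<exists>N. \<forall>n\<ge>N. ennreal (norm (\<Sum>l<n. f l)) \<le> (\<Sum>l. ennreal (norm (f l)))" by blast
qed

context sphere_basis
begin

text \<open>Minkowski's integral inequality over the counting measure on the natural
  numbers.\<close>

lemma sphere_norm_suminf_le:
  assumes p: "1 \<le> p" and u[measurable]: "\<And>l. u l \<in> borel_measurable \<sigma>"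
    and A: "\<And>l. 0 < A l" "A sums a" "\<And>l. sphere_norm \<sigma> p (u l) \<le> ennreal (A l)"
    and h: "\<And>x. norm x = 1 \<Longrightarrow> (\<lambda>l. u l x) sums h x"
  shows "sphere_norm \<sigma> p h \<le> ennreal a"
proof -
  have "sphere_norm \<sigma> p h \<le> (\<integral>\<^sup>+l. ennreal (A l) \<partial>count_space UNIV)"
  proof (rule sphere_norm_integral_le[where u=u, OF p])
    show "sigma_finite_measure (count_space (UNIV :: nat set))" by (rule sigma_finite_measure_count_space)
    show "(\<lambda>(l, x). u l x) \<in> borel_measurable (count_space UNIV \<Otimes>\<^sub>M \<sigma>)"
      by (rule measurable_pair_measure_countable1) (auto simp: u)
    show "ennreal (cmod (h x)) \<le> (\<integral>\<^sup>+l. ennreal (cmod (u l x)) \<partial>count_space UNIV)" if "norm x = 1" for x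
      unfolding nn_integral_count_space_nat by (rule ennreal_norm_sums_le[OF h[OF that]])
  qed (use A in auto)
  also have "\<dots> = ennreal a"
    unfolding nn_integral_count_space_nat by (rule suminf_ennreal_eq) (use A in \<open>auto intro: less_imp_le\<close>)
  finally show ?thesis .
qed

text \<open>The step of the gliding hump: adding the next term only when the partial sum is still small
  keeps all later partial sums large, whatever was chosen before.\<close>

lemma sphere_norm_hump:
  assumes p: "1 \<le> p" and [measurable]: "P \<in> borel_measurable \<sigma>" "v \<in> borel_measurable \<sigma>"
    and Q: "Q > 0" and c: "c > 0" and v: "\<not> sphere_norm \<sigma> p v \<le> ennreal Q"
  shows "\<not> sphere_norm \<sigma> p P \<le> ennreal (c * Q / 2) \<or> \<not> sphere_norm \<sigma> p (\<lambda>x. P x + of_real c * v x) \<le> ennreal (c * Q / 2)"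
proof (rule ccontr)
  assume "\<not> ?thesis"
  then have 1: "sphere_norm \<sigma> p (\<lambda>x. - P x) \<le> ennreal (c * Q / 2)"
    and 2: "sphere_norm \<sigma> p (\<lambda>x. P x + of_real c * v x) \<le> ennreal (c * Q / 2)"
    using sphere_norm_mono[of "\<lambda>x. - P x" P p] by auto
  have "sphere_norm \<sigma> p (\<lambda>x. (P x + of_real c * v x) + - P x) \<le> ennreal (c * Q / 2 + c * Q / 2)"
    by (rule sphere_norm_triangle_le[OF p _ _ _ 2 _ 1]) (use Q c in auto)
  then have "sphere_norm \<sigma> p (\<lambda>x. of_real c * v x) \<le> ennreal (c * Q)" by (simp add: mult.commute)
  from sphere_norm_scale_le[OF p _ _ _ this, of "1 / c"]
  have "sphere_norm \<sigma> p (\<lambda>x. of_real (1 / c) * (of_real c * v x)) \<le> ennreal (1 / c * (c * Q))"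
    using Q c by simp
  moreover have "(\<lambda>x. of_real (1 / c) * (of_real c * v x)) = v" "1 / c * (c * Q) = Q"
    using c by (auto simp: fun_eq_iff)
  ultimately show False using v by metis
qed

text \<open>Stage \<open>n\<close> records the decisions below \<open>n\<close> and is 0 from
  \<open>n\<close> on. Decision \<open>n\<close> depends on all earlier ones, so the recursion
  carries the whole function and updates it.\<close>

primrec hump_choice :: "ennreal \<Rightarrow> (nat \<Rightarrow> nat \<Rightarrow> 'a \<Rightarrow> complex) \<Rightarrow> (nat \<Rightarrow> real) \<Rightarrow> nat \<Rightarrow> nat \<Rightarrow> real" where
  "hump_choice p V Q 0 = (\<lambda>_. 0)"
| "hump_choice p V Q (Suc n) = (hump_choice p V Q n)
     (n := if sphere_norm \<sigma> p (\<lambda>x. \<Sum>l<n. of_real (hump_choice p V Q n l * (1/10) ^ l) * V n l x) \<le> ennreal ((1/10) ^ n * Q n / 2)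
        then 1 else 0)"

text \<open>After step n the partial sum for row n has norm above 10^(-n) Q n / 2. By
  \<open>small\<close> the rest of the series has norm at most 2 Q n (10^(-n-1) + 10^(-n-2) + ...) =
  (2/9) 10^(-n) Q n. Since 1/10 + 2/9 < 1/2, the full sum cannot have norm at most 10^(-n) Q n / 10.
  The factor 2 in \<open>small\<close> leaves room for choosing the terms as
  near-maximisers.\<close>

lemma gliding_hump:
  fixes V :: "nat \<Rightarrow> nat \<Rightarrow> 'a \<Rightarrow> complex"
  assumes p: "1 \<le> p" and Vm[measurable]: "\<And>n l. V n l \<in> borel_measurable \<sigma>"
    and Q: "\<And>n. Q n > 0" and big: "\<And>n. \<not> sphere_norm \<sigma> p (V n n) \<le> ennreal (Q n)"
    and small: "\<And>n l. sphere_norm \<sigma> p (V n l) \<le> ennreal (2 * Q n)"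
  obtains \<eta> :: "nat \<Rightarrow> real" where "\<And>l. \<eta> l \<in> {0, 1}"
    "\<And>n h. h \<in> borel_measurable \<sigma> \<Longrightarrow> (\<And>x. norm x = 1 \<Longrightarrow> (\<lambda>l. of_real (\<eta> l * (1/10) ^ l) * V n l x) sums h x) \<Longrightarrow>
       \<not> sphere_norm \<sigma> p h \<le> ennreal ((1/10) ^ n * Q n / 10)"
proof -
  define \<delta> :: real where "\<delta> = 1 / 10"
  have \<delta>: "\<delta> > 0" by (simp add: \<delta>_def)
  let ?H = "hump_choice p V Q"
  define \<eta> where "\<eta> l = ?H (Suc l) l" for l
  have H: "?H n l = (if l < n then \<eta> l else 0)" for n l
    by (induction n) (auto simp: \<eta>_def less_Suc_eq)
  have \<eta>01: "\<eta> l \<in> {0, 1}" for l unfolding \<eta>_def by simp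
  define P where "P n N x = (\<Sum>l<N. of_real (\<eta> l * \<delta> ^ l) * V n l x)" for n N x
  have Pm[measurable]: "P n N \<in> borel_measurable \<sigma>" for n N unfolding P_def by measurable
  have \<eta>_rec: "\<eta> n = (if sphere_norm \<sigma> p (P n n) \<le> ennreal (\<delta> ^ n * Q n / 2) then 1 else 0)" for n
  proof -
    have "(\<lambda>x. \<Sum>l<n. of_real (?H n l * (1/10) ^ l) * V n l x) = P n n"
      unfolding P_def \<delta>_def by (intro ext sum.cong refl) (simp add: H)
    then show ?thesis unfolding \<eta>_def \<delta>_def by simp
  qed
  have large: "\<not> sphere_norm \<sigma> p (P n (Suc n)) \<le> ennreal (\<delta> ^ n * Q n / 2)" for n
  proof (cases "sphere_norm \<sigma> p (P n n) \<le> ennreal (\<delta> ^ n * Q n / 2)")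
    case False
    then have "P n (Suc n) = P n n" using \<eta>_rec[of n] by (auto simp: P_def)
    then show ?thesis using False by simp
  next
    case True
    then have "P n (Suc n) = (\<lambda>x. P n n x + of_real (\<delta> ^ n) * V n n x)" using \<eta>_rec[of n] by (auto simp: P_def)
    then show ?thesis using sphere_norm_hump[OF p Pm Vm Q _ big, of "\<delta> ^ n" n n n] True \<delta> by simp
  qed
  have "\<not> sphere_norm \<sigma> p h \<le> ennreal ((1/10) ^ n * Q n / 10)"
    if hm[measurable]: "h \<in> borel_measurable \<sigma>" and h: "\<And>x. norm x = 1 \<Longrightarrow> (\<lambda>l. of_real (\<eta> l * (1/10) ^ l) * V n l x) sums h x" for n h
  proof
    assume le: "sphere_norm \<sigma> p h \<le> ennreal ((1/10) ^ n * Q n / 10)"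
    define T where "T x = h x - P n (Suc n) x" for x
    have Tm[measurable]: "T \<in> borel_measurable \<sigma>" unfolding T_def by measurable
    define u where "u l x = of_real (\<eta> (l + Suc n) * \<delta> ^ (l + Suc n)) * V n (l + Suc n) x" for l x
    have "sphere_norm \<sigma> p T \<le> ennreal (2 * Q n * \<delta> ^ Suc n * (1 / (1 - \<delta>)))"
    proof (rule sphere_norm_suminf_le[where u=u and A="\<lambda>l. 2 * Q n * \<delta> ^ Suc n * \<delta> ^ l", OF p])
      show "u l \<in> borel_measurable \<sigma>" for l unfolding u_def by measurable
      show "0 < 2 * Q n * \<delta> ^ Suc n * \<delta> ^ l" for l using Q[of n] \<delta> by simp
      show "(\<lambda>l. 2 * Q n * \<delta> ^ Suc n * \<delta> ^ l) sums (2 * Q n * \<delta> ^ Suc n * (1 / (1 - \<delta>)))"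
        by (intro sums_mult geometric_sums) (simp add: \<delta>_def)
      show "sphere_norm \<sigma> p (u l) \<le> ennreal (2 * Q n * \<delta> ^ Suc n * \<delta> ^ l)" for l
      proof -
        have "sphere_norm \<sigma> p (u l) \<le> sphere_norm \<sigma> p (\<lambda>x. of_real (\<delta> ^ (l + Suc n)) * V n (l + Suc n) x)"
          using \<eta>01[of "l + Suc n"] \<delta> by (intro sphere_norm_mono) (auto simp: u_def norm_mult)
        also have "\<dots> \<le> ennreal (\<delta> ^ (l + Suc n) * (2 * Q n))"
          using \<delta> Q[of n] by (intro sphere_norm_scale_le p small Vm) auto
        also have "\<delta> ^ (l + Suc n) * (2 * Q n) = 2 * Q n * \<delta> ^ Suc n * \<delta> ^ l" by (simp add: power_add)
        finally show ?thesis .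
      qed
      show "(\<lambda>l. u l x) sums T x" if "norm x = 1" for x
        using sums_split_initial_segment[OF h[OF that], of "Suc n"]
        unfolding u_def T_def P_def \<delta>_def by (simp add: lessThan_Suc_atMost)
    qed
    also have "2 * Q n * \<delta> ^ Suc n * (1 / (1 - \<delta>)) = \<delta> ^ n * Q n * (2 / 9)" by (simp add: \<delta>_def)
    finally have T: "sphere_norm \<sigma> p (\<lambda>x. - T x) \<le> ennreal (\<delta> ^ n * Q n * (2 / 9))"
      using sphere_norm_mono[of "\<lambda>x. - T x" T p] by simp
    have "sphere_norm \<sigma> p (\<lambda>x. h x + - T x) \<le> ennreal ((1/10) ^ n * Q n / 10 + \<delta> ^ n * Q n * (2 / 9))"
      by (rule sphere_norm_triangle_le[OF p _ _ _ le _ T]) (use Q[of n] \<delta> in auto)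
    also have "\<dots> \<le> ennreal (\<delta> ^ n * Q n / 2)"
    proof (rule ennreal_leI)
      have "0 < \<delta> ^ n * Q n" using Q[of n] \<delta> by simp
      then show "(1/10) ^ n * Q n / 10 + \<delta> ^ n * Q n * (2 / 9) \<le> \<delta> ^ n * Q n / 2" unfolding \<delta>_def by linarith
    qed
    finally have "sphere_norm \<sigma> p (P n (Suc n)) \<le> ennreal (\<delta> ^ n * Q n / 2)" by (simp add: T_def)
    with large show False by blast
  qed
  with \<eta>01 show ?thesis by (rule that)
qed

lemma coefficients_harmonic_series:
  assumes "series_converges Y c" "j \<in> {1..d k}"
  shows "coefficients Y (harmonic_series Y c) k j = c k j"
proof (rule coefficients_eq[OF _ assms(2)])
  show "harmonic_term Y c x sums harmonic_series Y c x" if "x \<in> ball 0 1" for x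
    using assms(1) that unfolding series_converges_def harmonic_series_def by (auto intro: summable_sums)
qed

end

section \<open>Necessity\<close>

context sphere_multiplier
begin

text \<open>Convergence alone identifies \<open>c\<close> with the coefficients of the sum;
  harmonicity then supplies their growth bound.\<close>

lemma admissible_of_harmonic:
  assumes "series_converges Y c" "harmonic_on (harmonic_series Y c) (ball 0 1)"
  shows "admissible c"
  by (rule admissible_cong[OF harmonic_expansion(1)[OF assms(2)] coefficients_harmonic_series[OF assms(1)]])

text \<open>Tested on one bounded function with positive coefficients of nearly exponential growth rate \<open>1\<close>.\<close>

lemma multiplier_admissible:
  assumes \<alpha>: "0 \<le> \<alpha>" and c: "c \<in> multipliers Y (H_space \<sigma> 1 \<alpha>) (H_space \<sigma> p \<beta>)"
  shows "admissible c"
proof -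
  \<comment> \<open>Small enough that \<open>w k * layer k\<close> is summable, which bounds the
    test function on the whole ball, yet with a subexponential reciprocal, so that dividing the
    coefficients of the image by \<open>w k\<close> keeps them subexponential.\<close>
  define w where "w k = 1 / ((layer k + 1) * (real k + 1)\<^sup>2)" for k
  have wpos: "w k > 0" for k using layer_nonneg[of k] by (simp add: w_def add_pos_nonneg zero_less_power2)
  have w1: "w k \<le> 1" for k
  proof -
    have "1 * 1 \<le> (layer k + 1) * (real k + 1)\<^sup>2" using layer_nonneg[of k] by (intro mult_mono) auto
    then show ?thesis by (simp add: w_def)
  qed
  have ws: "subexponential w" by (rule subexponential_mono[OF subexponential_const[of 1]]) (use wpos w1 in \<open>auto simp: less_imp_le\<close>)
  have wi: "subexponential (\<lambda>k. 1 / w k)"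
  proof -
    have "subexponential (\<lambda>k. layer k + 1)"
      unfolding subexponential_def
    proof (intro allI impI)
      fix r :: real assume r: "0 < r \<and> r < 1"
      obtain C where C: "\<And>k. \<bar>layer k\<bar> * r ^ k \<le> C" using subexponentialE[OF subexponential_layer] r by metis
      have "\<bar>layer k + 1\<bar> * r ^ k \<le> C + 1" for k
      proof -
        have "\<bar>layer k + 1\<bar> * r ^ k = \<bar>layer k\<bar> * r ^ k + r ^ k" using layer_nonneg[of k] by (simp add: distrib_right)
        also have "\<dots> \<le> C + 1" using C[of k] r by (intro add_mono power_le_one) auto
        finally show ?thesis .
      qed
      then show "\<exists>C. \<forall>k. \<bar>layer k + 1\<bar> * r ^ k \<le> C" by blast
    qed
    then have "subexponential (\<lambda>k. (layer k + 1) * ((real k + 1) * (real k + 1)))"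
      by (intro subexponential_mult subexponential_linear) auto
    then show ?thesis by (simp add: w_def power2_eq_square)
  qed
  have wl: "summable (\<lambda>k. w k * layer k)"
  proof (rule summable_comparison_test')
    show "summable (\<lambda>k. 1 / (real k + 1)\<^sup>2)"
      using inverse_power_summable[of 2, where 'a=real] summable_iff_shift[of "\<lambda>k. inverse ((real k)\<^sup>2)" 1]
      by (simp add: divide_inverse add.commute)
    show "norm (w k * layer k) \<le> 1 / (real k + 1)\<^sup>2" for k
    proof -
      have "layer k / (layer k + 1) \<le> 1" using layer_nonneg[of k] by simp
      then have "layer k / (layer k + 1) * (1 / (real k + 1)\<^sup>2) \<le> 1 * (1 / (real k + 1)\<^sup>2)" by (rule mult_right_mono) simp
      then show ?thesis using layer_nonneg[of k] by (simp add: w_def)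
    qed
  qed
  define f where "f = harmonic_series Y (\<lambda>k j. of_real (w k))"
  have wa: "admissible (\<lambda>k j. of_real (w k))" by (rule admissible_const[OF ws])
  define S where "S = (\<Sum>k. w k * layer k)"
  have S0: "S \<ge> 0" unfolding S_def using wl wpos layer_nonneg by (intro suminf_nonneg) (auto simp: less_imp_le)
  have "f \<in> H_space \<sigma> 1 \<alpha>" unfolding H_space_iff
  proof (intro conjI exI[of _ "S * \<omega> + 1"] allI impI)
    show "harmonic_on f (ball 0 1)" unfolding f_def by (rule admissible_harmonic[OF wa])
    show "0 < S * \<omega> + 1" using S0 omega_pos by (simp add: add_nonneg_pos)
    fix r :: real assume r: "0 \<le> r" "r < 1"
    have fb: "cmod (f (r *\<^sub>R x)) \<le> S" if x: "norm x = 1" for x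
      unfolding f_def S_def harmonic_series_polar[OF r(1) x]
    proof (rule sphere_series_sums(2)[OF _ wl x])
      show "norm (of_real (r ^ k) * complex_of_real (w k)) \<le> w k" for k
        using r wpos[of k] by (simp add: norm_mult norm_power mult_left_le_one_le power_le_one less_imp_le)
    qed
    have "(\<integral>\<^sup>+x. ennreal (cmod (f (r *\<^sub>R x))) \<partial>\<sigma>) \<le> (\<integral>\<^sup>+x. ennreal S \<partial>\<sigma>)"
      by (intro nn_integral_mono ennreal_leI fb) simp
    also have "\<dots> = ennreal (S * \<omega>)" using S0 by (simp add: emeasure_eq_measure \<omega>_def ennreal_mult)
    finally have I: "(\<integral>\<^sup>+x. ennreal (cmod (f (r *\<^sub>R x))) \<partial>\<sigma>) \<le> ennreal (S * \<omega>)" .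
    have "mean_p \<sigma> 1 f r \<le> ennreal (S * \<omega>)"
      unfolding mean_p_def using I S0 omega_pos by (subst sphere_norm_le_iff) auto
    also have "\<dots> \<le> ennreal ((S * \<omega> + 1) / (1 - r) powr \<alpha>)"
    proof (rule ennreal_leI)
      have "(1 - r) powr \<alpha> \<le> 1" "0 < (1 - r) powr \<alpha>" using r \<alpha> by (auto intro: powr_le1)
      moreover have "0 \<le> S * \<omega>" using S0 omega_pos by simp
      ultimately show "S * \<omega> \<le> (S * \<omega> + 1) / (1 - r) powr \<alpha>"
        by (simp add: pos_le_divide_eq) (smt (verit) mult_left_le)
    qed
    finally show "mean_p \<sigma> 1 f r \<le> ennreal ((S * \<omega> + 1) / (1 - r) powr \<alpha>)" .
  qed
  with c have s: "series_converges Y (\<lambda>k j. c k j * coefficients Y f k j)"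
    and h: "harmonic_series Y (\<lambda>k j. c k j * coefficients Y f k j) \<in> H_space \<sigma> p \<beta>"
    unfolding multipliers_def by auto
  have b: "admissible (\<lambda>k j. c k j * coefficients Y f k j)"
    by (rule admissible_of_harmonic[OF s]) (use h in \<open>simp add: H_space_iff\<close>)
  have "admissible (\<lambda>k j. of_real (1 / w k) * (c k j * coefficients Y f k j))"
    by (rule admissible_mult[OF admissible_const[OF wi] b])
  then show ?thesis
  proof (rule admissible_cong)
    fix k j assume "j \<in> {1..d k}"
    then have "coefficients Y f k j = of_real (w k)" unfolding f_def by (rule admissible_coefficients[OF wa])
    then show "of_real (1 / w k) * (c k j * coefficients Y f k j) = c k j" using wpos[of k] by simp
  qed
qed

text \<open>For \<open>i = (\<rho>, y)\<close>, the fractional derivative of \<open>x \<mapsto> P\<^sub>y (\<rho> x)\<close>, normalised to be bounded in \<open>H\<^sup>1\<^sub>\<alpha>\<close>.\<close>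

definition test_coeff :: "real \<Rightarrow> real \<Rightarrow> real \<times> 'a \<Rightarrow> nat \<Rightarrow> nat \<Rightarrow> complex" where
  "test_coeff t \<alpha> i k j = of_real ((1 - fst i) powr (t - \<alpha>) * fst i ^ k) * (of_real (frac_factor hd t k) * of_real (Y k j (snd i)))"

text \<open>Majorant of the test coefficients uniform in the index (\<rho>, y): the factors (1 -
  \<rho>)^(t-\<alpha>) and \<rho>^k are at most 1.\<close>

definition test_bound :: "real \<Rightarrow> nat \<Rightarrow> real" where
  "test_bound t k = \<bar>frac_factor hd t k * ymax k\<bar>"

lemma subexponential_test_bound: "t > 0 \<Longrightarrow> subexponential (test_bound t)"
  unfolding test_bound_def
  by (rule subexponential_mono[OF subexponential_mult[OF subexponential_frac_factor[OF hd_pos] subexponential_ymax]]) auto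

lemma test_coeff_bound:
  assumes "\<alpha> \<le> t" "i \<in> {0..<1} \<times> sphere 0 1" "j \<in> {1..d k}"
  shows "norm (test_coeff t \<alpha> i k j) \<le> test_bound t k"
proof -
  have i: "0 \<le> fst i" "fst i < 1" "norm (snd i) = 1" using assms by auto
  have "(1 - fst i) powr (t - \<alpha>) * fst i ^ k \<le> 1 * 1"
    using i assms(1) by (intro mult_mono powr_le1 power_le_one) auto
  then have "norm (test_coeff t \<alpha> i k j) \<le> 1 * (\<bar>frac_factor hd t k\<bar> * \<bar>Y k j (snd i)\<bar>)"
    unfolding test_coeff_def norm_mult norm_of_real using i by (intro mult_mono) auto
  also have "\<dots> \<le> \<bar>frac_factor hd t k\<bar> * ymax k"
    using abs_Y_le_ymax[OF assms(3) i(3)] by (simp add: mult_left_mono)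
  finally show ?thesis using ymax_nonneg[of k] by (simp add: test_bound_def abs_mult)
qed

text \<open>The L^1 norm at radius R is at most C (1 - \<rho>)^(t-\<alpha>) (1 - R \<rho>)^(-t). The
  exponent t is split into t - \<alpha> and \<alpha>: 1 - R \<rho> \<ge> 1 - \<rho> cancels the
  normalisation, and 1 - R \<rho> \<ge> 1 - R gives the weight of the target space.\<close>

lemma test_function_norm:
  assumes t: "t > 0" and \<alpha>: "0 \<le> \<alpha>" "\<alpha> \<le> t"
  shows "\<exists>C>0. \<forall>R i. 0 \<le> R \<longrightarrow> R < 1 \<longrightarrow> i \<in> {0..<1} \<times> sphere 0 1 \<longrightarrow>
    sphere_norm \<sigma> 1 (sphere_series (\<lambda>k j. of_real (R ^ k) * test_coeff t \<alpha> i k j)) \<le> ennreal (C * (1 - R) powr (- \<alpha>))"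
proof -
  from zonal_L1_frac[OF t] obtain C where C0: "C > 0" and C1: "\<forall>r z. 0 \<le> r \<longrightarrow> r < 1 \<longrightarrow> norm z = 1 \<longrightarrow>
     zonal_L1 (frac_factor hd t) r z \<le> ennreal (C * (1 - r) powr (- t))" by (elim exE conjE)
  have "sphere_norm \<sigma> 1 (sphere_series (\<lambda>k j. of_real (R ^ k) * test_coeff t \<alpha> i k j)) \<le> ennreal (C * (1 - R) powr (- \<alpha>))"
    if R: "0 \<le> R" "R < 1" and i: "i \<in> {0..<1} \<times> sphere 0 1" for R i
  proof -
    define \<rho> where "\<rho> = fst i"
    define y where "y = snd i"
    have \<rho>: "0 \<le> \<rho>" "\<rho> < 1" and y: "norm y = 1" using i by (auto simp: \<rho>_def y_def)
    have R\<rho>: "0 \<le> R * \<rho>" "R * \<rho> \<le> R" "R * \<rho> \<le> \<rho>" using R \<rho> by (auto intro!: mult_left_le mult_left_le_one_le)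
    then have R\<rho>1: "R * \<rho> < 1" using R by simp
    define q where "q = (1 - \<rho>) powr (t - \<alpha>)"
    have q: "q \<ge> 0" by (simp add: q_def)
    have fs: "subexponential (frac_factor hd t)" by (rule subexponential_frac_factor[OF hd_pos t])
    have eq: "sphere_series (\<lambda>k j. of_real (R ^ k) * test_coeff t \<alpha> i k j) x = of_real q * zonal (frac_factor hd t) (R * \<rho>) x y" 
      if x: "norm x = 1" for x
    proof -
      have "sphere_series (\<lambda>k j. of_real (R ^ k) * test_coeff t \<alpha> i k j) x = zonal (\<lambda>k. q * frac_factor hd t k) (R * \<rho>) x y"
        unfolding zonal_def
        by (rule sphere_series_cong) (simp add: test_coeff_def q_def \<rho>_def y_def power_mult_distrib mult_ac)
      then show ?thesis using zonal_cmult[OF fs R\<rho>(1) R\<rho>1 x y, of q] by simp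
    qed
    have "(\<integral>\<^sup>+x. ennreal (cmod (sphere_series (\<lambda>k j. of_real (R ^ k) * test_coeff t \<alpha> i k j) x)) \<partial>\<sigma>)
      = (\<integral>\<^sup>+x. ennreal q * ennreal (cmod (zonal (frac_factor hd t) (R * \<rho>) x y)) \<partial>\<sigma>)"
    proof (rule nn_integral_cong)
      fix x assume "x \<in> space \<sigma>"
      then have x: "norm x = 1" by simp
      show "ennreal (cmod (sphere_series (\<lambda>k j. of_real (R ^ k) * test_coeff t \<alpha> i k j) x))
        = ennreal q * ennreal (cmod (zonal (frac_factor hd t) (R * \<rho>) x y))"
        unfolding eq[OF x] norm_mult norm_of_real using q by (simp add: ennreal_mult)
    qed
    also have "\<dots> = ennreal q * zonal_L1 (frac_factor hd t) (R * \<rho>) y"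
      unfolding zonal_L1_def by (rule nn_integral_cmult) (rule measurable_compose[OF zonal_measurable[OF y]], simp)
    also have "\<dots> \<le> ennreal q * ennreal (C * (1 - R * \<rho>) powr (- t))"
      using C1 R\<rho>(1) R\<rho>1 y by (intro mult_left_mono) auto
    also have "\<dots> = ennreal (C * (q * (1 - R * \<rho>) powr (- t)))" using q C0 by (simp add: ennreal_mult[symmetric] mult_ac)
    also have "\<dots> \<le> ennreal (C * (1 - R) powr (- \<alpha>))"
    proof (intro ennreal_leI mult_left_mono)
      have "q * (1 - R * \<rho>) powr (- t) = q * ((1 - R * \<rho>) powr (- (t - \<alpha>)) * (1 - R * \<rho>) powr (- \<alpha>))"
        by (simp add: powr_add[symmetric])
      also have "\<dots> \<le> q * ((1 - \<rho>) powr (- (t - \<alpha>)) * (1 - R) powr (- \<alpha>))"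
        using R \<rho> R\<rho> \<alpha> q by (intro mult_left_mono mult_mono powr_mono2') auto
      also have "\<dots> = (q * (1 - \<rho>) powr (- (t - \<alpha>))) * (1 - R) powr (- \<alpha>)" by simp
      also have "q * (1 - \<rho>) powr (- (t - \<alpha>)) = 1" unfolding q_def using \<rho> by (simp add: powr_add[symmetric])
      finally show "q * (1 - R * \<rho>) powr (- t) \<le> (1 - R) powr (- \<alpha>)" by simp
    qed (use C0 in simp)
    finally have "(\<integral>\<^sup>+x. ennreal (cmod (sphere_series (\<lambda>k j. of_real (R ^ k) * test_coeff t \<alpha> i k j) x)) \<partial>\<sigma>) \<le> ennreal (C * (1 - R) powr (- \<alpha>))" .
    then show ?thesis using C0 by (subst sphere_norm_le_iff) auto
  qed
  then show ?thesis using C0 by blast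
qed

lemma sphere_series_measurable: "sphere_series c \<in> borel_measurable \<sigma>"
  unfolding sphere_series_def by measurable

text \<open>The countable sum over \<open>l\<close> is written as an integral over the counting
  measure, so that \<open>sphere_series_integral\<close> exchanges it with the sum over degrees.
  With \<open>u\<close> equal to 1 it describes a superposition of test functions, with
  \<open>u\<close> the multiplier its image.\<close>

lemma sphere_series_superposition:
  assumes u: "admissible u" and b: "subexponential b" "\<And>l k j. j \<in> {1..d k} \<Longrightarrow> norm (e l k j) \<le> b k"
    and w: "\<And>l. 0 \<le> w l" "summable w"
  defines "X \<equiv> \<lambda>k j. LINT l|count_space UNIV. of_real (w l) * e l k j"
  shows "0 \<le> R \<Longrightarrow> R < 1 \<Longrightarrow> norm x = 1 \<Longrightarrow>
    (\<lambda>l. of_real (w l) * sphere_series (\<lambda>k j. of_real (R ^ k) * (u k j * e l k j)) x)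
      sums sphere_series (\<lambda>k j. of_real (R ^ k) * (u k j * X k j)) x"
    and "admissible X"
proof -
  let ?N = "count_space (UNIV :: nat set)"
  have wi: "integrable ?N w" using w by (simp add: integrable_count_space_nat_iff)
  have ewi: "integrable ?N (\<lambda>l. of_real (w l) * e l k j)" if "j \<in> {1..d k}" for k j
  proof (rule Bochner_Integration.integrable_bound[OF integrable_mult_right[OF wi, of "b k"]])
    show "AE l in ?N. norm (of_real (w l) * e l k j) \<le> norm (b k * w l)"
      using order_trans[OF b(2)[OF that] abs_ge_self] w(1)
      by (auto intro!: AE_I2 simp: norm_mult abs_mult mult.commute mult_left_mono mult_right_mono)
  qed simp
  show "admissible X"
  proof (rule admissibleI[OF subexponential_mult[OF b(1) subexponential_const[of "LINT l|?N. w l"]]])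
    fix k j assume j: "j \<in> {1..d k}"
    have "norm (X k j) \<le> (LINT l|?N. norm (of_real (w l) * e l k j))" unfolding X_def by simp
    also have "\<dots> \<le> (LINT l|?N. b k * w l)"
      using b(2)[OF j] w(1)
      by (intro integral_mono integrable_norm ewi j integrable_mult_right wi) (auto simp: norm_mult mult.commute[of "b k"] mult_left_mono)
    finally show "norm (X k j) \<le> b k * (LINT l|?N. w l)" by simp
  qed
  assume R: "0 \<le> R" "R < 1" and x: "norm x = 1"
  obtain a where a: "subexponential a" "\<And>k j. j \<in> {1..d k} \<Longrightarrow> norm (u k j) \<le> a k"
    using u unfolding admissible_def by blast
  let ?M = "\<lambda>k. \<bar>a k * b k\<bar> * R ^ k"
  have sM: "summable (\<lambda>k. ?M k * layer k)"
    by (intro subexponential_layer_summable subexponential_mult a b R)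
  have bd: "norm (of_real (R ^ k) * (u k j * e l k j)) \<le> ?M k" if j: "j \<in> {1..d k}" for l k j
  proof -
    have "norm (u k j * e l k j) \<le> \<bar>a k\<bar> * \<bar>b k\<bar>"
      unfolding norm_mult
      by (intro mult_mono order_trans[OF a(2)[OF j] abs_ge_self] order_trans[OF b(2)[OF j] abs_ge_self]) auto
    then have "R ^ k * norm (u k j * e l k j) \<le> R ^ k * (\<bar>a k\<bar> * \<bar>b k\<bar>)" using R by (intro mult_left_mono) auto
    then show ?thesis using R by (simp add: norm_mult[of "_ ^ _"] norm_power abs_mult mult.commute)
  qed
  define A where "A l k j = of_real (w l) * (of_real (R ^ k) * (u k j * e l k j))" for l k j
  have Ab: "norm (A l k j) \<le> ?M k * w l" if "j \<in> {1..d k}" for l k j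
    unfolding A_def norm_mult[of "of_real (w l)"] using bd[OF that, of l] w(1)[of l]
    by (simp add: mult.commute[of "w l"] mult_right_mono)
  have int: "integrable ?N (\<lambda>l. sphere_series (A l) x)"
    and eq: "sphere_series (\<lambda>k j. LINT l|?N. A l k j) x = (LINT l|?N. sphere_series (A l) x)"
    by (rule sphere_series_integral[where a=A and M="?M" and W=w, OF _ _ wi sM _ x]; use Ab R in simp)+
  have "sphere_series (\<lambda>k j. LINT l|?N. A l k j) x = sphere_series (\<lambda>k j. of_real (R ^ k) * (u k j * X k j)) x"
  proof (rule sphere_series_cong)
    fix k j
    have "(LINT l|?N. A l k j) = (LINT l|?N. (of_real (R ^ k) * u k j) * (of_real (w l) * e l k j))"
      by (intro Bochner_Integration.integral_cong refl) (simp only: A_def mult_ac)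
    also have "\<dots> = (of_real (R ^ k) * u k j) * X k j" unfolding X_def by (rule integral_mult_right_zero)
    finally show "(LINT l|?N. A l k j) = of_real (R ^ k) * (u k j * X k j)" by (simp only: mult.assoc)
  qed
  moreover have "sphere_series (A l) x = of_real (w l) * sphere_series (\<lambda>k j. of_real (R ^ k) * (u k j * e l k j)) x" for l
    unfolding A_def by (rule sphere_series_mult[where M="?M", OF bd sM x])
  ultimately show "(\<lambda>l. of_real (w l) * sphere_series (\<lambda>k j. of_real (R ^ k) * (u k j * e l k j)) x)
      sums sphere_series (\<lambda>k j. of_real (R ^ k) * (u k j * X k j)) x"
    using sums_integral_count_space_nat[OF int] eq by simp
qed

text \<open>If the bound failed, every n would give a radius R_n and a test function whose image
  there has weighted norm above Q_n, within a factor 2 of the largest possible at that radius. A sum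
  of these test functions with weights 0 or 10^(-l) still lies in the source space, but by
  \<open>gliding_hump\<close> the weighted norms of its image at the radii R_n are
  unbounded.\<close>

lemma multiplier_uniform_bound:
  assumes c: "c \<in> multipliers Y (H_space \<sigma> 1 \<alpha>) (H_space \<sigma> p \<beta>)" 
    and \<alpha>: "0 \<le> \<alpha>" "\<alpha> < t" and p: "1 \<le> p"
  shows "\<exists>K>0. \<forall>R i. 0 \<le> R \<longrightarrow> R < 1 \<longrightarrow> i \<in> {0..<1} \<times> sphere 0 1 \<longrightarrow>
    sphere_norm \<sigma> p (\<lambda>x. of_real ((1 - R) powr \<beta>) * sphere_series (\<lambda>k j. of_real (R ^ k) * (c k j * test_coeff t \<alpha> i k j)) x) \<le> ennreal K"
proof (rule ccontr)
  have t: "t > 0" "\<alpha> \<le> t" using \<alpha> by auto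
  have ca: "admissible c" by (rule multiplier_admissible[OF \<alpha>(1) c])
  let ?I = "{0..<1} \<times> sphere (0::'a) 1"
  define V where "V R i x = of_real ((1 - R) powr \<beta>) * sphere_series (\<lambda>k j. of_real (R ^ k) * (c k j * test_coeff t \<alpha> i k j)) x" for R i x
  define B where "B R = (SUP i\<in>?I. sphere_norm \<sigma> p (V R i))" for R
  assume "\<not> ?thesis"
  then have unb: "\<exists>R i. 0 \<le> R \<and> R < 1 \<and> i \<in> ?I \<and> \<not> sphere_norm \<sigma> p (V R i) \<le> ennreal K" if "K > 0" for K
    using that unfolding V_def[abs_def] by blast
  obtain a where a: "subexponential a" "\<And>k j. j \<in> {1..d k} \<Longrightarrow> norm (c k j) \<le> a k"
    using ca unfolding admissible_def by blast
  \<comment> \<open>At a fixed radius all test functions share the majorant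
    \<open>test_bound t\<close>, so the supremum over them is finite although no bound uniform in
    \<open>R\<close> is known yet.\<close>
  have B_fin: "B R < \<infinity>" if R: "0 \<le> R" "R < 1" for R
  proof -
    let ?M = "\<lambda>k. \<bar>a k * test_bound t k\<bar> * R ^ k"
    have sM: "summable (\<lambda>k. ?M k * layer k)"
      by (intro subexponential_layer_summable subexponential_mult a subexponential_test_bound t R)
    define D where "D = (1 - R) powr \<beta> * (\<Sum>k. ?M k * layer k)"
    have "cmod (V R i x) \<le> D" if i: "i \<in> ?I" and x: "norm x = 1" for i x
    proof -
      have "cmod (sphere_series (\<lambda>k j. of_real (R ^ k) * (c k j * test_coeff t \<alpha> i k j)) x) \<le> (\<Sum>k. ?M k * layer k)"
      proof (rule sphere_series_sums(2)[OF _ sM x])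
        fix k j assume j: "j \<in> {1..d k}"
        have "norm (c k j * test_coeff t \<alpha> i k j) \<le> \<bar>a k\<bar> * \<bar>test_bound t k\<bar>"
          unfolding norm_mult
          by (intro mult_mono order_trans[OF a(2)[OF j] abs_ge_self] order_trans[OF test_coeff_bound[OF t(2) i j] abs_ge_self]) auto
        then have "R ^ k * norm (c k j * test_coeff t \<alpha> i k j) \<le> R ^ k * (\<bar>a k\<bar> * \<bar>test_bound t k\<bar>)" using R by (intro mult_left_mono) auto
        then show "norm (of_real (R ^ k) * (c k j * test_coeff t \<alpha> i k j)) \<le> ?M k"
          using R by (simp add: norm_mult[of "_ ^ _"] norm_power abs_mult mult.commute)
      qed
      then show ?thesis unfolding V_def D_def norm_mult norm_of_real by (simp add: mult_left_mono)
    qed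
    then have "B R \<le> sphere_norm \<sigma> p (\<lambda>_. of_real D)"
      unfolding B_def by (intro SUP_least sphere_norm_mono) (auto intro: order_trans[OF _ abs_ge_self])
    also have "\<dots> < \<infinity>" by (rule sphere_norm_bounded[OF p, of _ "\<bar>D\<bar>"]) simp
    finally show ?thesis .
  qed
  have step: "\<forall>n. \<exists>q. 0 \<le> fst q \<and> fst q < 1 \<and> fst (snd q) \<in> ?I \<and> 40 * (real n + 1) * 10 ^ n \<le> snd (snd q) \<and>
    \<not> sphere_norm \<sigma> p (V (fst q) (fst (snd q))) \<le> ennreal (snd (snd q)) \<and>
    (\<forall>i\<in>?I. sphere_norm \<sigma> p (V (fst q) i) \<le> ennreal (2 * snd (snd q)))"
  proof
    fix n :: nat
    \<comment> \<open>Q_n will be half of the supremum \<open>s\<close>, which exceeds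
      \<open>L\<close>, hence 80 is twice 40. With 40 the bound
      \<open>(1/10) ^ n * Qn n / 10\<close> of the gliding hump is at least 4 (n + 1), so it
      outgrows every constant.\<close>
    define L where "L = 80 * (real n + 1) * 10 ^ n"
    have L: "L > 0" by (simp add: L_def)
    from unb[OF L] obtain R i0 where R: "0 \<le> R" "R < 1" and i0: "i0 \<in> ?I" and big: "\<not> sphere_norm \<sigma> p (V R i0) \<le> ennreal L"
      by blast
    obtain s where s: "s \<ge> 0" "B R = ennreal s" using B_fin[OF R] by (cases "B R") auto
    have le: "sphere_norm \<sigma> p (V R i) \<le> ennreal s" if "i \<in> ?I" for i
      unfolding s(2)[symmetric] B_def using that by (rule SUP_upper)
    have sL: "L < s"
    proof (rule ccontr)
      assume "\<not> L < s"
      then have "ennreal s \<le> ennreal L" by (intro ennreal_leI) simp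
      with le[OF i0] big show False by auto
    qed
    have "ennreal (s / 2) < B R" unfolding s(2) using sL L by (intro ennreal_lessI) auto
    then obtain i where i: "i \<in> ?I" "ennreal (s / 2) < sphere_norm \<sigma> p (V R i)" unfolding B_def less_SUP_iff by blast
    then show "\<exists>q. 0 \<le> fst q \<and> fst q < 1 \<and> fst (snd q) \<in> ?I \<and> 40 * (real n + 1) * 10 ^ n \<le> snd (snd q) \<and>
      \<not> sphere_norm \<sigma> p (V (fst q) (fst (snd q))) \<le> ennreal (snd (snd q)) \<and>
      (\<forall>i\<in>?I. sphere_norm \<sigma> p (V (fst q) i) \<le> ennreal (2 * snd (snd q)))"
      by (intro exI[of _ "(R, i, s / 2)"]) (use R i le sL in \<open>auto simp: L_def not_le algebra_simps\<close>)
  qed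
  obtain q where q: "\<And>n. 0 \<le> fst (q n) \<and> fst (q n) < 1 \<and> fst (snd (q n)) \<in> ?I \<and> 40 * (real n + 1) * 10 ^ n \<le> snd (snd (q n)) \<and>
    \<not> sphere_norm \<sigma> p (V (fst (q n)) (fst (snd (q n)))) \<le> ennreal (snd (snd (q n))) \<and>
    (\<forall>i\<in>?I. sphere_norm \<sigma> p (V (fst (q n)) i) \<le> ennreal (2 * snd (snd (q n))))"
    using choice[OF step] by (elim exE) (rule that, erule spec)
  define Rn where "Rn n = fst (q n)" for n
  define In where "In n = fst (snd (q n))" for n
  define Qn where "Qn n = snd (snd (q n))" for n
  have Rn: "0 \<le> Rn n" "Rn n < 1" and In: "In n \<in> ?I" and Qn: "40 * (real n + 1) * 10 ^ n \<le> Qn n"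
    and big: "\<not> sphere_norm \<sigma> p (V (Rn n) (In n)) \<le> ennreal (Qn n)"
    and small: "sphere_norm \<sigma> p (V (Rn n) (In l)) \<le> ennreal (2 * Qn n)" for n l
    using q[of n] q[of l] unfolding Rn_def In_def Qn_def by auto
  have Qpos: "Qn n > 0" for n
    by (rule less_le_trans[OF _ Qn]) simp
  have Vm: "V R i \<in> borel_measurable \<sigma>" for R i
    unfolding V_def by (intro borel_measurable_times borel_measurable_const sphere_series_measurable)
  obtain \<eta> :: "nat \<Rightarrow> real" where \<eta>: "\<And>l. \<eta> l \<in> {0, 1}"
    "\<And>n h. h \<in> borel_measurable \<sigma> \<Longrightarrow> (\<And>x. norm x = 1 \<Longrightarrow> (\<lambda>l. of_real (\<eta> l * (1/10) ^ l) * V (Rn n) (In l) x) sums h x) \<Longrightarrow>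
       \<not> sphere_norm \<sigma> p h \<le> ennreal ((1/10) ^ n * Qn n / 10)"
    by (rule gliding_hump[OF p, where V="\<lambda>n l. V (Rn n) (In l)" and Q=Qn]) (use Vm Qpos big small in auto)
  define w where "w l = \<eta> l * (1/10) ^ l" for l
  have w: "0 \<le> w l" "w l \<le> (1/10) ^ l" for l using \<eta>(1)[of l] by (auto simp: w_def)
  have ws: "summable w"
    by (rule summable_comparison_test'[OF summable_geometric[of "1/10"]]) (use w in auto)
  define X where "X k j = (LINT l|count_space UNIV. of_real (w l) * test_coeff t \<alpha> (In l) k j)" for k j
  note sup = sphere_series_superposition[where b="test_bound t" and e="\<lambda>l. test_coeff t \<alpha> (In l)" and w=w, 
      OF _ subexponential_test_bound[OF t(1)] test_coeff_bound[OF t(2) In] w(1) ws, folded X_def]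
  have Xa: "admissible X" by (rule sup(2)[OF ca])
  define f where "f = harmonic_series Y X"
  obtain C where C0: "C > 0" and C1: "\<forall>R i. 0 \<le> R \<longrightarrow> R < 1 \<longrightarrow> i \<in> ?I \<longrightarrow>
    sphere_norm \<sigma> 1 (sphere_series (\<lambda>k j. of_real (R ^ k) * test_coeff t \<alpha> i k j)) \<le> ennreal (C * (1 - R) powr (- \<alpha>))"
    using test_function_norm[OF t(1) \<alpha>(1) t(2)] by (elim exE conjE)
  have "f \<in> H_space \<sigma> 1 \<alpha>" unfolding H_space_iff
  proof (intro conjI exI[of _ "C * (10 / 9)"] allI impI)
    show "harmonic_on f (ball 0 1)" unfolding f_def by (rule admissible_harmonic[OF Xa])
    show "0 < C * (10 / 9)" using C0 by simp
    fix R :: real assume R: "0 \<le> R" "R < 1"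
    define F where "F l = sphere_series (\<lambda>k j. of_real (R ^ k) * test_coeff t \<alpha> (In l) k j)" for l
    have "mean_p \<sigma> 1 f R \<le> ennreal (C * (1 - R) powr (- \<alpha>) * (1 / (1 - 1 / 10)))"
      unfolding mean_p_def
    proof (rule sphere_norm_suminf_le[where u="\<lambda>l x. of_real (w l) * F l x" and A="\<lambda>l. C * (1 - R) powr (- \<alpha>) * (1/10) ^ l"])
      show "(\<lambda>x. of_real (w l) * F l x) \<in> borel_measurable \<sigma>" for l
        unfolding F_def by (intro borel_measurable_times borel_measurable_const sphere_series_measurable)
      show "0 < C * (1 - R) powr (- \<alpha>) * (1/10) ^ l" for l using C0 R by simp
      show "(\<lambda>l. C * (1 - R) powr (- \<alpha>) * (1/10) ^ l) sums (C * (1 - R) powr (- \<alpha>) * (1 / (1 - 1 / 10)))"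
        by (intro sums_mult geometric_sums) simp
      show "sphere_norm \<sigma> 1 (\<lambda>x. of_real (w l) * F l x) \<le> ennreal (C * (1 - R) powr (- \<alpha>) * (1/10) ^ l)" for l
      proof -
        have "sphere_norm \<sigma> 1 (\<lambda>x. of_real (w l) * F l x) \<le> sphere_norm \<sigma> 1 (\<lambda>x. of_real ((1/10) ^ l) * F l x)"
          unfolding norm_mult[symmetric] using w[of l]
          by (intro sphere_norm_mono) (simp only: norm_mult norm_of_real, intro mult_right_mono, auto)
        also have "\<dots> \<le> ennreal ((1/10) ^ l * (C * (1 - R) powr (- \<alpha>)))"
          using C1 R In[of l] C0 by (intro sphere_norm_scale_le) (auto simp: F_def sphere_series_measurable)
        finally show ?thesis by (simp only: mult.commute)
      qed
      show "(\<lambda>l. of_real (w l) * F l x) sums f (R *\<^sub>R x)" if x: "norm x = 1" for x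
        unfolding f_def harmonic_series_polar[OF R(1) x] F_def
        using sup(1)[OF admissible_const[OF subexponential_const[of 1]] _ R x] by (simp only: of_real_1 mult_1_left)
    qed simp
    then show "mean_p \<sigma> 1 f R \<le> ennreal (C * (10 / 9) / (1 - R) powr \<alpha>)"
      by (simp add: powr_minus_divide mult.commute[of 9])
  qed
  with c have "harmonic_series Y (\<lambda>k j. c k j * coefficients Y f k j) \<in> H_space \<sigma> p \<beta>"
    unfolding multipliers_def by auto
  moreover have "harmonic_series Y (\<lambda>k j. c k j * coefficients Y f k j) = harmonic_series Y (\<lambda>k j. c k j * X k j)"
    by (rule harmonic_series_cong) (simp only: f_def admissible_coefficients[OF Xa])
  ultimately obtain K where K: "K > 0" 
    "\<And>r. 0 \<le> r \<Longrightarrow> r < 1 \<Longrightarrow> mean_p \<sigma> p (harmonic_series Y (\<lambda>k j. c k j * X k j)) r \<le> ennreal (K / (1 - r) powr \<beta>)"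
    unfolding H_space_iff by auto
  obtain n where n: "K < real n" using reals_Archimedean2 by blast
  define h where "h x = of_real ((1 - Rn n) powr \<beta>) * sphere_series (\<lambda>k j. of_real (Rn n ^ k) * (c k j * X k j)) x" for x
  have "\<not> sphere_norm \<sigma> p h \<le> ennreal ((1/10) ^ n * Qn n / 10)"
  proof (rule \<eta>(2))
    show "h \<in> borel_measurable \<sigma>"
      unfolding h_def by (intro borel_measurable_times borel_measurable_const sphere_series_measurable)
    fix x :: 'a assume x: "norm x = 1"
    show "(\<lambda>l. of_real (\<eta> l * (1/10) ^ l) * V (Rn n) (In l) x) sums h x"
      using sums_mult[OF sup(1)[OF ca _ Rn x], of "of_real ((1 - Rn n) powr \<beta>)" n]
      unfolding V_def h_def w_def by (simp only: mult.left_commute)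
  qed
  moreover have "sphere_norm \<sigma> p h \<le> ennreal K"
  proof -
    have "sphere_norm \<sigma> p (sphere_series (\<lambda>k j. of_real (Rn n ^ k) * (c k j * X k j))) = mean_p \<sigma> p (harmonic_series Y (\<lambda>k j. c k j * X k j)) (Rn n)"
      unfolding mean_p_def by (rule sphere_norm_cong) (simp only: harmonic_series_polar[OF Rn(1)])
    then have "sphere_norm \<sigma> p (sphere_series (\<lambda>k j. of_real (Rn n ^ k) * (c k j * X k j))) \<le> ennreal (K / (1 - Rn n) powr \<beta>)"
      using K(2)[OF Rn] by simp
    then have "sphere_norm \<sigma> p h \<le> ennreal ((1 - Rn n) powr \<beta> * (K / (1 - Rn n) powr \<beta>))"
      unfolding h_def using Rn[of n] K(1) by (intro sphere_norm_scale_le p sphere_series_measurable) auto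
    then show ?thesis using Rn[of n] by simp
  qed
  moreover have "ennreal K \<le> ennreal ((1/10) ^ n * Qn n / 10)"
  proof (rule ennreal_leI)
    have "(1/10) ^ n * (40 * (real n + 1) * 10 ^ n) \<le> (1/10) ^ n * Qn n"
      by (intro mult_left_mono Qn) simp
    then show "K \<le> (1/10) ^ n * Qn n / 10" using n by (simp add: power_divide)
  qed
  ultimately show False by (meson order_trans)
qed

lemma multiplier_necessary:
  assumes c: "c \<in> multipliers Y (H_space \<sigma> 1 \<alpha>) (H_space \<sigma> p \<beta>)" 
    and \<alpha>: "0 \<le> \<alpha>" and m: "\<alpha> - 1 < m" and p: "1 \<le> p" and \<beta>: "0 < \<beta>"
  shows "N_p \<sigma> Y m \<alpha> \<beta> p (harmonic_series Y c) < \<infinity>"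
proof -
  define t where "t = m + 1"
  have t: "t > 0" "\<alpha> < t" and m1: "m > -1" using m \<alpha> by (auto simp: t_def)
  have ca: "admissible c" by (rule multiplier_admissible[OF \<alpha> c])
  define e where "e = m + 1 - \<alpha> + \<beta>"
  have e: "e > 0" "e = \<beta> + (t - \<alpha>)" using m \<beta> by (auto simp: e_def t_def)
  obtain K where K0: "K > 0" and K1: "\<forall>R i. 0 \<le> R \<longrightarrow> R < 1 \<longrightarrow> i \<in> {0..<1} \<times> sphere (0::'a) 1 \<longrightarrow>
    sphere_norm \<sigma> p (\<lambda>x. of_real ((1 - R) powr \<beta>) * sphere_series (\<lambda>k j. of_real (R ^ k) * (c k j * test_coeff t \<alpha> i k j)) x) \<le> ennreal K"
    using multiplier_uniform_bound[OF c \<alpha> t(2) p] by (elim exE conjE)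
  have "sphere_norm \<sigma> p (\<lambda>x. kern t c \<rho> x y) \<le> ennreal (2 powr e * K / (1 - \<rho>) powr e)"
    if \<rho>: "0 \<le> \<rho>" "\<rho> < 1" and y: "norm y = 1" for \<rho> y
  proof -
    \<comment> \<open>The test function with index (R, y) is evaluated at radius R: the radii
      multiply to \<rho>, and the weights (1 - R)^\<beta> and (1 - R)^(t-\<alpha>) to (1 -
      R)^e.\<close>
    define R where "R = sqrt \<rho>"
    have R: "0 \<le> R" "R < 1" "R * R = \<rho>" using \<rho> by (auto simp: R_def)
    have Rp: "(1 - R) powr e > 0" using R by simp
    obtain M where M: "\<And>k j. j \<in> {1..d k} \<Longrightarrow> norm (of_real (\<rho> ^ k) * (of_real (frac_factor hd t k) * (c k j * of_real (Y k j y)))) \<le> M k"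
      "summable (\<lambda>k. M k * layer k)"
      using admissible_dominated[OF admissible_kern[OF ca t(1) y] \<rho>] by metis
    define v where "v x = of_real ((1 - R) powr \<beta>) * sphere_series (\<lambda>k j. of_real (R ^ k) * (c k j * test_coeff t \<alpha> (R, y) k j)) x" for x
    have v: "v x = of_real ((1 - R) powr e) * kern t c \<rho> x y" if x: "norm x = 1" for x
    proof -
      have "sphere_series (\<lambda>k j. of_real (R ^ k) * (c k j * test_coeff t \<alpha> (R, y) k j)) x =
        sphere_series (\<lambda>k j. of_real ((1 - R) powr (t - \<alpha>)) * (of_real (\<rho> ^ k) * (of_real (frac_factor hd t k) * (c k j * of_real (Y k j y))))) x"
        by (rule sphere_series_cong) (simp add: test_coeff_def R(3)[symmetric] power_mult_distrib mult_ac)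
      also have "\<dots> = of_real ((1 - R) powr (t - \<alpha>)) * kern t c \<rho> y x"
        unfolding kern_def
        by (rule sphere_series_mult[where c="\<lambda>k j. of_real (\<rho> ^ k) * (of_real (frac_factor hd t k) * (c k j * of_real (Y k j y)))", OF M x])
      finally have "v x = of_real ((1 - R) powr \<beta> * (1 - R) powr (t - \<alpha>)) * kern t c \<rho> x y"
        unfolding v_def kern_symmetric[of t c \<rho> x y] by simp
      then show ?thesis by (simp only: powr_add[symmetric] e(2))
    qed
    have "sphere_norm \<sigma> p (\<lambda>x. kern t c \<rho> x y) = sphere_norm \<sigma> p (\<lambda>x. of_real (1 / (1 - R) powr e) * v x)"
      using R by (intro sphere_norm_cong) (simp add: v)
    also have "\<dots> \<le> ennreal (1 / (1 - R) powr e * K)"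
    proof (rule sphere_norm_scale_le[OF p])
      show "v \<in> borel_measurable \<sigma>"
        unfolding v_def by (intro borel_measurable_times borel_measurable_const sphere_series_measurable)
      show "sphere_norm \<sigma> p v \<le> ennreal K"
        using K1 R y unfolding v_def[abs_def] by auto
    qed (use Rp K0 in auto)
    also have "\<dots> \<le> ennreal (2 powr e * K / (1 - \<rho>) powr e)"
    proof (rule ennreal_leI)
      have "(1 - R) powr (- e) * K \<le> (2 powr e * (1 - \<rho>) powr (- e)) * K"
        unfolding R_def using K0 e \<rho> by (intro mult_right_mono sqrt_powr_le) auto
      then show "1 / (1 - R) powr e * K \<le> 2 powr e * K / (1 - \<rho>) powr e"
        by (simp add: powr_minus_divide)
    qed
    finally show ?thesis .
  qed
  then show ?thesis
    unfolding N_p_finite_iff[OF ca m1] t_def[symmetric] using K0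
    by (intro exI[of _ "2 powr e * K"]) (auto simp: e_def t_def)
qed

end

theorem theorem5:
  fixes \<sigma> :: "(real ^ 'n) measure"
    and Y :: "nat \<Rightarrow> nat \<Rightarrow> real ^ 'n \<Rightarrow> real"
    and c :: "nat \<Rightarrow> nat \<Rightarrow> complex"
    and \<kappa> \<alpha> \<beta> m :: real
    and p :: ennreal
  assumes "2 \<le> CARD('n)"
    and "0 < \<kappa>" and "\<sigma> = scale_measure (ennreal \<kappa>) surface_measure"
    and "spherical_harmonic_basis \<sigma> Y"
    and "0 \<le> \<alpha>" and "0 < \<beta>" and "1 \<le> p" and "\<alpha> - 1 < m"
  shows "c \<in> multipliers Y (H_space \<sigma> 1 \<alpha>) (H_space \<sigma> p \<beta>) \<longleftrightarrow>
    series_converges Y c \<and> harmonic_on (harmonic_series Y c) (ball 0 1) \<and>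
    N_p \<sigma> Y m \<alpha> \<beta> p (harmonic_series Y c) < \<infinity>"
proof -
  interpret sphere_multiplier \<sigma> \<kappa> Y "sph_dim TYPE(real ^ 'n)" "real DIM(real ^ 'n) / 2"
    using assms(1-4) by unfold_locales auto
  show ?thesis
  proof
    assume c: "c \<in> multipliers Y (H_space \<sigma> 1 \<alpha>) (H_space \<sigma> p \<beta>)"
    have ca: "admissible c" by (rule multiplier_admissible[OF assms(5) c])
    show "series_converges Y c \<and> harmonic_on (harmonic_series Y c) (ball 0 1) \<and>
      N_p \<sigma> Y m \<alpha> \<beta> p (harmonic_series Y c) < \<infinity>"
      using admissible_series_converges[OF ca] admissible_harmonic[OF ca] 
        multiplier_necessary[OF c assms(5,8,7,6)] by blast
  next
    assume g: "series_converges Y c \<and> harmonic_on (harmonic_series Y c) (ball 0 1) \<and>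
      N_p \<sigma> Y m \<alpha> \<beta> p (harmonic_series Y c) < \<infinity>"
    then have ca: "admissible c" by (intro admissible_of_harmonic) auto
    show "c \<in> multipliers Y (H_space \<sigma> 1 \<alpha>) (H_space \<sigma> p \<beta>)"
      by (rule multiplier_sufficient[OF ca assms(8,5,6,7)]) (use g in blast)
  qed
qed

end
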